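(* There are group isomorphisms as follows, for the models defined in the context. (a) For every field $F$: $B_1(F)\cong \mathrm{PSL}_2(F)$ and $C_1(F)\cong\mathrm{PSL}_2(F)$. (b) For every finite field $F$ (including $|F|=2$): $B_2(F)\cong C_2(F)$. (c) For every field $F$: $D_2(F)\cong \mathrm{PSL}_2(F)\times\mathrm{PSL}_2(F)$. (d) For every finite field $F$: $D_3(F)\cong\mathrm{PSL}_4(F)$. (e) For every finite field $F$ of characteristic two and every $r\ge1$: $B_r(F)\cong C_r(F)$.
   Context: For a quadratic form $Q$ on a finite-dimensional $F$-vector space with polar form $B(x,y)=Q(x+y)-Q(x)-Q(y)$, a Siegel transformation is a map $x\mapsto x+B(x,u)w-B(x,w)u-Q(w)B(x,u)u$, where $u\ne0$, $Q(u)=0$, $B(u,w)=0$. The projective model of $Q$ is the group generated by all Siegel transformations, divided by its subgroup of scalar transformations. $B_r(F)$ is the projective model of $\sum_{i=1}^r x_iy_i+z^2$ on $F^{2r+1}$; $D_r(F)$ is the projective model of $\sum_{i=1}^r x_iy_i$ on $F^{2r}$; $C_r(F)=\mathrm{PSp}_{2r}(F)=\mathrm{Sp}_{2r}(F)/Z(\mathrm{Sp}_{2r}(F))$ for the standard nondegenerate alternating form on $F^{2r}$; $\mathrm{PSL}_n(F)=\mathrm{SL}_n(F)/Z(\mathrm{SL}_n(F))$. *)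

theory Defs
  imports
    "Jordan_Normal_Form.Determinant"
    "HOL-Algebra.Bij"
    "HOL-Algebra.Coset"
    "HOL-Algebra.Generated_Groups"
begin

section \<open>Projective models of quadratic forms\<close>

text \<open>
  The space \<open>F^n\<close> is \<^term>\<open>carrier_vec n\<close>, with coordinates indexed by \<open>0, \<dots>, n - 1\<close>.
  Transformations of it are elements of the group \<^const>\<open>BijGroup\<close> of extensional bijections,
  hence the bounded abstractions below.
\<close>

definition polar_form :: "('a :: field vec \<Rightarrow> 'a) \<Rightarrow> 'a vec \<Rightarrow> 'a vec \<Rightarrow> 'a" where
  "polar_form Q x y = Q (x + y) - Q x - Q y"

definition siegel_map ::
    "nat \<Rightarrow> ('a :: field vec \<Rightarrow> 'a) \<Rightarrow> 'a vec \<Rightarrow> 'a vec \<Rightarrow> 'a vec \<Rightarrow> 'a vec" where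
  "siegel_map n Q u w =
     (\<lambda>x\<in>carrier_vec n. x + polar_form Q x u \<cdot>\<^sub>v w - polar_form Q x w \<cdot>\<^sub>v u
                          - (Q w * polar_form Q x u) \<cdot>\<^sub>v u)"

definition siegel_transformations ::
    "nat \<Rightarrow> ('a :: field vec \<Rightarrow> 'a) \<Rightarrow> ('a vec \<Rightarrow> 'a vec) set" where
  "siegel_transformations n Q =
     {siegel_map n Q u w | u w.
        u \<in> carrier_vec n \<and> w \<in> carrier_vec n \<and> u \<noteq> 0\<^sub>v n \<and> Q u = 0 \<and> polar_form Q u w = 0}"

definition siegel_group ::
    "nat \<Rightarrow> ('a :: field vec \<Rightarrow> 'a) \<Rightarrow> ('a vec \<Rightarrow> 'a vec) monoid" where
  "siegel_group n Q =
     (BijGroup (carrier_vec n))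
       \<lparr>carrier := generate (BijGroup (carrier_vec n)) (siegel_transformations n Q)\<rparr>"

definition scalar_maps :: "nat \<Rightarrow> ('a :: field vec \<Rightarrow> 'a vec) set" where
  "scalar_maps n = {(\<lambda>x\<in>carrier_vec n. c \<cdot>\<^sub>v x) | c. True}"

definition projective_model ::
    "nat \<Rightarrow> ('a :: field vec \<Rightarrow> 'a) \<Rightarrow> ('a vec \<Rightarrow> 'a vec) set monoid" where
  "projective_model n Q = siegel_group n Q Mod (carrier (siegel_group n Q) \<inter> scalar_maps n)"

text \<open>
  Coordinates are ordered as \<open>x\<^sub>1, \<dots>, x\<^sub>r, y\<^sub>1, \<dots>, y\<^sub>r\<close>, followed by \<open>z\<close> in the odd-dimensional case.
\<close>

definition hyperbolic_form :: "nat \<Rightarrow> 'a :: field vec \<Rightarrow> 'a" where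
  "hyperbolic_form r v = (\<Sum>i<r. v $ i * v $ (r + i))"

definition odd_form :: "nat \<Rightarrow> 'a :: field vec \<Rightarrow> 'a" where
  "odd_form r v = (\<Sum>i<r. v $ i * v $ (r + i)) + (v $ (2 * r))\<^sup>2"

definition B_model :: "'a :: field itself \<Rightarrow> nat \<Rightarrow> ('a vec \<Rightarrow> 'a vec) set monoid" where
  "B_model F r = projective_model (2 * r + 1) (odd_form r)"

definition D_model :: "'a :: field itself \<Rightarrow> nat \<Rightarrow> ('a vec \<Rightarrow> 'a vec) set monoid" where
  "D_model F r = projective_model (2 * r) (hyperbolic_form r)"

section \<open>Projective linear and symplectic groups\<close>

definition group_center :: "('a, 'b) monoid_scheme \<Rightarrow> 'a set" where
  "group_center G = {z \<in> carrier G. \<forall>g\<in>carrier G. z \<otimes>\<^bsub>G\<^esub> g = g \<otimes>\<^bsub>G\<^esub> z}"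

definition GL :: "'a :: field itself \<Rightarrow> nat \<Rightarrow> 'a mat monoid" where
  "GL F n = units_of (ring_mat F n ())"

definition SL :: "'a :: field itself \<Rightarrow> nat \<Rightarrow> 'a mat monoid" where
  "SL F n = (GL F n)\<lparr>carrier := {A \<in> carrier (GL F n). det A = 1}\<rparr>"

definition PSL :: "'a :: field itself \<Rightarrow> nat \<Rightarrow> 'a mat set monoid" where
  "PSL F n = SL F n Mod group_center (SL F n)"

definition alternating_form :: "nat \<Rightarrow> 'a :: field vec \<Rightarrow> 'a vec \<Rightarrow> 'a" where
  "alternating_form r x y = (\<Sum>i<r. x $ i * y $ (r + i) - x $ (r + i) * y $ i)"

definition Sp :: "'a :: field itself \<Rightarrow> nat \<Rightarrow> 'a mat monoid" \<comment> \<open>the argument is the rank \<open>r\<close>,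
    the matrices have size \<open>2 * r\<close>\<close> where
  "Sp F r = (GL F (2 * r))
     \<lparr>carrier := {A \<in> carrier (GL F (2 * r)).
        \<forall>x\<in>carrier_vec (2 * r). \<forall>y\<in>carrier_vec (2 * r).
          alternating_form r (A *\<^sub>v x) (A *\<^sub>v y) = alternating_form r x y}\<rparr>"

definition C_model :: "'a :: field itself \<Rightarrow> nat \<Rightarrow> 'a mat set monoid" where
  "C_model F r = Sp F r Mod group_center (Sp F r)"

end

(*
  A quadratic space that embeds linearly into matrices by maps M, M' with M x M' x = M' x M x = Q(x) turns the Siegel
  transformation of (u, w) into X |-> (1 - M u M' w) X (1 - M' w M u).  Trace zero 2x2 matrices, all 2x2 matrices,
  alternating 4x4 matrices, and those orthogonal to the matrix of the symplectic form realise B_1, D_2, D_3 and B_2 in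
  this way over SL_2, SL_2 x SL_2, SL_4 and Sp_4.  The linear groups are generated by transvections, which act as Siegel
  transformations; conversely 1 - M u M' w lies in the linear group, so the images agree, and the elements acting as
  scalars are exactly the central ones.  In characteristic two the form B_r is nondegenerate modulo a one-dimensional
  radical, and over a finite field a symplectic map lifts uniquely to an isometry because squaring is bijective.
*)

theory Submission
  imports Defs
begin

section \<open>Projective models as quotients of linear groups\<close>

text \<open>The two-sided shape of the action comes from u^2 = 0 and u w = - w u: these make 1 - w u
  the inverse of 1 - u w, so the left factor is one diagonal block of 1 - u w and the right factor
  is the inverse of the other block. The models divide by whatever scalar maps happen to lie in the
  Siegel group; hence the kernel is first described as the set of elements that act as scalars, and
  the comparison with the centre is a separate computation for each group. Comparing generators
  instead of orders treats all fields alike, down to the field with two elements. In the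
  characteristic two family the rank is arbitrary and matrices of a spin module would have size
  exponential in the rank; there the action is built on the vectors themselves, by correcting the
  last coordinate of a symplectic image so that the value of the form is kept.\<close>

lemma action_hom_BijGroup:
  fixes G (structure)
  assumes G: "group G"
    and closed: "\<And>g x. g \<in> carrier G \<Longrightarrow> x \<in> V \<Longrightarrow> act g x \<in> V"
    and mult: "\<And>g h x. g \<in> carrier G \<Longrightarrow> h \<in> carrier G \<Longrightarrow> x \<in> V
                \<Longrightarrow> act (g \<otimes>\<^bsub>G\<^esub> h) x = act g (act h x)"
    and one: "\<And>x. x \<in> V \<Longrightarrow> act \<one>\<^bsub>G\<^esub> x = x"
  shows "(\<lambda>g. \<lambda>x\<in>V. act g x) \<in> hom G (BijGroup V)"
proof -
  interpret group G by fact
  have cancel: "act g (act (inv g) x) = x" "act (inv g) (act g x) = x"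
    if "g \<in> carrier G" "x \<in> V" for g x
    using that mult[of g "inv g" x] mult[of "inv g" g x] one by auto
  have bij: "(\<lambda>x\<in>V. act g x) \<in> Bij V" if g: "g \<in> carrier G" for g
  proof -
    have "bij_betw (act g) V V"
    proof (rule bij_betwI[where g = "act (inv g)"])
      show "act g \<in> V \<rightarrow> V" "act (inv g) \<in> V \<rightarrow> V"
        using closed[OF g] closed[OF inv_closed[OF g]] by blast+
    qed (rule cancel[OF g], assumption)+
    then have "bij_betw (\<lambda>x\<in>V. act g x) V V"
      by (rule iffD1[OF bij_betw_cong, rotated]) simp
    then show ?thesis by (simp add: Bij_def)
  qed
  show ?thesis
  proof (rule homI)
    fix g assume "g \<in> carrier G"
    then show "(\<lambda>x\<in>V. act g x) \<in> carrier (BijGroup V)"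
      using bij by (simp add: BijGroup_def)
  next
    fix g h assume gh: "g \<in> carrier G" "h \<in> carrier G"
    show "(\<lambda>x\<in>V. act (g \<otimes> h) x) = (\<lambda>x\<in>V. act g x) \<otimes>\<^bsub>BijGroup V\<^esub> (\<lambda>x\<in>V. act h x)"
      using gh bij closed mult by (auto simp: BijGroup_def compose_def fun_eq_iff)
  qed
qed

text \<open>The criterion behind most of the isomorphisms. The conditions on \<open>S\<close> put
  the image of \<open>G\<close> inside the Siegel group, the condition \<open>siegel\<close> gives
  the reverse inclusion, and \<open>Z\<close> is the kernel of the resulting map onto the quotient.
  Homogeneity makes scalar maps commute with the group, so dividing by them is legitimate.\<close>

lemma projective_model_iso:
  fixes Q :: "'a :: field vec \<Rightarrow> 'a"
  assumes G: "group G"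
    and hom: "\<phi> \<in> hom G (BijGroup (carrier_vec n))"
    and gen: "S \<subseteq> carrier G" "carrier G \<subseteq> generate G S"
    and S: "\<phi> ` S \<subseteq> siegel_transformations n Q"
    and siegel: "siegel_transformations n Q \<subseteq> \<phi> ` carrier G"
    and homog: "\<And>g c x. g \<in> carrier G \<Longrightarrow> x \<in> carrier_vec n \<Longrightarrow> \<phi> g (c \<cdot>\<^sub>v x) = c \<cdot>\<^sub>v \<phi> g x"
    and Z: "\<And>g. g \<in> carrier G \<Longrightarrow> g \<in> Z \<longleftrightarrow> \<phi> g \<in> scalar_maps n" "Z \<subseteq> carrier G"
  shows "projective_model n Q \<cong> G Mod Z"
proof -
  let ?V = "carrier_vec n :: 'a vec set"
  let ?B = "BijGroup ?V"
  let ?K = "siegel_group n Q"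
  let ?N = "carrier ?K \<inter> scalar_maps n"
  interpret G: group G by fact
  interpret B: group ?B by (rule group_BijGroup)
  interpret h: group_hom G ?B \<phi>
    using hom by (simp add: group_hom_def group_hom_axioms_def G B.group_axioms)
  have genG: "generate G S = carrier G"
    using gen G.generate_incl[OF gen(1)] by blast
  have "generate ?B (siegel_transformations n Q) = \<phi> ` carrier G"
  proof
    have "subgroup (\<phi> ` carrier G) ?B" by (rule h.img_is_subgroup)
    then show "generate ?B (siegel_transformations n Q) \<subseteq> \<phi> ` carrier G"
      by (rule B.generate_subgroup_incl[OF siegel])
    have "\<phi> ` carrier G = generate ?B (\<phi> ` S)"
      using h.generate_img[OF gen(1)] genG by simp
    also have "\<dots> \<subseteq> generate ?B (siegel_transformations n Q)"
      by (rule B.mono_generate[OF S])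
    finally show "\<phi> ` carrier G \<subseteq> generate ?B (siegel_transformations n Q)" .
  qed
  then have K: "?K = ?B\<lparr>carrier := \<phi> ` carrier G\<rparr>"
    by (simp add: siegel_group_def)
  then have carK: "carrier ?K = \<phi> ` carrier G" and multK: "mult ?K = mult ?B" and oneK: "\<one>\<^bsub>?K\<^esub> = \<one>\<^bsub>?B\<^esub>"
    by simp_all
  interpret K: group ?K
    unfolding K using B.subgroup_imp_group[OF h.img_is_subgroup] by simp
  have Bij: "f \<in> Bij ?V" if "f \<in> carrier ?K" for f
    using that h.hom_closed by (auto simp: carK BijGroup_def)
  have in_V: "f x \<in> ?V" if "f \<in> carrier ?K" "x \<in> ?V" for f x
    using Bij[OF that(1)] that(2) Bij_imp_funcset by blast
  have ext: "f \<in> extensional ?V" if "f \<in> carrier ?K" for f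
    using Bij[OF that] Bij_imp_extensional by blast
  have mult: "(f \<otimes>\<^bsub>?K\<^esub> g) x = f (g x)" if "f \<in> carrier ?K" "g \<in> carrier ?K" "x \<in> ?V" for f g x
    using Bij[OF that(1)] Bij[OF that(2)] that by (simp add: multK BijGroup_def compose_def)
  have one: "\<one>\<^bsub>?K\<^esub> x = x" if "x \<in> ?V" for x
    using that by (simp add: oneK BijGroup_def)
  have sm: "f (c \<cdot>\<^sub>v x) = c \<cdot>\<^sub>v f x" if "f \<in> carrier ?K" "x \<in> ?V" for f c x
    using that homog by (auto simp: carK)
  have scal: "f \<in> scalar_maps n \<longleftrightarrow> (\<exists>c. \<forall>x\<in>?V. f x = c \<cdot>\<^sub>v x)" if "f \<in> carrier ?K" for f
    unfolding scalar_maps_def using ext[OF that]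
    by (auto simp: fun_eq_iff extensional_def)
  have "?N \<lhd> ?K"
    unfolding K.normal_inv_iff
  proof (intro conjI ballI)
    show "subgroup ?N ?K"
    proof
      show "?N \<subseteq> carrier ?K" by blast
      show "\<one>\<^bsub>?K\<^esub> \<in> ?N"
        by (simp add: scal) (rule exI[of _ 1], simp add: one)
    next
      fix f g assume f: "f \<in> ?N" and g: "g \<in> ?N"
      obtain c d where "\<forall>x\<in>?V. f x = c \<cdot>\<^sub>v x" "\<forall>x\<in>?V. g x = d \<cdot>\<^sub>v x"
        using f g scal by (metis IntD1 IntD2)
      then have "\<forall>x\<in>?V. (f \<otimes>\<^bsub>?K\<^esub> g) x = (c * d) \<cdot>\<^sub>v x"
        using f g by (simp add: mult smult_smult_assoc)
      then show "f \<otimes>\<^bsub>?K\<^esub> g \<in> ?N" using f g scal[of "f \<otimes>\<^bsub>?K\<^esub> g"] by blast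
    next
      fix f assume f: "f \<in> ?N"
      obtain c where c: "\<forall>x\<in>?V. f x = c \<cdot>\<^sub>v x" using f scal by (metis IntD1 IntD2)
      let ?i = "inv\<^bsub>?K\<^esub> f"
      have i: "?i \<in> carrier ?K" using f by blast
      have e: "x = c \<cdot>\<^sub>v ?i x" if x: "x \<in> ?V" for x
        using mult[of f ?i x] f i x c in_V[OF i x] one[OF x] by (simp add: K.r_inv)
      have "\<exists>d. \<forall>x\<in>?V. ?i x = d \<cdot>\<^sub>v x"
      \<comment> \<open>\<open>scalar_maps\<close> admits the factor 0. It is bijective only on the
        zero space, where the inverse is multiplication by 1 as well.\<close>
      proof (cases "c = 0")
        case False
        have "?i x = inverse c \<cdot>\<^sub>v x" if "x \<in> ?V" for x
          using e[OF that] False in_V[OF i that]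
          by (metis left_inverse one_smult_vec smult_smult_assoc)
        then show ?thesis by blast
      next
        case True
        have "0 \<cdot>\<^sub>v v = 0\<^sub>v n" if "v \<in> ?V" for v :: "'a vec"
          using that by auto
        then have "x = 0\<^sub>v n" if "x \<in> ?V" for x
          using e[OF that] True in_V[OF i that] by simp
        then have "\<forall>x\<in>?V. ?i x = 1 \<cdot>\<^sub>v x" using in_V[OF i] by (metis one_smult_vec)
        then show ?thesis by blast
      qed
      then show "?i \<in> ?N" using i scal[OF i] by blast
    qed
  next
    fix f g assume f: "f \<in> carrier ?K" and g: "g \<in> ?N"
    obtain c where c: "\<forall>x\<in>?V. g x = c \<cdot>\<^sub>v x" using g scal by (metis IntD1 IntD2)
    have gK: "g \<in> carrier ?K" using g by blast
    have "f \<otimes>\<^bsub>?K\<^esub> g = g \<otimes>\<^bsub>?K\<^esub> f"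
    proof (rule extensionalityI[of _ ?V])
      show "f \<otimes>\<^bsub>?K\<^esub> g \<in> extensional ?V" "g \<otimes>\<^bsub>?K\<^esub> f \<in> extensional ?V"
        using f gK by (auto intro: ext)
      fix x assume "x \<in> ?V"
      then show "(f \<otimes>\<^bsub>?K\<^esub> g) x = (g \<otimes>\<^bsub>?K\<^esub> f) x"
        using f gK c in_V by (simp add: mult sm)
    qed
    then have "f \<otimes>\<^bsub>?K\<^esub> g \<otimes>\<^bsub>?K\<^esub> inv\<^bsub>?K\<^esub> f = g"
      using f gK K.m_assoc by (metis K.inv_closed K.r_inv K.r_one)
    then show "f \<otimes>\<^bsub>?K\<^esub> g \<otimes>\<^bsub>?K\<^esub> inv\<^bsub>?K\<^esub> f \<in> ?N" using g by simp
  qed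
  then interpret N: normal ?N ?K .
  interpret P: group "?K Mod ?N" by (rule N.factorgroup_is_group)
  define \<psi> where "\<psi> g = ?N #>\<^bsub>?K\<^esub> \<phi> g" for g
  have "\<phi> \<in> hom G ?K"
    using hom by (auto simp: hom_def carK multK)
  then have "(\<lambda>a. ?N #>\<^bsub>?K\<^esub> a) \<circ> \<phi> \<in> hom G (?K Mod ?N)"
    by (rule hom_compose[OF _ N.r_coset_hom_Mod])
  then have \<psi>: "group_hom G (?K Mod ?N) \<psi>"
    by (simp add: group_hom_def group_hom_axioms_def G P.group_axioms \<psi>_def[abs_def] comp_def)
  have "\<psi> ` carrier G = carrier (?K Mod ?N)"
    by (auto simp: \<psi>_def carrier_FactGroup carK)
  then have "G Mod (kernel G (?K Mod ?N) \<psi>) \<cong> ?K Mod ?N"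
    by (rule group_hom.FactGroup_iso[OF \<psi>])
  moreover have "kernel G (?K Mod ?N) \<psi> = Z"
  proof -
    have "\<psi> g = ?N \<longleftrightarrow> g \<in> Z" if g: "g \<in> carrier G" for g
    proof -
      have gK: "\<phi> g \<in> carrier ?K" using g by (simp add: carK)
      have "\<psi> g = ?N \<longleftrightarrow> \<phi> g \<in> ?N"
        unfolding \<psi>_def using K.coset_join1[OF _ gK N.subgroup_axioms] K.coset_join2[OF gK N.subgroup_axioms]
          N.subset by blast
      then show ?thesis using Z(1)[OF g] gK by blast
    qed
    then show ?thesis using Z(2) by (auto simp: kernel_def)
  qed
  ultimately have "G Mod Z \<cong> ?K Mod ?N" by simp
  then show ?thesis
    unfolding projective_model_def
    using group.iso_sym[of "G Mod Z"] \<open>kernel G (?K Mod ?N) \<psi> = Z\<close>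
      normal.factorgroup_is_group[OF group_hom.normal_kernel[OF \<psi>]] by simp
qed

section \<open>Siegel transformations through matrix factorizations of the form\<close>

text \<open>\<open>M\<close> and \<open>M'\<close> are the off-diagonal blocks of a Clifford module:
  the block matrix with \<open>M x\<close> and \<open>M' x\<close> off the diagonal squares to
  \<open>Q x\<close>. Two maps allow the two half-spin modules to differ.\<close>

locale clifford_pair =
  fixes N n :: nat
    and Q :: "'a :: field vec \<Rightarrow> 'a"
    and M M' :: "'a vec \<Rightarrow> 'a mat"
  assumes M_carrier: "x \<in> carrier_vec N \<Longrightarrow> M x \<in> carrier_mat n n"
    and M'_carrier: "x \<in> carrier_vec N \<Longrightarrow> M' x \<in> carrier_mat n n"
    and M_add: "x \<in> carrier_vec N \<Longrightarrow> y \<in> carrier_vec N \<Longrightarrow> M (x + y) = M x + M y"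
    and M_smult: "x \<in> carrier_vec N \<Longrightarrow> M (c \<cdot>\<^sub>v x) = c \<cdot>\<^sub>m M x"
    and M'_add: "x \<in> carrier_vec N \<Longrightarrow> y \<in> carrier_vec N \<Longrightarrow> M' (x + y) = M' x + M' y"
    and M_inj: "x \<in> carrier_vec N \<Longrightarrow> y \<in> carrier_vec N \<Longrightarrow> M x = M y \<Longrightarrow> x = y"
    and M_M': "x \<in> carrier_vec N \<Longrightarrow> M x * M' x = Q x \<cdot>\<^sub>m 1\<^sub>m n"
    and M'_M: "x \<in> carrier_vec N \<Longrightarrow> M' x * M x = Q x \<cdot>\<^sub>m 1\<^sub>m n"
begin

text \<open>The Clifford relation x y + y x = B(x, y) in both diagonal blocks, obtained by expanding
  the product at \<open>x + y\<close>.\<close>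

lemma polar:
  assumes x: "x \<in> carrier_vec N" and y: "y \<in> carrier_vec N"
  shows "M x * M' y + M y * M' x = polar_form Q x y \<cdot>\<^sub>m 1\<^sub>m n"
    and "M' x * M y + M' y * M x = polar_form Q x y \<cdot>\<^sub>m 1\<^sub>m n"
proof -
  have c: "M x \<in> carrier_mat n n" "M y \<in> carrier_mat n n" "M' x \<in> carrier_mat n n" "M' y \<in> carrier_mat n n"
    using x y M_carrier M'_carrier by auto
  have xy: "x + y \<in> carrier_vec N" using x y by simp
  have "Q (x + y) \<cdot>\<^sub>m 1\<^sub>m n = (M x + M y) * (M' x + M' y)"
    using M_M'[OF xy] M_add M'_add x y by simp
  also have "\<dots> = (M x * M' x + M y * M' x) + (M x * M' y + M y * M' y)"
    using c by (simp add: mult_add_distrib_mat[of _ n n _ n] add_mult_distrib_mat[of _ n n _ _ n])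
  also have "\<dots> = (Q x \<cdot>\<^sub>m 1\<^sub>m n + M y * M' x) + (M x * M' y + Q y \<cdot>\<^sub>m 1\<^sub>m n)"
    using M_M' x y by simp
  finally have e: "Q (x + y) \<cdot>\<^sub>m 1\<^sub>m n = (Q x \<cdot>\<^sub>m 1\<^sub>m n + M y * M' x) + (M x * M' y + Q y \<cdot>\<^sub>m 1\<^sub>m n)" .
  show "M x * M' y + M y * M' x = polar_form Q x y \<cdot>\<^sub>m 1\<^sub>m n"
  proof (rule eq_matI)
    fix i j assume "i < dim_row (polar_form Q x y \<cdot>\<^sub>m 1\<^sub>m n)" "j < dim_col (polar_form Q x y \<cdot>\<^sub>m 1\<^sub>m n)"
    then show "(M x * M' y + M y * M' x) $$ (i, j) = (polar_form Q x y \<cdot>\<^sub>m 1\<^sub>m n) $$ (i, j)"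
      using arg_cong[OF e, of "\<lambda>A. A $$ (i, j)"] c
      by (simp add: polar_form_def algebra_simps del: index_mult_mat(1) split: if_splits)
  qed (use c in auto)
  have "Q (x + y) \<cdot>\<^sub>m 1\<^sub>m n = (M' x + M' y) * (M x + M y)"
    using M'_M[OF xy] M_add M'_add x y by simp
  also have "\<dots> = (M' x * M x + M' y * M x) + (M' x * M y + M' y * M y)"
    using c by (simp add: mult_add_distrib_mat[of _ n n _ n] add_mult_distrib_mat[of _ n n _ _ n])
  also have "\<dots> = (Q x \<cdot>\<^sub>m 1\<^sub>m n + M' y * M x) + (M' x * M y + Q y \<cdot>\<^sub>m 1\<^sub>m n)"
    using M'_M x y by simp
  finally have e: "Q (x + y) \<cdot>\<^sub>m 1\<^sub>m n = (Q x \<cdot>\<^sub>m 1\<^sub>m n + M' y * M x) + (M' x * M y + Q y \<cdot>\<^sub>m 1\<^sub>m n)" .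
  show "M' x * M y + M' y * M x = polar_form Q x y \<cdot>\<^sub>m 1\<^sub>m n"
  proof (rule eq_matI)
    fix i j assume "i < dim_row (polar_form Q x y \<cdot>\<^sub>m 1\<^sub>m n)" "j < dim_col (polar_form Q x y \<cdot>\<^sub>m 1\<^sub>m n)"
    then show "(M' x * M y + M' y * M x) $$ (i, j) = (polar_form Q x y \<cdot>\<^sub>m 1\<^sub>m n) $$ (i, j)"
      using arg_cong[OF e, of "\<lambda>A. A $$ (i, j)"] c
      by (simp add: polar_form_def algebra_simps del: index_mult_mat(1) split: if_splits)
  qed (use c in auto)
qed

lemma polar_swap:
  assumes x: "x \<in> carrier_vec N" and y: "y \<in> carrier_vec N"
  shows "M x * M' y = polar_form Q x y \<cdot>\<^sub>m 1\<^sub>m n - M y * M' x"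
    and "M' x * M y = polar_form Q x y \<cdot>\<^sub>m 1\<^sub>m n - M' y * M x"
proof -
  have c: "M x \<in> carrier_mat n n" "M y \<in> carrier_mat n n" "M' x \<in> carrier_mat n n" "M' y \<in> carrier_mat n n"
    using x y M_carrier M'_carrier by auto
  show "M x * M' y = polar_form Q x y \<cdot>\<^sub>m 1\<^sub>m n - M y * M' x"
    using c by (subst polar(1)[OF x y, symmetric]) (auto intro!: eq_matI simp del: index_mult_mat(1))
  show "M' x * M y = polar_form Q x y \<cdot>\<^sub>m 1\<^sub>m n - M' y * M x"
    using c by (subst polar(2)[OF x y, symmetric]) (auto intro!: eq_matI simp del: index_mult_mat(1))
qed

lemma polar_form_commute: "x \<in> carrier_vec N \<Longrightarrow> y \<in> carrier_vec N \<Longrightarrow> polar_form Q x y = polar_form Q y x"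
  by (simp add: polar_form_def comm_add_vec[of x N y])

text \<open>In Clifford-algebra terms the Siegel transformation of \<open>u, w\<close> is conjugation by \<open>1 - u w\<close>.\<close>

lemma M_siegel_map:
  assumes u: "u \<in> carrier_vec N" "Q u = 0" and w: "w \<in> carrier_vec N" and uw: "polar_form Q u w = 0"
    and x: "x \<in> carrier_vec N"
  shows "M (siegel_map N Q u w x) = (1\<^sub>m n - M u * M' w) * M x * (1\<^sub>m n - M' w * M u)"
proof -
  define U U' W W' X X' where d: "U = M u" "U' = M' u" "W = M w" "W' = M' w" "X = M x" "X' = M' x"
  define a b where "a = polar_form Q x u" and "b = polar_form Q x w"
  note carriers = M_carrier[OF u(1)] M'_carrier[OF u(1)] M_carrier[OF w] M'_carrier[OF w] M_carrier[OF x] M'_carrier[OF x]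
  note c = carriers[folded d]
  note asc = assoc_mult_mat[of _ n n _ n _ n]
  note dist = mult_minus_distrib_mat[of _ n n _ n] minus_mult_distrib_mat[of _ n n _ _ n]
    mult_smult_distrib[of _ n n _ n] mult_smult_assoc_mat[of _ n n _ n]
  have UW': "U * W' = - (W * U')" and U'W: "U' * W = - (W' * U)"
    using polar_swap[OF u(1) w] c by (auto simp: uw d intro!: eq_matI)
  have XU': "U * X' = a \<cdot>\<^sub>m 1\<^sub>m n - X * U'" and X'U: "X' * U = a \<cdot>\<^sub>m 1\<^sub>m n - U' * X"
    using polar_swap(1)[OF u(1) x] polar_swap(2)[OF x u(1)] polar_form_commute[OF u(1) x]
    by (simp_all add: a_def d)
  have W'X: "W' * X = b \<cdot>\<^sub>m 1\<^sub>m n - X' * W"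
    using polar_swap(2)[OF w x] polar_form_commute[OF w x] by (simp add: b_def d)
  have UU': "U * U' = 0\<^sub>m n n" and U'U: "U' * U = 0\<^sub>m n n"
    using M_M'[OF u(1)] M'_M[OF u(1)] u(2) by (auto simp: d intro!: eq_matI)
  have WW': "W * W' = Q w \<cdot>\<^sub>m 1\<^sub>m n"
    using M_M'[OF w] by (simp add: d)
  \<comment> \<open>\<open>U\<close> is moved to the far right by anticommutation. The term
    \<open>X * (W' * U)\<close> that this leaves cancels against the one produced by the right
    factor \<open>1 - W' U\<close>.\<close>
  have UW'X: "U * (W' * X) = b \<cdot>\<^sub>m U - (a \<cdot>\<^sub>m W + X * (W' * U))"
  proof -
    have "U * (W' * X) = b \<cdot>\<^sub>m U - U * X' * W"
      using c by (simp add: W'X dist asc)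
    also have "U * X' * W = a \<cdot>\<^sub>m W - X * (U' * W)"
      using c by (simp add: XU' dist asc)
    also have "\<dots> = a \<cdot>\<^sub>m W + X * (W' * U)"
      using c by (simp add: U'W) (auto intro!: eq_matI simp del: index_mult_mat(1))
    finally show ?thesis .
  qed
  have UW'U: "U * (W' * U) = 0\<^sub>m n n"
  proof -
    have "U * (W' * U) = U * W' * U" using c by (simp add: asc)
    also have "\<dots> = - (W * (U' * U))" using c by (simp add: UW' asc)
    finally show ?thesis using c by (auto simp: U'U)
  qed
  have UX'U: "U * (X' * U) = a \<cdot>\<^sub>m U"
  proof -
    have "U * (X' * U) = a \<cdot>\<^sub>m U - U * U' * X"
      using c by (simp add: X'U dist asc)
    then show ?thesis using c by (auto simp: UU' intro!: eq_matI)
  qed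
  \<comment> \<open>This product is the source of the quadratic term of a Siegel map: moving
    \<open>X\<close> to the left brings \<open>W\<close> next to \<open>W'\<close>, which
    contributes \<open>Q w\<close>.\<close>
  have UW'XW'U: "U * (W' * (X * (W' * U))) = - ((Q w * a) \<cdot>\<^sub>m U)"
  proof -
    have "W' * (X * (W' * U)) = W' * X * (W' * U)" using c by (simp add: asc)
    also have "\<dots> = b \<cdot>\<^sub>m (W' * U) - X' * (W * W') * U"
      using c by (simp add: W'X dist asc)
    also have "\<dots> = b \<cdot>\<^sub>m (W' * U) - Q w \<cdot>\<^sub>m (X' * U)"
      using c by (simp add: WW' dist)
    finally have "U * (W' * (X * (W' * U))) = b \<cdot>\<^sub>m (U * (W' * U)) - Q w \<cdot>\<^sub>m (U * (X' * U))"
      using c by (simp add: dist)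
    then show ?thesis using c by (simp add: UW'U UX'U) (auto intro!: eq_matI)
  qed
  have "(1\<^sub>m n - U * W') * X * (1\<^sub>m n - W' * U) = (X - U * (W' * X)) - (X * (W' * U) - U * (W' * (X * (W' * U))))"
    using c by (simp add: dist asc minus_carrier_mat)
  also have "\<dots> = X + a \<cdot>\<^sub>m W + (- b) \<cdot>\<^sub>m U + (- (Q w * a)) \<cdot>\<^sub>m U"
    unfolding UW'X UW'XW'U using c by (auto intro!: eq_matI simp del: index_mult_mat(1))
  also have "\<dots> = M (x + a \<cdot>\<^sub>v w + (- b) \<cdot>\<^sub>v u + (- (Q w * a)) \<cdot>\<^sub>v u)"
    using u w x M_carrier by (simp add: M_add M_smult d assoc_add_mat[of _ n n])
  also have "x + a \<cdot>\<^sub>v w + (- b) \<cdot>\<^sub>v u + (- (Q w * a)) \<cdot>\<^sub>v u = siegel_map N Q u w x"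
    unfolding siegel_map_def restrict_apply if_P[OF x] a_def[symmetric] b_def[symmetric]
    using u w x by (intro eq_vecI) simp_all
  finally show ?thesis unfolding d by simp
qed

end

context clifford_pair begin

text \<open>\<open>\<alpha>\<close> and \<open>\<beta>\<close> describe an action \<open>X \<mapsto> \<alpha>(g) X \<beta>(g)\<close> of \<open>G\<close> on the image of \<open>M\<close>, so \<open>\<beta>\<close> is an antihomomorphism.\<close>

theorem projective_model_iso_action:
  fixes \<alpha> \<beta> :: "'g \<Rightarrow> 'a mat" and G (structure)
  assumes G: "group G"
    and car: "\<And>g. g \<in> carrier G \<Longrightarrow> \<alpha> g \<in> carrier_mat n n \<and> \<beta> g \<in> carrier_mat n n"
    and hom: "\<And>g h. g \<in> carrier G \<Longrightarrow> h \<in> carrier G \<Longrightarrow> \<alpha> (g \<otimes> h) = \<alpha> g * \<alpha> h \<and> \<beta> (g \<otimes> h) = \<beta> h * \<beta> g"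
    and one: "\<alpha> \<one> = 1\<^sub>m n" "\<beta> \<one> = 1\<^sub>m n"
    and stable: "\<And>g x. g \<in> carrier G \<Longrightarrow> x \<in> carrier_vec N \<Longrightarrow> \<exists>y\<in>carrier_vec N. M y = \<alpha> g * M x * \<beta> g"
    and siegel: "\<And>u w. u \<in> carrier_vec N \<Longrightarrow> w \<in> carrier_vec N \<Longrightarrow> Q u = 0 \<Longrightarrow> polar_form Q u w = 0
            \<Longrightarrow> \<exists>g\<in>carrier G. \<alpha> g = 1\<^sub>m n - M u * M' w \<and> \<beta> g = 1\<^sub>m n - M' w * M u"
    and gen: "S \<subseteq> carrier G" "carrier G \<subseteq> generate G S"
    and S: "\<And>s. s \<in> S \<Longrightarrow> \<exists>u w. u \<in> carrier_vec N \<and> w \<in> carrier_vec N \<and> u \<noteq> 0\<^sub>v N \<and> Q u = 0 \<and> polar_form Q u w = 0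
            \<and> \<alpha> s = 1\<^sub>m n - M u * M' w \<and> \<beta> s = 1\<^sub>m n - M' w * M u"
    and Z: "\<And>g. g \<in> carrier G \<Longrightarrow> g \<in> Z \<longleftrightarrow> (\<exists>c. \<forall>x\<in>carrier_vec N. \<alpha> g * M x * \<beta> g = c \<cdot>\<^sub>m M x)" "Z \<subseteq> carrier G"
  shows "projective_model N Q \<cong> G Mod Z"
proof -
  let ?V = "carrier_vec N :: 'a vec set"
  interpret group G by fact
  \<comment> \<open>The action is transported from matrices to vectors by choice;
    \<open>stable\<close> gives existence and \<open>M_inj\<close> uniqueness.\<close>
  define act where "act g x = (SOME y. y \<in> ?V \<and> M y = \<alpha> g * M x * \<beta> g)" for g x
  have act: "act g x \<in> ?V" "M (act g x) = \<alpha> g * M x * \<beta> g" if "g \<in> carrier G" "x \<in> ?V" for g x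
    using someI_ex[of "\<lambda>y. y \<in> ?V \<and> M y = \<alpha> g * M x * \<beta> g"] stable[OF that] unfolding act_def by blast+
  have act_eqI: "act g x = y" if "g \<in> carrier G" "x \<in> ?V" "y \<in> ?V" "M y = \<alpha> g * M x * \<beta> g" for g x y
    using M_inj[of "act g x" y] that act by simp
  define \<phi> where "\<phi> = (\<lambda>g. \<lambda>x\<in>?V. act g x)"
  have ext: "\<phi> g = f \<longleftrightarrow> (\<forall>x\<in>?V. act g x = f x)" if "f \<in> extensional ?V" for g f
    using that by (auto simp: \<phi>_def fun_eq_iff extensional_def)
  have assoc: "a * b * X * (c * d) = a * (b * X * c) * d"
    if "a \<in> carrier_mat n n" "b \<in> carrier_mat n n" "X \<in> carrier_mat n n" "c \<in> carrier_mat n n" "d \<in> carrier_mat n n"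
    for a b c d X :: "'a mat"
    using that by (simp add: assoc_mult_mat[of _ n n _ n _ n])
  show ?thesis
  proof (rule projective_model_iso[of G \<phi> N S Q Z])
    show "\<phi> \<in> hom G (BijGroup ?V)"
      unfolding \<phi>_def
    proof (rule action_hom_BijGroup[OF G])
      fix g h x assume g: "g \<in> carrier G" "h \<in> carrier G" "x \<in> ?V"
      show "act (g \<otimes> h) x = act g (act h x)"
        using g car[of g] car[of h] M_carrier[OF g(3)]
        by (intro act_eqI) (simp_all add: act hom assoc)
    next
      fix x assume x: "x \<in> ?V"
      show "act \<one> x = x" using x M_carrier[OF x] by (intro act_eqI) (simp_all add: one)
    qed (rule act)
    show "\<phi> ` S \<subseteq> siegel_transformations N Q"
    proof clarify
      fix s assume s: "s \<in> S"
      obtain u w where uw: "u \<in> ?V" "w \<in> ?V" "u \<noteq> 0\<^sub>v N" "Q u = 0" "polar_form Q u w = 0"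
        and e: "\<alpha> s = 1\<^sub>m n - M u * M' w" "\<beta> s = 1\<^sub>m n - M' w * M u"
        using S[OF s] by blast
      have "\<phi> s = siegel_map N Q u w"
      proof (subst ext)
        show "siegel_map N Q u w \<in> extensional ?V" by (simp add: siegel_map_def)
        show "\<forall>x\<in>?V. act s x = siegel_map N Q u w x"
          using s gen(1) uw by (auto intro!: act_eqI simp: M_siegel_map e) (auto simp: siegel_map_def)
      qed
      then show "\<phi> s \<in> siegel_transformations N Q"
        using uw unfolding siegel_transformations_def by blast
    qed
    show "siegel_transformations N Q \<subseteq> \<phi> ` carrier G"
    proof
      fix f assume "f \<in> siegel_transformations N Q"
      then obtain u w where uw: "u \<in> ?V" "w \<in> ?V" "u \<noteq> 0\<^sub>v N" "Q u = 0" "polar_form Q u w = 0"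
        and f: "f = siegel_map N Q u w"
        unfolding siegel_transformations_def by blast
      obtain g where g: "g \<in> carrier G" "\<alpha> g = 1\<^sub>m n - M u * M' w" "\<beta> g = 1\<^sub>m n - M' w * M u"
        using siegel uw by blast
      have "\<phi> g = f"
      proof (subst ext)
        show "f \<in> extensional ?V" by (simp add: f siegel_map_def)
        show "\<forall>x\<in>?V. act g x = f x"
          using g uw unfolding f by (auto intro!: act_eqI simp: M_siegel_map) (auto simp: siegel_map_def)
      qed
      then show "f \<in> \<phi> ` carrier G" using g by blast
    qed
    show "\<phi> g (c \<cdot>\<^sub>v x) = c \<cdot>\<^sub>v \<phi> g x" if "g \<in> carrier G" "x \<in> ?V" for g c x
      using that car[of g] M_carrier[OF that(2)] unfolding \<phi>_def
      by (auto intro!: act_eqI simp: act M_smult mult_smult_distrib[of _ n n _ n] mult_smult_assoc_mat[of _ n n _ n])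
    fix g assume g: "g \<in> carrier G"
    have "(\<exists>c. \<forall>x\<in>?V. \<alpha> g * M x * \<beta> g = c \<cdot>\<^sub>m M x) \<longleftrightarrow> (\<exists>c. \<forall>x\<in>?V. act g x = c \<cdot>\<^sub>v x)"
    proof -
      have "\<alpha> g * M x * \<beta> g = c \<cdot>\<^sub>m M x \<longleftrightarrow> act g x = c \<cdot>\<^sub>v x" if x: "x \<in> ?V" for c x
      proof
        assume "\<alpha> g * M x * \<beta> g = c \<cdot>\<^sub>m M x"
        then show "act g x = c \<cdot>\<^sub>v x" using g x by (intro act_eqI) (simp_all add: M_smult)
      next
        assume "act g x = c \<cdot>\<^sub>v x"
        then show "\<alpha> g * M x * \<beta> g = c \<cdot>\<^sub>m M x" using act(2)[OF g x] x by (simp add: M_smult)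
      qed
      then show ?thesis by blast
    qed
    also have "\<dots> \<longleftrightarrow> \<phi> g \<in> scalar_maps N"
      unfolding scalar_maps_def by (auto simp: ext)
    finally show "g \<in> Z \<longleftrightarrow> \<phi> g \<in> scalar_maps N" using Z(1)[OF g] by simp
  qed (use G gen Z(2) in auto)
qed

end

section \<open>Generators and centres of the special linear and symplectic groups\<close>

lemma carrier_SL: "carrier (SL TYPE('a :: field) n) = {A \<in> carrier_mat n n. det A = 1}"
proof -
  have "A \<in> Units (ring_mat TYPE('a) n ())" if "A \<in> carrier_mat n n" "det A = 1" for A
    by (rule det_non_zero_imp_unit) (use that in auto)
  then show ?thesis
    by (auto simp: SL_def GL_def units_of_def Units_def ring_mat_simps)
qed

lemma mult_SL [simp]: "A \<otimes>\<^bsub>SL TYPE('a :: field) n\<^esub> B = A * B"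
  by (simp add: SL_def GL_def units_of_def ring_mat_simps)

lemma one_SL [simp]: "\<one>\<^bsub>SL TYPE('a :: field) n\<^esub> = 1\<^sub>m n"
  by (simp add: SL_def GL_def units_of_def ring_mat_simps)

lemma carrier_GL: "carrier (GL TYPE('a :: field) n) = {A \<in> carrier_mat n n. \<exists>B\<in>carrier_mat n n. B * A = 1\<^sub>m n}"
  using mat_mult_left_right_inverse
  by (auto simp: GL_def units_of_def Units_def ring_mat_simps)

lemma group_SL: "group (SL TYPE('a :: field) n)"
proof (rule groupI)
  fix x assume "x \<in> carrier (SL TYPE('a) n)"
  then have x: "x \<in> carrier_mat n n" "det x = 1" by (auto simp: carrier_SL)
  then have "x \<in> carrier (GL TYPE('a) n)"
    using det_non_zero_imp_unit[of x n "()"] by (simp add: GL_def units_of_def)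
  then obtain y where y: "y \<in> carrier_mat n n" "y * x = 1\<^sub>m n" by (auto simp: carrier_GL)
  then have "det y = 1" using x det_mult[OF y(1) x(1)] by simp
  then show "\<exists>y\<in>carrier (SL TYPE('a) n). y \<otimes>\<^bsub>SL TYPE('a) n\<^esub> x = \<one>\<^bsub>SL TYPE('a) n\<^esub>"
    using y by (auto simp: carrier_SL)
qed (auto simp: carrier_SL det_mult[of _ n] assoc_mult_mat[of _ n n _ n _ n])

definition elementary_mats :: "'a :: field itself \<Rightarrow> nat \<Rightarrow> 'a mat set" where
  "elementary_mats F n = {addrow_mat n a k l | a k l. k < n \<and> l < n \<and> k \<noteq> l}"

lemma elementary_mats_SL: "elementary_mats TYPE('a :: field) n \<subseteq> carrier (SL TYPE('a) n)"
  by (auto simp: elementary_mats_def carrier_SL det_addrow_mat)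

text \<open>One backward step of Gaussian elimination: a row operation is undone by the elementary
  matrix with the opposite coefficient, so membership may be tested after the operation.\<close>

lemma addrow_step:
  fixes A :: "'a :: field mat"
  assumes A: "A \<in> carrier_mat n n" and kl: "k < n" "l < n" "k \<noteq> l"
    and gen: "addrow_mat n a k l * A \<in> generate (SL TYPE('a) n) (elementary_mats TYPE('a) n)"
  shows "A \<in> generate (SL TYPE('a) n) (elementary_mats TYPE('a) n)"
proof -
  let ?H = "generate (SL TYPE('a) n) (elementary_mats TYPE('a) n)"
  have "addrow_mat n (-a) k l \<in> ?H"
    using kl by (intro generate.incl) (auto simp: elementary_mats_def)
  from generate.eng[OF this gen]
  have "addrow_mat n (-a) k l * (addrow_mat n a k l * A) \<in> ?H" by simp
  also have "addrow_mat n (-a) k l * (addrow_mat n a k l * A) = addrow_mat n (-a) k l * addrow_mat n a k l * A"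
    using A by (simp add: assoc_mult_mat[of _ n n _ n _ n])
  also have "addrow_mat n (-a) k l * addrow_mat n a k l = 1\<^sub>m n"
    using addrow_mat_inv[OF kl, of "-a"] by simp
  finally show ?thesis using A by simp
qed

definition unit_cols :: "nat \<Rightarrow> nat \<Rightarrow> 'a :: field mat \<Rightarrow> bool" where
  "unit_cols n k A \<longleftrightarrow> (\<forall>i<n. \<forall>j<k. A $$ (i, j) = (if i = j then 1 else 0))"

lemma index_addrow_mat_mult:
  fixes A :: "'a :: field mat"
  assumes "A \<in> carrier_mat n n" "l < n" "i < n" "j < n"
  shows "(addrow_mat n a k l * A) $$ (i, j) = (if i = k then a * A $$ (l, j) + A $$ (i, j) else A $$ (i, j))"
  using assms by (subst addrow_mat[symmetric]) auto

text \<open>A row \<open>l\<close> with \<open>k \<le> l\<close> vanishes in the first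
  \<open>k\<close> columns, so adding a multiple of it to another row leaves those columns
  alone.\<close>

lemma unit_cols_addrow:
  assumes "A \<in> carrier_mat n n" "unit_cols n k A" "k \<le> l" "l < n"
  shows "unit_cols n k (addrow_mat n a i l * A)"
  using assms unfolding unit_cols_def by (auto simp: index_addrow_mat_mult simp del: index_mult_mat)

lemma SL_addrow:
  fixes A :: "'a :: field mat"
  assumes "A \<in> carrier (SL TYPE('a) n)" "k < n" "l < n" "k \<noteq> l"
  shows "addrow_mat n a k l * A \<in> carrier (SL TYPE('a) n)"
  using assms by (auto simp: carrier_SL det_mult[of _ n] det_addrow_mat)

text \<open>Columns are turned into standard basis vectors one after the other; a column that is not the last one gets a
  pivot \<open>1\<close> through a nonzero entry below the diagonal, and the last pivot is the determinant.\<close>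

lemma SL_subset_generate_elementary:
  "carrier (SL TYPE('a :: field) n) \<subseteq> generate (SL TYPE('a) n) (elementary_mats TYPE('a) n)"
proof
  let ?G = "SL TYPE('a) n" let ?H = "generate ?G (elementary_mats TYPE('a) n)"
  \<comment> \<open>With the pivot 1 in place, column \<open>k\<close> is cleared row by row.
    \<open>m\<close> counts the rows already cleared, and the induction descends from
    \<open>n\<close>, where the column is a unit vector.\<close>
  have clear: "A \<in> ?H"
    if "A \<in> carrier ?G" "unit_cols n k A" "A $$ (k, k) = 1" "k < n" "\<forall>i<m. i \<noteq> k \<longrightarrow> A $$ (i, k) = 0" "m \<le> n"
      and IH: "\<And>A. A \<in> carrier ?G \<Longrightarrow> unit_cols n (Suc k) A \<Longrightarrow> A \<in> ?H" for A k m
    using that(6,1-5)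
  proof (induction m arbitrary: A rule: inc_induct)
    case base
    then have "unit_cols n (Suc k) A" by (auto simp: unit_cols_def less_Suc_eq)
    then show ?case using base IH by blast
  next
    case (step m)
    show ?case
    proof (cases "m = k")
      case True
      then show ?thesis using step by (auto simp: less_Suc_eq)
    next
      case False
      have A: "A \<in> carrier_mat n n" using step by (auto simp: carrier_SL)
      let ?A = "addrow_mat n (- A $$ (m, k)) m k * A"
      have "?A \<in> ?H"
      proof (rule step.IH)
        show "?A \<in> carrier ?G" using step False by (intro SL_addrow) auto
        show "unit_cols n k ?A" using A step by (intro unit_cols_addrow) auto
        show "?A $$ (k, k) = 1" "\<forall>i<Suc m. i \<noteq> k \<longrightarrow> ?A $$ (i, k) = 0"
          using A step False by (auto simp: index_addrow_mat_mult less_Suc_eq simp del: index_mult_mat)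
      qed (use step in auto)
      then show ?thesis using A step False by (intro addrow_step[of A n m k]) auto
    qed
  qed
  have main: "A \<in> ?H" if "k \<le> n" "A \<in> carrier ?G" "unit_cols n k A" for k and A :: "'a mat"
    using that
  proof (induction k arbitrary: A rule: inc_induct)
    case base
    then have "A = 1\<^sub>m n" by (intro eq_matI) (auto simp: unit_cols_def carrier_SL)
    then show ?case using generate.one[of ?G] by simp
  next
    case (step k)
    have A: "A \<in> carrier_mat n n" "det A = 1" using step by (auto simp: carrier_SL)
    have IH: "B \<in> ?H" if "B \<in> carrier ?G" "unit_cols n (Suc k) B" for B
      using step.IH that by blast
    have pivot: "B \<in> ?H" if "B \<in> carrier ?G" "unit_cols n k B" "B $$ (k, k) = 1" for B
      by (rule clear[of B k 0]) (use that step IH in auto)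
    \<comment> \<open>The coefficient is chosen so that adding that multiple of row \<open>j\<close>
      turns the diagonal entry into 1.\<close>
    have below: "B \<in> ?H" if B: "B \<in> carrier ?G" "unit_cols n k B" and j: "k < j" "j < n" "B $$ (j, k) \<noteq> 0" for B j
    proof (rule addrow_step)
      show Bc: "B \<in> carrier_mat n n" using B by (auto simp: carrier_SL)
      show "addrow_mat n ((1 - B $$ (k, k)) / B $$ (j, k)) k j * B \<in> ?H"
        using B Bc j step.hyps
        by (intro pivot unit_cols_addrow SL_addrow) (auto simp: index_addrow_mat_mult simp del: index_mult_mat)
    qed (use j in auto)
    show ?case
    proof (cases "\<exists>j>k. j < n \<and> A $$ (j, k) \<noteq> 0")
      case True
      then show ?thesis using below step by blast
    next
      case F: False
      show ?thesis
      proof (cases "Suc k = n")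
        case True
        have ut: "upper_triangular A"
          using step.prems(2) A(1) True by (intro upper_triangularI) (auto simp: unit_cols_def)
        have "diag_mat A = map (\<lambda>i. if i = k then A $$ (k, k) else 1) [0..<n]"
          using step.prems(2) A(1) True by (auto simp: diag_mat_def unit_cols_def less_Suc_eq)
        moreover have "prod_list (map (\<lambda>i. if i = k then A $$ (k, k) else 1) [0..<Suc k]) = A $$ (k, k)"
        proof -
          have "map (\<lambda>i. if i = k then A $$ (k, k) else 1) [0..<k] = replicate k 1"
            by (intro nth_equalityI) auto
          then show ?thesis by simp
        qed
        ultimately have "A $$ (k, k) = 1"
          using det_upper_triangular[OF ut A(1)] A(2) True by auto
        then show ?thesis using pivot step by blast
      next
        case False
        then have k: "Suc k < n" using step by auto
        \<comment> \<open>Otherwise column \<open>k\<close> would be a combination of the first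
          \<open>k\<close> columns, which are unit vectors; \<open>v\<close> records this relation
          and lies in the kernel of \<open>A\<close>.\<close>
        have "A $$ (k, k) \<noteq> 0"
        proof
          assume 0: "A $$ (k, k) = 0"
          define v where "v = vec n (\<lambda>i. if i < k then - A $$ (i, k) else if i = k then 1 else 0)"
          have "A *\<^sub>v v = 0\<^sub>v n"
          proof (rule eq_vecI)
            fix i assume "i < dim_vec (0\<^sub>v n)"
            then have i: "i < n" by simp
            have "(A *\<^sub>v v) $ i = (\<Sum>j\<in>{0..<n}. A $$ (i, j) * v $ j)"
              using A i by (auto simp: scalar_prod_def v_def)
            also have "\<dots> = (\<Sum>j\<in>{0..<n}. (if j = i then (if i < k then v $ i else 0) else 0) + (if j = k then A $$ (i, k) else 0))"
            proof (rule sum.cong)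
              fix j assume "j \<in> {0..<n}"
              then show "A $$ (i, j) * v $ j = (if j = i then (if i < k then v $ i else 0) else 0) + (if j = k then A $$ (i, k) else 0)"
                using step.prems i by (cases j k rule: linorder_cases) (auto simp: unit_cols_def v_def)
            qed simp
            also have "\<dots> = (if i < k then v $ i else 0) + A $$ (i, k)"
              using i k by (simp add: sum.distrib)
            also have "\<dots> = 0"
              using F 0 i by (cases i k rule: linorder_cases) (auto simp: v_def)
            finally show "(A *\<^sub>v v) $ i = 0\<^sub>v n $ i" using i by simp
          qed (use A in auto)
          moreover have "v \<noteq> 0\<^sub>v n"
            using k by (auto simp: v_def dest!: arg_cong[of _ _ "\<lambda>v. v $ k"])
          moreover have "v \<in> carrier_vec n" by (simp add: v_def)
          ultimately have "det A = 0" using det_0_iff_vec_prod_zero_field[OF A(1)] by blast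
          then show False using A by simp
        qed
        \<comment> \<open>Adding row \<open>k\<close> to the next row puts the nonzero diagonal
          entry below the diagonal, which reduces to \<open>below\<close>.\<close>
        then have "addrow_mat n 1 (Suc k) k * A \<in> ?H"
          using A step k F
          by (intro below[of _ "Suc k"] SL_addrow unit_cols_addrow)
             (auto simp: index_addrow_mat_mult simp del: index_mult_mat)
        then show ?thesis using A k by (intro addrow_step[of A n "Suc k" k]) auto
      qed
    qed
  qed
  fix A assume "A \<in> carrier ?G"
  then show "A \<in> ?H" using main[of 0 A] by (auto simp: unit_cols_def)
qed

lemma mult_mat_unit_vec:
  fixes A :: "'a :: semiring_1 mat"
  assumes "A \<in> carrier_mat m n" "j < n"
  shows "A *\<^sub>v unit_vec n j = col A j"
  using assms by (intro eq_vecI) auto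

lemma mat_eqI_vec:
  fixes A B :: "'a :: semiring_1 mat"
  assumes "A \<in> carrier_mat m n" "B \<in> carrier_mat m n" "\<And>x. x \<in> carrier_vec n \<Longrightarrow> A *\<^sub>v x = B *\<^sub>v x"
  shows "A = B"
proof (rule mat_col_eqI)
  fix i assume "i < dim_col B"
  then show "col A i = col B i"
    using assms(1,2) assms(3)[of "unit_vec n i"] by (simp add: mult_mat_unit_vec[of _ m])
qed (use assms in auto)

text \<open>Unit vectors being eigenvectors makes the matrix diagonal; the sum of two unit vectors
  being one equates the two diagonal entries.\<close>

lemma scalar_mat_of_eigenvectors:
  fixes A :: "'a :: field mat"
  assumes A: "A \<in> carrier_mat n n"
    and eig: "\<And>v. v \<in> carrier_vec n \<Longrightarrow> v \<noteq> 0\<^sub>v n \<Longrightarrow> \<exists>c. A *\<^sub>v v = c \<cdot>\<^sub>v v"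
  shows "\<exists>c. A = c \<cdot>\<^sub>m 1\<^sub>m n"
proof -
  have entry: "A $$ (i, j) = (A *\<^sub>v unit_vec n j) $ i" if "i < n" "j < n" for i j
    using that A by (simp add: mult_mat_unit_vec[of _ n])
  have off: "A $$ (i, j) = 0" if ij: "i < n" "j < n" "i \<noteq> j" for i j
  proof -
    obtain c where "A *\<^sub>v unit_vec n j = c \<cdot>\<^sub>v unit_vec n j"
      using eig[of "unit_vec n j"] ij by auto
    then show ?thesis using ij entry[OF ij(1,2)] by (simp del: index_mult_mat_vec)
  qed
  have diag: "A $$ (i, i) = A $$ (j, j)" if ij: "i < n" "j < n" "i \<noteq> j" for i j
  proof -
    let ?v = "unit_vec n i + unit_vec n j :: 'a vec"
    have "?v \<noteq> 0\<^sub>v n"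
      using ij by (auto dest!: arg_cong[of _ _ "\<lambda>v. v $ i"])
    then obtain c where c: "A *\<^sub>v ?v = c \<cdot>\<^sub>v ?v"
      using eig[of ?v] by auto
    have Av: "A *\<^sub>v ?v = A *\<^sub>v unit_vec n i + A *\<^sub>v unit_vec n j"
      using A by (intro mult_add_distrib_mat_vec) auto
    have "(A *\<^sub>v ?v) $ k = c * ?v $ k" if "k < n" for k
      using that unfolding c by simp
    then have "A $$ (k, i) + A $$ (k, j) = c * ?v $ k" if "k < n" for k
      using that A ij unfolding Av by (simp add: entry[symmetric] del: index_mult_mat_vec)
    from this[of i] this[of j] show ?thesis using ij off by simp
  qed
  show ?thesis
  proof (cases "n = 0")
    case True
    then show ?thesis using A by (intro exI[of _ 0] eq_matI) auto
  next
    case False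
    define d where "d = A $$ (0, 0)"
    have "A $$ (i, i) = d" if "i < n" for i
      using diag[of i 0] that unfolding d_def by (cases "i = 0") auto
    then have "A = d \<cdot>\<^sub>m 1\<^sub>m n"
      using A off by (intro eq_matI) auto
    then show ?thesis by blast
  qed
qed

lemma scalar_mat_commute:
  fixes B :: "'a :: comm_semiring_1 mat"
  assumes "B \<in> carrier_mat n n"
  shows "c \<cdot>\<^sub>m 1\<^sub>m n * B = B * (c \<cdot>\<^sub>m 1\<^sub>m n)"
  using assms by (simp add: mult_smult_distrib[of _ n n _ n] mult_smult_assoc_mat[of _ n n _ n])

text \<open>Commuting with \<open>addrow_mat n 1 k l\<close> means commuting with the matrix unit
  E_kl. Position (k, k) of the two products then kills an off-diagonal entry, and position (k, l)
  equates two diagonal entries.\<close>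

lemma center_SL:
  assumes n: "n \<ge> 2" and A: "A \<in> carrier (SL TYPE('a :: field) n)"
  shows "A \<in> group_center (SL TYPE('a) n) \<longleftrightarrow> (\<exists>c. A = c \<cdot>\<^sub>m 1\<^sub>m n)"
proof
  have Ac: "A \<in> carrier_mat n n" using A by (simp add: carrier_SL)
  assume "A \<in> group_center (SL TYPE('a) n)"
  then have comm: "A * addrow_mat n 1 k l = addrow_mat n 1 k l * A" if "k < n" "l < n" "k \<noteq> l" for k l
    using that by (auto simp: group_center_def carrier_SL det_addrow_mat)
  have eq: "(if j = l then A $$ (i, k) else 0) = (if i = k then A $$ (l, j) else 0)"
    if "k < n" "l < n" "k \<noteq> l" "i < n" "j < n" for i j k l
  proof -
    have "(A * addrow_mat n 1 k l) $$ (i, j) = (if j = l then A $$ (i, k) else 0) + A $$ (i, j)"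
      using that Ac by (subst addcol_mat[OF Ac, symmetric]) (auto simp: mat_addcol_def)
    moreover have "(addrow_mat n 1 k l * A) $$ (i, j) = (if i = k then A $$ (l, j) else 0) + A $$ (i, j)"
      using that Ac by (simp add: index_addrow_mat_mult del: index_mult_mat)
    ultimately show ?thesis using comm[OF that(1-3)] by simp
  qed
  have "A $$ (i, j) = 0" if "i < n" "j < n" "i \<noteq> j" for i j
    using eq[of j i j j] that by simp
  moreover define d where "d = A $$ (0, 0)"
  have "A $$ (i, i) = d" if "i < n" for i
    using eq[of i 0 i 0] that n unfolding d_def by (cases "i = 0") auto
  ultimately have "A = d \<cdot>\<^sub>m 1\<^sub>m n"
    using Ac by (intro eq_matI) auto
  then show "\<exists>c. A = c \<cdot>\<^sub>m 1\<^sub>m n" by blast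
next
  assume "\<exists>c. A = c \<cdot>\<^sub>m 1\<^sub>m n"
  then show "A \<in> group_center (SL TYPE('a) n)"
    using A by (auto simp: group_center_def carrier_SL scalar_mat_commute)
qed

section \<open>The standard alternating form, symplectic transvections and the symplectic
  group\<close>

lemma sum_lessThan_split: "(\<Sum>j<r + s. f j) = (\<Sum>j<r. f j) + (\<Sum>j<s. f (r + j :: nat))" for f :: "nat \<Rightarrow> 'a :: comm_monoid_add"
  by (induction s) (auto simp: add.assoc)

lemma alternating_form_add:
  assumes "x \<in> carrier_vec (2 * r)" "y \<in> carrier_vec (2 * r)" "z \<in> carrier_vec (2 * r)"
  shows "alternating_form r (x + y) z = alternating_form r x z + alternating_form r y z"
    and "alternating_form r z (x + y) = alternating_form r z x + alternating_form r z y"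
  using assms by (auto simp: alternating_form_def sum.distrib[symmetric] algebra_simps intro!: sum.cong)

lemma alternating_form_smult:
  assumes "x \<in> carrier_vec (2 * r)" "y \<in> carrier_vec (2 * r)"
  shows "alternating_form r (c \<cdot>\<^sub>v x) y = c * alternating_form r x y"
    and "alternating_form r x (c \<cdot>\<^sub>v y) = c * alternating_form r x y"
  using assms by (auto simp: alternating_form_def sum_distrib_left algebra_simps intro!: sum.cong)

lemma alternating_form_skew: "alternating_form r y x = - alternating_form r x y"
  by (auto simp: alternating_form_def sum_negf[symmetric] algebra_simps intro!: sum.cong)

lemma alternating_form_self [simp]: "alternating_form r x x = 0"
  by (simp add: alternating_form_def)

lemma alternating_form_diff:
  assumes "x \<in> carrier_vec (2 * r)" "y \<in> carrier_vec (2 * r)" "z \<in> carrier_vec (2 * r)"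
  shows "alternating_form r z (x - y) = alternating_form r z x - alternating_form r z y"
  using assms by (auto simp: alternating_form_def sum_subtractf[symmetric] algebra_simps intro!: sum.cong)

lemma alternating_form_unit:
  assumes i: "i < r"
  shows "alternating_form r x (unit_vec (2 * r) i) = - x $ (r + i)"
    and "alternating_form r x (unit_vec (2 * r) (r + i)) = x $ i"
proof -
  have "alternating_form r x (unit_vec (2 * r) i) = (\<Sum>j<r. if j = i then - x $ (r + i) else 0)"
    using i unfolding alternating_form_def by (intro sum.cong) auto
  then show "alternating_form r x (unit_vec (2 * r) i) = - x $ (r + i)" using i by simp
  have "alternating_form r x (unit_vec (2 * r) (r + i)) = (\<Sum>j<r. if j = i then x $ i else 0)"
    using i unfolding alternating_form_def by (intro sum.cong) auto
  then show "alternating_form r x (unit_vec (2 * r) (r + i)) = x $ i" using i by simp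
qed

lemma alternating_form_expand:
  assumes "x \<in> carrier_vec (2 * r)"
  shows "alternating_form r x v = (\<Sum>j<2 * r. x $ j * alternating_form r (unit_vec (2 * r) j) v)"
proof -
  have "(\<Sum>j<2 * r. x $ j * alternating_form r (unit_vec (2 * r) j) v)
      = (\<Sum>j<r. x $ j * alternating_form r (unit_vec (2 * r) j) v)
        + (\<Sum>j<r. x $ (r + j) * alternating_form r (unit_vec (2 * r) (r + j)) v)"
    unfolding mult_2 by (rule sum_lessThan_split)
  also have "\<dots> = (\<Sum>j<r. x $ j * v $ (r + j) - x $ (r + j) * v $ j)"
    unfolding sum.distrib[symmetric]
    by (intro sum.cong)
       (auto simp: alternating_form_skew[of r "unit_vec _ _" v] alternating_form_unit)
  finally show ?thesis by (simp add: alternating_form_def)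
qed

text \<open>The map x + a \<omega>(x, v) v, entered column by column as the images of the unit
  vectors.\<close>

definition symplectic_transvection :: "nat \<Rightarrow> 'a :: field vec \<Rightarrow> 'a \<Rightarrow> 'a mat" where
  "symplectic_transvection r v a = mat (2 * r) (2 * r)
     (\<lambda>(i, j). (if i = j then 1 else 0) + a * alternating_form r (unit_vec (2 * r) j) v * v $ i)"

lemma symplectic_transvection_carrier [simp]: "symplectic_transvection r v a \<in> carrier_mat (2 * r) (2 * r)"
  by (simp add: symplectic_transvection_def)

lemma symplectic_transvection_mult_vec:
  assumes v: "v \<in> carrier_vec (2 * r)" and x: "x \<in> carrier_vec (2 * r)"
  shows "symplectic_transvection r v a *\<^sub>v x = x + (a * alternating_form r x v) \<cdot>\<^sub>v v"
proof (rule eq_vecI)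
  fix i assume "i < dim_vec (x + (a * alternating_form r x v) \<cdot>\<^sub>v v)"
  then have i: "i < 2 * r" using v by simp
  have "(symplectic_transvection r v a *\<^sub>v x) $ i
      = (\<Sum>j<2 * r. (if j = i then x $ i else 0) + a * v $ i * (x $ j * alternating_form r (unit_vec (2 * r) j) v))"
    using i x by (auto simp: symplectic_transvection_def scalar_prod_def lessThan_atLeast0 algebra_simps intro!: sum.cong)
  also have "\<dots> = x $ i + a * v $ i * alternating_form r x v"
    using i unfolding sum.distrib sum_distrib_left[symmetric] alternating_form_expand[OF x, symmetric] by simp
  finally show "(symplectic_transvection r v a *\<^sub>v x) $ i = (x + (a * alternating_form r x v) \<cdot>\<^sub>v v) $ i"
    using i v x by simp
qed (use v in \<open>auto simp: symplectic_transvection_def\<close>)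

lemma carrier_Sp:
  "carrier (Sp TYPE('a :: field) r) = {A \<in> carrier_mat (2 * r) (2 * r). (\<exists>B\<in>carrier_mat (2 * r) (2 * r). B * A = 1\<^sub>m (2 * r)) \<and>
     (\<forall>x\<in>carrier_vec (2 * r). \<forall>y\<in>carrier_vec (2 * r). alternating_form r (A *\<^sub>v x) (A *\<^sub>v y) = alternating_form r x y)}"
  by (auto simp: Sp_def carrier_GL)

lemma mult_Sp [simp]: "A \<otimes>\<^bsub>Sp TYPE('a :: field) r\<^esub> B = A * B"
  by (simp add: Sp_def GL_def units_of_def ring_mat_simps)

lemma one_Sp [simp]: "\<one>\<^bsub>Sp TYPE('a :: field) r\<^esub> = 1\<^sub>m (2 * r)"
  by (simp add: Sp_def GL_def units_of_def ring_mat_simps)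

lemma Sp_carrier_mat: "A \<in> carrier (Sp TYPE('a :: field) r) \<Longrightarrow> A \<in> carrier_mat (2 * r) (2 * r)"
  by (simp add: carrier_Sp)

lemma Sp_alternating_form:
  assumes "A \<in> carrier (Sp TYPE('a :: field) r)" "x \<in> carrier_vec (2 * r)" "y \<in> carrier_vec (2 * r)"
  shows "alternating_form r (A *\<^sub>v x) (A *\<^sub>v y) = alternating_form r x y"
  using assms by (simp add: carrier_Sp)

lemma group_Sp: "group (Sp TYPE('a :: field) r)"
proof -
  let ?n = "2 * r"
  note asc = assoc_mult_mat[of _ ?n ?n _ ?n _ ?n] and ascv = assoc_mult_mat_vec[of _ ?n ?n _ ?n]
  show ?thesis
  proof (rule groupI)
    fix A B assume A: "A \<in> carrier (Sp TYPE('a) r)" and B: "B \<in> carrier (Sp TYPE('a) r)"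
    obtain A' B' where inv: "A' \<in> carrier_mat ?n ?n" "A' * A = 1\<^sub>m ?n" "B' \<in> carrier_mat ?n ?n" "B' * B = 1\<^sub>m ?n"
      using A B by (auto simp: carrier_Sp)
    have car: "A \<in> carrier_mat ?n ?n" "B \<in> carrier_mat ?n ?n" using A B Sp_carrier_mat by auto
    have "B' * A' * (A * B) = B' * (A' * A) * B" using inv(1,3) car by (simp add: asc)
    then have "B' * A' * (A * B) = 1\<^sub>m ?n" using inv by simp
    moreover have "B' * A' \<in> carrier_mat ?n ?n" using inv by simp
    ultimately show "A \<otimes>\<^bsub>Sp TYPE('a) r\<^esub> B \<in> carrier (Sp TYPE('a) r)"
      using A B car unfolding carrier_Sp by (auto simp: ascv)
  next
    fix A assume A: "A \<in> carrier (Sp TYPE('a) r)"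
    then obtain B where B: "B \<in> carrier_mat ?n ?n" "B * A = 1\<^sub>m ?n" by (auto simp: carrier_Sp)
    have car: "A \<in> carrier_mat ?n ?n" using A Sp_carrier_mat by auto
    have AB: "A * B = 1\<^sub>m ?n" using mat_mult_left_right_inverse[OF B(1) car B(2)] .
    have "alternating_form r (B *\<^sub>v x) (B *\<^sub>v y) = alternating_form r x y"
      if "x \<in> carrier_vec ?n" "y \<in> carrier_vec ?n" for x y
      using Sp_alternating_form[OF A, of "B *\<^sub>v x" "B *\<^sub>v y"] that B(1) car AB
      by (simp add: ascv[symmetric])
    then have "B \<in> carrier (Sp TYPE('a) r)" using B AB car by (auto simp: carrier_Sp)
    then show "\<exists>B\<in>carrier (Sp TYPE('a) r). B \<otimes>\<^bsub>Sp TYPE('a) r\<^esub> A = \<one>\<^bsub>Sp TYPE('a) r\<^esub>" using B by auto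
  next
    show "\<one>\<^bsub>Sp TYPE('a) r\<^esub> \<in> carrier (Sp TYPE('a) r)"
      by (auto simp: carrier_Sp intro!: bexI[of _ "1\<^sub>m ?n"])
  qed (auto simp: asc dest!: Sp_carrier_mat)
qed

definition symplectic_transvections :: "'a :: field itself \<Rightarrow> nat \<Rightarrow> 'a mat set" where
  "symplectic_transvections F r = {symplectic_transvection r v a | v a. v \<in> carrier_vec (2 * r) \<and> v \<noteq> 0\<^sub>v (2 * r)}"

lemma symplectic_transvection_in_Sp:
  fixes v :: "'a :: field vec"
  assumes v: "v \<in> carrier_vec (2 * r)"
  shows "symplectic_transvection r v a \<in> carrier (Sp TYPE('a) r)"
proof -
  let ?n = "2 * r"
  have "symplectic_transvection r v (- a) * symplectic_transvection r v a = 1\<^sub>m ?n"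
  proof (rule mat_eqI_vec[of _ ?n ?n])
    fix x :: "'a vec" assume x: "x \<in> carrier_vec ?n"
    then have "symplectic_transvection r v (- a) * symplectic_transvection r v a *\<^sub>v x = x"
      using v by (auto simp: assoc_mult_mat_vec[of _ ?n ?n _ ?n] symplectic_transvection_mult_vec
          alternating_form_add alternating_form_smult)
    then show "symplectic_transvection r v (- a) * symplectic_transvection r v a *\<^sub>v x = 1\<^sub>m ?n *\<^sub>v x"
      using x by simp
  qed (use mult_carrier_mat[OF symplectic_transvection_carrier symplectic_transvection_carrier] in auto)
  moreover have "alternating_form r (symplectic_transvection r v a *\<^sub>v x) (symplectic_transvection r v a *\<^sub>v y) = alternating_form r x y"
    if x: "x \<in> carrier_vec ?n" and y: "y \<in> carrier_vec ?n" for x y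
    using v x y by (simp add: symplectic_transvection_mult_vec alternating_form_add alternating_form_smult
        alternating_form_skew[of r v y])
  ultimately show ?thesis
    unfolding carrier_Sp using symplectic_transvection_carrier by blast
qed

lemma symplectic_transvections_subset: "symplectic_transvections TYPE('a :: field) r \<subseteq> carrier (Sp TYPE('a) r)"
  by (auto simp: symplectic_transvections_def symplectic_transvection_in_Sp)

text \<open>Since \<omega>(x, y - x) = \<omega>(x, y), the coefficient makes the transvection along
  \<open>y - x\<close> add exactly \<open>y - x\<close> to \<open>x\<close>.\<close>

lemma symplectic_transvection_moves:
  assumes "x \<in> carrier_vec (2 * r)" "y \<in> carrier_vec (2 * r)" "alternating_form r x y \<noteq> 0"
  shows "symplectic_transvection r (y - x) (1 / alternating_form r x y) *\<^sub>v x = y"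
proof -
  have "symplectic_transvection r (y - x) (1 / alternating_form r x y) *\<^sub>v x = x + 1 \<cdot>\<^sub>v (y - x)"
    using assms by (simp add: symplectic_transvection_mult_vec alternating_form_diff)
  also have "\<dots> = y" using assms by (intro eq_vecI) auto
  finally show ?thesis .
qed

text \<open>A central element commutes with the transvection along \<open>v\<close>; comparing the
  images of a vector \<open>x\<close> not orthogonal to \<open>v\<close> shows that it preserves the
  line of \<open>v\<close>. So every nonzero vector is an eigenvector.\<close>

lemma center_Sp:
  assumes A: "A \<in> carrier (Sp TYPE('a :: field) r)"
  shows "A \<in> group_center (Sp TYPE('a) r) \<longleftrightarrow> (\<exists>c. A = c \<cdot>\<^sub>m 1\<^sub>m (2 * r))"
proof
  let ?n = "2 * r"
  have Ac: "A \<in> carrier_mat ?n ?n" using A Sp_carrier_mat by auto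
  assume cen: "A \<in> group_center (Sp TYPE('a) r)"
  show "\<exists>c. A = c \<cdot>\<^sub>m 1\<^sub>m ?n"
  proof (rule scalar_mat_of_eigenvectors[OF Ac])
    fix v :: "'a vec" assume v: "v \<in> carrier_vec ?n" "v \<noteq> 0\<^sub>v ?n"
    let ?T = "symplectic_transvection r v 1"
    obtain x where x: "x \<in> carrier_vec ?n" "alternating_form r x v \<noteq> 0"
    proof -
      obtain i where i: "i < ?n" "v $ i \<noteq> 0" using v by (auto simp: vec_eq_iff)
      show ?thesis
      proof (cases "i < r")
        case True
        then show ?thesis using that[of "unit_vec ?n (r + i)"] i alternating_form_unit(2)[of i r v]
          by (simp add: alternating_form_skew[of r _ v])
      next
        case False
        then show ?thesis using that[of "unit_vec ?n (i - r)"] i alternating_form_unit(1)[of "i - r" r v]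
          by (simp add: alternating_form_skew[of r _ v])
      qed
    qed
    let ?c = "alternating_form r x v" and ?d = "alternating_form r (A *\<^sub>v x) v"
    have "A * ?T = ?T * A"
      using cen symplectic_transvection_in_Sp[OF v(1), of 1] by (auto simp: group_center_def)
    then have "A *\<^sub>v (?T *\<^sub>v x) = ?T *\<^sub>v (A *\<^sub>v x)"
      using Ac x by (metis assoc_mult_mat_vec symplectic_transvection_carrier)
    then have eq: "A *\<^sub>v x + ?c \<cdot>\<^sub>v (A *\<^sub>v v) = A *\<^sub>v x + ?d \<cdot>\<^sub>v v"
      using Ac x v by (simp add: symplectic_transvection_mult_vec mult_add_distrib_mat_vec[of _ ?n ?n] mult_mat_vec[of _ ?n ?n])
    have e: "?c * (A *\<^sub>v v) $ i = ?d * v $ i" if "i < ?n" for i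
      using arg_cong[OF eq, of "\<lambda>w. w $ i"] that Ac v x by (simp del: index_mult_mat_vec)
    have "A *\<^sub>v v = (?d / ?c) \<cdot>\<^sub>v v"
      using e x(2) Ac v by (intro eq_vecI) (simp_all add: field_simps del: index_mult_mat_vec)
    then show "\<exists>c. A *\<^sub>v v = c \<cdot>\<^sub>v v" by blast
  qed
next
  assume "\<exists>c. A = c \<cdot>\<^sub>m 1\<^sub>m (2 * r)"
  then show "A \<in> group_center (Sp TYPE('a) r)"
    using A by (auto simp: group_center_def intro: scalar_mat_commute dest: Sp_carrier_mat)
qed

section \<open>Generation of the symplectic group by transvections\<close>

definition fixes_pairs :: "nat \<Rightarrow> nat \<Rightarrow> 'a :: field mat \<Rightarrow> bool" where
  "fixes_pairs r k A \<longleftrightarrow> (\<forall>i<k. A *\<^sub>v unit_vec (2 * r) i = unit_vec (2 * r) i \<and>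
     A *\<^sub>v unit_vec (2 * r) (r + i) = unit_vec (2 * r) (r + i))"

text \<open>In coordinates, the orthogonal complement of the first \<open>k\<close> hyperbolic
  pairs; transvections along its vectors fix these pairs.\<close>

definition orth_pairs :: "nat \<Rightarrow> nat \<Rightarrow> 'a :: field vec \<Rightarrow> bool" where
  "orth_pairs r k v \<longleftrightarrow> v \<in> carrier_vec (2 * r) \<and> (\<forall>i<k. v $ i = 0 \<and> v $ (r + i) = 0)"

lemma orth_pairs_add: "k \<le> r \<Longrightarrow> orth_pairs r k v \<Longrightarrow> orth_pairs r k w \<Longrightarrow> orth_pairs r k (v + w)"
  by (auto simp: orth_pairs_def)

lemma orth_pairs_diff: "k \<le> r \<Longrightarrow> orth_pairs r k v \<Longrightarrow> orth_pairs r k w \<Longrightarrow> orth_pairs r k (v - w)"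
  by (auto simp: orth_pairs_def)

lemma orth_pairs_alternating_form:
  assumes "v \<in> carrier_vec (2 * r)" "k \<le> r"
  shows "orth_pairs r k v \<longleftrightarrow> (\<forall>i<k. alternating_form r v (unit_vec (2 * r) i) = 0 \<and>
    alternating_form r v (unit_vec (2 * r) (r + i)) = 0)"
  using assms by (auto simp: orth_pairs_def alternating_form_unit)

lemma fixes_pairs_transvection:
  assumes "k \<le> r" "orth_pairs r k v"
  shows "fixes_pairs r k (symplectic_transvection r v a)"
  unfolding fixes_pairs_def
proof (intro allI impI conjI)
  have v: "v \<in> carrier_vec (2 * r)" using assms by (simp add: orth_pairs_def)
  fix i assume i: "i < k"
  have "alternating_form r (unit_vec (2 * r) i) v = 0" "alternating_form r (unit_vec (2 * r) (r + i)) v = 0"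
    using orth_pairs_alternating_form[OF v assms(1)] assms(2) i by (auto simp: alternating_form_skew[of r _ v])
  then show "symplectic_transvection r v a *\<^sub>v unit_vec (2 * r) i = unit_vec (2 * r) i"
    "symplectic_transvection r v a *\<^sub>v unit_vec (2 * r) (r + i) = unit_vec (2 * r) (r + i)"
    using v by (auto simp: symplectic_transvection_mult_vec)
qed

lemma fixes_pairs_mult:
  assumes "A \<in> carrier_mat (2 * r) (2 * r)" "B \<in> carrier_mat (2 * r) (2 * r)" "fixes_pairs r k A" "fixes_pairs r k B"
  shows "fixes_pairs r k (A * B)"
  using assms by (simp add: fixes_pairs_def assoc_mult_mat_vec[of _ "2 * r" "2 * r" _ "2 * r"])

text \<open>Nondegeneracy on the complement: the witness is the hyperbolic partner of the unit
  vector of a nonzero coordinate, and it stays in the complement.\<close>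

lemma orth_pairs_dual:
  assumes k: "k \<le> r" and x: "orth_pairs r k x" "x \<noteq> 0\<^sub>v (2 * r)"
  shows "\<exists>b. orth_pairs r k b \<and> alternating_form r x b \<noteq> 0"
proof -
  obtain i where i: "i < 2 * r" "x $ i \<noteq> 0" using x by (auto simp: vec_eq_iff orth_pairs_def)
  show ?thesis
  proof (cases "i < r")
    case True
    then have "i \<ge> k" using x i by (auto simp: orth_pairs_def not_less[symmetric])
    then have "orth_pairs r k (unit_vec (2 * r) (r + i))" using k True by (auto simp: orth_pairs_def)
    then show ?thesis using i True alternating_form_unit(2)[of i r x] by metis
  next
    case False
    then have j: "i = r + (i - r)" "i - r < r" using i by auto
    then have "i - r \<ge> k" using x i by (metis orth_pairs_def not_less)
    then have "orth_pairs r k (unit_vec (2 * r) (i - r))" using k j by (auto simp: orth_pairs_def)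
    moreover have "alternating_form r x (unit_vec (2 * r) (i - r)) \<noteq> 0"
      using alternating_form_unit(1)[OF j(2), of x] i j(1) by simp
    ultimately show ?thesis by blast
  qed
qed

context
  fixes ty :: "'a :: field itself" and r :: nat
begin

private abbreviation "G \<equiv> Sp TYPE('a) r"
private abbreviation "H \<equiv> generate G (symplectic_transvections TYPE('a) r)"

private lemma H_subset: "H \<subseteq> carrier G"
  by (rule group.generate_incl[OF group_Sp symplectic_transvections_subset])

private lemma transvection_in_H:
  assumes "v \<in> carrier_vec (2 * r)"
  shows "symplectic_transvection r v a \<in> H"
proof (cases "v = 0\<^sub>v (2 * r)")
  case True
  have "symplectic_transvection r v a = 1\<^sub>m (2 * r)"
    using True by (intro eq_matI) (auto simp: symplectic_transvection_def)
  then show ?thesis using generate.one[of G] by simp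
next
  case False
  then show ?thesis using assms by (intro generate.incl) (auto simp: symplectic_transvections_def)
qed

private lemma H_mult: "A \<in> H \<Longrightarrow> B \<in> H \<Longrightarrow> A * B \<in> H"
  using generate.eng[of A G _ B] by simp

private lemma H_cancel:
  assumes A: "A \<in> H" and B: "B \<in> carrier G" and AB: "A * B \<in> H"
  shows "B \<in> H"
proof -
  interpret group G by (rule group_Sp)
  have A': "A \<in> carrier G" using A H_subset by auto
  have "inv\<^bsub>G\<^esub> A \<otimes>\<^bsub>G\<^esub> (A \<otimes>\<^bsub>G\<^esub> B) \<in> H"
    by (rule generate.eng[OF generate_m_inv_closed[OF symplectic_transvections_subset A]]) (simp add: AB)
  then show ?thesis using A' B by (simp del: mult_Sp one_Sp add: m_assoc[symmetric])
qed

text \<open>One transvection suffices unless \<open>x\<close> and \<open>y\<close> are orthogonal; then a vector orthogonal to neither is interposed.\<close>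

private lemma move_vector:
  assumes k: "k \<le> r" and x: "orth_pairs r k x" "x \<noteq> 0\<^sub>v (2 * r)" and y: "orth_pairs r k y" "y \<noteq> 0\<^sub>v (2 * r)"
  shows "\<exists>A\<in>H. fixes_pairs r k A \<and> A *\<^sub>v x = (y :: 'a vec)"
proof -
  have direct: "\<exists>A\<in>H. fixes_pairs r k A \<and> A *\<^sub>v x = y"
    if "orth_pairs r k x" "orth_pairs r k y" "alternating_form r x y \<noteq> 0" for x y :: "'a vec"
  proof -
    have c: "x \<in> carrier_vec (2 * r)" "y \<in> carrier_vec (2 * r)" using that by (auto simp: orth_pairs_def)
    have o: "orth_pairs r k (y - x)" using that k by (intro orth_pairs_diff)
    show ?thesis
      using symplectic_transvection_moves[OF c that(3)] fixes_pairs_transvection[OF k o] transvection_in_H[of "y - x"] c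
      by (intro bexI[of _ "symplectic_transvection r (y - x) (1 / alternating_form r x y)"]) auto
  qed
  show ?thesis
  proof (cases "alternating_form r x y = 0")
    case False
    then show ?thesis using direct x y by blast
  next
    case True
    obtain b where b: "orth_pairs r k b" "alternating_form r x b \<noteq> 0" using orth_pairs_dual[OF k x] by blast
    obtain c where c: "orth_pairs r k c" "alternating_form r y c \<noteq> 0" using orth_pairs_dual[OF k y] by blast
    have car: "x \<in> carrier_vec (2 * r)" "y \<in> carrier_vec (2 * r)" "b \<in> carrier_vec (2 * r)" "c \<in> carrier_vec (2 * r)"
      using x y b c by (auto simp: orth_pairs_def)
    \<comment> \<open>If \<open>b\<close> is orthogonal to \<open>y\<close> and \<open>c\<close> to
      \<open>x\<close>, then \<open>b + c\<close> is orthogonal to neither; otherwise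
      \<open>b\<close> or \<open>c\<close> already serves.\<close>
    have "\<exists>z. orth_pairs r k z \<and> alternating_form r x z \<noteq> 0 \<and> alternating_form r y z \<noteq> 0"
    proof (cases "alternating_form r y b = 0 \<and> alternating_form r x c = 0")
      case True
      then show ?thesis
        using b c car orth_pairs_add[OF k b(1) c(1)] by (intro exI[of _ "b + c"]) (simp add: alternating_form_add)
    next
      case False
      then show ?thesis using b c by blast
    qed
    then obtain z where z: "orth_pairs r k z" "alternating_form r x z \<noteq> 0" "alternating_form r z y \<noteq> 0"
      by (metis alternating_form_skew neg_equal_0_iff_equal)
    obtain A where A: "A \<in> H" "fixes_pairs r k A" "A *\<^sub>v x = z" using direct[OF x(1) z(1,2)] by blast
    obtain B where B: "B \<in> H" "fixes_pairs r k B" "B *\<^sub>v z = y" using direct[OF z(1) y(1) z(3)] by blast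
    have Ac: "A \<in> carrier_mat (2 * r) (2 * r)" and Bc: "B \<in> carrier_mat (2 * r) (2 * r)"
      using A B H_subset Sp_carrier_mat by blast+
    show ?thesis
      using H_mult[OF B(1) A(1)] fixes_pairs_mult[OF Bc Ac B(2) A(2)] assoc_mult_mat_vec[OF Bc Ac car(1)] A(3) B(3)
      by (intro bexI[of _ "B * A"]) simp
  qed
qed

text \<open>The transvection along \<open>f' - f\<close> fixes \<open>e\<close> because
  \<open>f\<close> and \<open>f'\<close> have the same product with \<open>e\<close>. If
  \<open>f\<close> and \<open>f'\<close> are orthogonal, the detour over \<open>f + e\<close> works:
  \<omega>(f, f + e) = -1 and \<omega>(f + e, f') = 1.\<close>

private lemma move_partner:
  fixes e f f' :: "'a vec"
  assumes k: "k \<le> r" and orth: "orth_pairs r k e" "orth_pairs r k f" "orth_pairs r k f'"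
    and ef: "alternating_form r e f = 1" "alternating_form r e f' = 1"
  shows "\<exists>A\<in>H. fixes_pairs r k A \<and> A *\<^sub>v e = e \<and> A *\<^sub>v f = f'"
proof -
  have car: "e \<in> carrier_vec (2 * r)" "f \<in> carrier_vec (2 * r)" "f' \<in> carrier_vec (2 * r)"
    using orth by (auto simp: orth_pairs_def)
  have direct: "\<exists>A\<in>H. fixes_pairs r k A \<and> A *\<^sub>v e = e \<and> A *\<^sub>v x = y"
    if "orth_pairs r k x" "orth_pairs r k y" "alternating_form r x y \<noteq> 0"
      "alternating_form r e x = alternating_form r e y" for x y :: "'a vec"
  proof -
    have c: "x \<in> carrier_vec (2 * r)" "y \<in> carrier_vec (2 * r)" using that by (auto simp: orth_pairs_def)
    have o: "orth_pairs r k (y - x)" using that k by (intro orth_pairs_diff)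
    have "symplectic_transvection r (y - x) (1 / alternating_form r x y) *\<^sub>v e = e"
      using c car that(4) by (auto simp: symplectic_transvection_mult_vec alternating_form_diff)
    then show ?thesis
      using symplectic_transvection_moves[OF c that(3)] fixes_pairs_transvection[OF k o] transvection_in_H[of "y - x"] c
      by (intro bexI[of _ "symplectic_transvection r (y - x) (1 / alternating_form r x y)"]) auto
  qed
  show ?thesis
  proof (cases "alternating_form r f f' = 0")
    case False
    then show ?thesis using direct orth ef by simp
  next
    case True
    have o: "orth_pairs r k (f + e)" by (rule orth_pairs_add[OF k orth(2,1)])
    have "\<exists>A\<in>H. fixes_pairs r k A \<and> A *\<^sub>v e = e \<and> A *\<^sub>v f = f + e"
      using car ef by (intro direct orth o) (simp_all add: alternating_form_add alternating_form_skew[of r f e])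
    then obtain A where A: "A \<in> H" "fixes_pairs r k A" "A *\<^sub>v e = e" "A *\<^sub>v f = f + e" by blast
    have "\<exists>A\<in>H. fixes_pairs r k A \<and> A *\<^sub>v e = e \<and> A *\<^sub>v (f + e) = f'"
      using car ef True by (intro direct orth o) (simp_all add: alternating_form_add)
    then obtain B where B: "B \<in> H" "fixes_pairs r k B" "B *\<^sub>v e = e" "B *\<^sub>v (f + e) = f'" by blast
    have Ac: "A \<in> carrier_mat (2 * r) (2 * r)" and Bc: "B \<in> carrier_mat (2 * r) (2 * r)"
      using A B H_subset Sp_carrier_mat by blast+
    show ?thesis
      using H_mult[OF B(1) A(1)] fixes_pairs_mult[OF Bc Ac B(2) A(2)] assoc_mult_mat_vec[OF Bc Ac car(1)]
        assoc_mult_mat_vec[OF Bc Ac car(2)] A B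
      by (intro bexI[of _ "B * A"]) simp_all
  qed
qed

text \<open>Induction over hyperbolic pairs: a symplectic map fixing the first \<open>k\<close>
  pairs preserves their complement, so transvections from that complement return the images of the
  next pair to their places without disturbing the earlier ones.\<close>

lemma Sp_subset_generate_transvections: "carrier (Sp TYPE('a) r) \<subseteq> generate (Sp TYPE('a) r) (symplectic_transvections TYPE('a) r)"
proof
  let ?n = "2 * r"
  let ?e = "unit_vec ?n :: nat \<Rightarrow> 'a vec"
  have orth_image: "orth_pairs r k (A *\<^sub>v x)"
    if A: "A \<in> carrier G" "fixes_pairs r k A" and x: "orth_pairs r k x" and k: "k \<le> r" for A x k
  proof -
    have xc: "x \<in> carrier_vec ?n" using x by (simp add: orth_pairs_def)
    have Ax: "A *\<^sub>v x \<in> carrier_vec ?n" using A xc Sp_carrier_mat by (metis mult_mat_vec_carrier)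
    show ?thesis
      unfolding orth_pairs_alternating_form[OF Ax k]
    proof (intro allI impI)
      fix i assume i: "i < k"
      then show "alternating_form r (A *\<^sub>v x) (?e i) = 0 \<and> alternating_form r (A *\<^sub>v x) (?e (r + i)) = 0"
        using Sp_alternating_form[OF A(1) xc, of "?e i"] Sp_alternating_form[OF A(1) xc, of "?e (r + i)"]
          A(2) x k orth_pairs_alternating_form[OF xc k] by (simp add: fixes_pairs_def)
    qed
  qed
  have main: "A \<in> H" if "k \<le> r" "A \<in> carrier G" "fixes_pairs r k A" for k and A :: "'a mat"
    using that
  proof (induction k arbitrary: A rule: inc_induct)
    case base
    have Ac: "A \<in> carrier_mat ?n ?n" using base Sp_carrier_mat by blast
    have "col A i = ?e i" if "i < ?n" for i
      using base(2) that mult_mat_unit_vec[OF Ac that]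
      unfolding fixes_pairs_def by (cases "i < r") (auto dest: spec[of _ "i - r"])
    then have "A = 1\<^sub>m ?n" using Ac by (intro mat_col_eqI) auto
    then show ?case using generate.one[of G] by simp
  next
    case (step k)
    have k: "k \<le> r" "k < r" using step.hyps by auto
    note A = step.prems
    have Ac: "A \<in> carrier_mat ?n ?n" using A Sp_carrier_mat by blast
    have o: "orth_pairs r k (?e k)" "orth_pairs r k (?e (r + k))"
      using k by (auto simp: orth_pairs_def)
    have ne: "?e k \<noteq> 0\<^sub>v ?n" using k by auto
    have ef: "alternating_form r (?e k) (?e (r + k)) = 1" using k by (simp add: alternating_form_unit)
    have "A *\<^sub>v ?e k \<noteq> 0\<^sub>v ?n"
    proof
      assume "A *\<^sub>v ?e k = 0\<^sub>v ?n"
      then have "alternating_form r (0\<^sub>v ?n) (A *\<^sub>v ?e (r + k)) = 1"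
        using Sp_alternating_form[OF A(1), of "?e k" "?e (r + k)"] ef by simp
      then show False by (simp add: alternating_form_def)
    qed
    then obtain B where B: "B \<in> H" "fixes_pairs r k B" "B *\<^sub>v (A *\<^sub>v ?e k) = ?e k"
      using move_vector[OF k(1) orth_image[OF A o(1) k(1)] _ o(1) ne] by blast
    have BA: "B * A \<in> carrier G" "fixes_pairs r k (B * A)"
      using monoid.m_closed[OF group.is_monoid[OF group_Sp], of B r A] B A H_subset fixes_pairs_mult[OF _ Ac B(2) A(2)]
        Sp_carrier_mat by auto
    have Bc: "B \<in> carrier_mat ?n ?n" using B H_subset Sp_carrier_mat by blast
    have BAk: "B * A *\<^sub>v ?e k = ?e k" using assoc_mult_mat_vec[OF Bc Ac, of "?e k"] B(3) by simp
    have "alternating_form r (?e k) (B * A *\<^sub>v ?e (r + k)) = 1"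
      using Sp_alternating_form[OF BA(1), of "?e k" "?e (r + k)"] BAk ef by simp
    then obtain C where C: "C \<in> H" "fixes_pairs r k C" "C *\<^sub>v ?e k = ?e k" "C *\<^sub>v (B * A *\<^sub>v ?e (r + k)) = ?e (r + k)"
      using move_partner[OF k(1) o(1) orth_image[OF BA o(2) k(1)] o(2) _ ef] by blast
    have Cc: "C \<in> carrier_mat ?n ?n" using C H_subset Sp_carrier_mat by blast
    have BAc: "B * A \<in> carrier_mat ?n ?n" using BA Sp_carrier_mat by blast
    have CBA: "C * (B * A) \<in> carrier G"
      using monoid.m_closed[OF group.is_monoid[OF group_Sp], of C r "B * A"] C(1) BA(1) H_subset by auto
    have "fixes_pairs r (Suc k) (C * (B * A))"
      using fixes_pairs_mult[OF Cc BAc C(2) BA(2)] C(3,4) BAk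
        assoc_mult_mat_vec[OF Cc BAc, of "?e k"] assoc_mult_mat_vec[OF Cc BAc, of "?e (r + k)"]
      by (auto simp: fixes_pairs_def less_Suc_eq)
    then have "C * (B * A) \<in> H" using step.IH CBA by blast
    then show ?case using H_cancel[OF B(1) A(1)] H_cancel[OF C(1) BA(1)] by blast
  qed
  fix A assume "A \<in> carrier G"
  then show "A \<in> H" using main[of 0 A] by (simp add: fixes_pairs_def)
qed

end

section \<open>Forms on two-by-two matrices\<close>

definition mat2 :: "'a \<Rightarrow> 'a \<Rightarrow> 'a \<Rightarrow> 'a \<Rightarrow> 'a mat" where
  "mat2 a b c d = mat 2 2 (\<lambda>(i, j). if i = 0 then if j = 0 then a else b else if j = 0 then c else d)"

lemma less_2_cases: "(i :: nat) < 2 \<longleftrightarrow> i = 0 \<or> i = 1"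
  by auto

lemma mat2_carrier [simp]: "mat2 a b c d \<in> carrier_mat 2 2"
  by (simp add: mat2_def)

lemma dim_mat2 [simp]: "dim_row (mat2 a b c d) = 2" "dim_col (mat2 a b c d) = 2"
  by (simp_all add: mat2_def)

lemma index_mat2 [simp]:
  "mat2 a b c d $$ (0, 0) = a" "mat2 a b c d $$ (0, Suc 0) = b"
  "mat2 a b c d $$ (Suc 0, 0) = c" "mat2 a b c d $$ (Suc 0, Suc 0) = d"
  by (simp_all add: mat2_def)

lemma mat2_eqI:
  assumes "A \<in> carrier_mat 2 2" "B \<in> carrier_mat 2 2"
    "A $$ (0, 0) = B $$ (0, 0)" "A $$ (0, 1) = B $$ (0, 1)" "A $$ (1, 0) = B $$ (1, 0)" "A $$ (1, 1) = B $$ (1, 1)"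
  shows "A = B"
  using assms by (intro eq_matI) (auto simp: less_2_cases)

lemma mat2_eq_iff [simp]: "mat2 a b c d = mat2 a' b' c' d' \<longleftrightarrow> a = a' \<and> b = b' \<and> c = c' \<and> d = d'"
  by (auto intro!: arg_cong[of _ _ "\<lambda>A. A $$ _"] simp: mat_eq_iff less_2_cases)

lemma mat2_cases:
  assumes "A \<in> carrier_mat 2 2"
  obtains a b c d where "A = mat2 a b c d"
  by (rule that[OF mat2_eqI[OF assms mat2_carrier]]) auto

lemma mat2_mult [simp]:
  "mat2 a b c d * mat2 a' b' c' d' = mat2 (a * a' + b * c') (a * b' + b * d') (c * a' + d * c') (c * b' + d * d' :: 'a :: comm_semiring_0)"
  by (rule mat2_eqI) (auto simp: scalar_prod_def numeral_2_eq_2)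

lemma mat2_add [simp]: "mat2 a b c d + mat2 a' b' c' d' = mat2 (a + a') (b + b') (c + c') (d + d')"
  by (rule mat2_eqI) auto

lemma mat2_minus [simp]: "mat2 a b c d - mat2 a' b' c' d' = mat2 (a - a') (b - b') (c - c') (d - d')"
  by (rule mat2_eqI) auto

lemma mat2_smult [simp]: "k \<cdot>\<^sub>m mat2 a b c d = mat2 (k * a) (k * b) (k * c) (k * d)"
  by (rule mat2_eqI) auto

lemma one_mat2: "1\<^sub>m 2 = mat2 1 0 0 1"
  by (rule mat2_eqI) auto

lemma det_mat2 [simp]: "det (mat2 a b c d) = a * d - b * (c :: 'a :: comm_ring_1)"
proof -
  have "det (mat2 a b c d) = (\<Sum>j<2. mat2 a b c d $$ (0, j) * cofactor (mat2 a b c d) 0 j)"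
    by (rule laplace_expansion_row) auto
  then show ?thesis
    by (simp add: numeral_2_eq_2 cofactor_def mat_delete_def det_single)
qed

text \<open>The adjugate: the inverse on the special linear group, and polynomial and
  antimultiplicative on all matrices of size two.\<close>

definition adj2 :: "'a :: comm_ring_1 mat \<Rightarrow> 'a mat" where
  "adj2 A = mat2 (A $$ (1, 1)) (- A $$ (0, 1)) (- A $$ (1, 0)) (A $$ (0, 0))"

lemma adj2_mat2 [simp]: "adj2 (mat2 a b c d) = mat2 d (- b) (- c) a"
  by (simp add: adj2_def)

lemma SL2_cases:
  assumes "A \<in> carrier (SL TYPE('a :: field) 2)"
  obtains a b c d where "A = mat2 a b c d" "a * d - b * c = 1"
  using assms by (auto simp: carrier_SL elim!: mat2_cases)

lemma mat2_in_SL2 [simp]: "mat2 a b c d \<in> carrier (SL TYPE('a :: field) 2) \<longleftrightarrow> a * d - b * c = 1"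
  by (auto simp: carrier_SL)

lemma elementary_mats_2:
  assumes "A \<in> elementary_mats TYPE('a :: field) 2"
  obtains a where "A = mat2 1 a 0 1" | a where "A = mat2 1 0 a 1"
proof -
  obtain a k l where A: "A = addrow_mat 2 a k l" "k < 2" "l < 2" "k \<noteq> l"
    using assms by (auto simp: elementary_mats_def)
  then consider "k = 0" "l = 1" | "k = 1" "l = 0" by (auto simp: less_2_cases)
  then show thesis
  proof cases
    case 1
    have "A = mat2 1 a 0 1" unfolding A(1) 1 by (rule mat2_eqI) auto
    then show thesis by (rule that(1))
  next
    case 2
    have "A = mat2 1 0 a 1" unfolding A(1) 2 by (rule mat2_eqI) auto
    then show thesis by (rule that(2))
  qed
qed

lemma center_SL2:
  assumes "a * d - b * c = (1 :: 'a :: field)"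
  shows "mat2 a b c d \<in> group_center (SL TYPE('a) 2) \<longleftrightarrow> a = d \<and> b = 0 \<and> c = 0"
  using assms by (subst center_SL) (auto simp: one_mat2)

lemma group_center_subset: "group_center G \<subseteq> carrier G"
  by (auto simp: group_center_def)

section \<open>Trace zero matrices and the model of rank one\<close>

lemma vec_eq_3:
  assumes "x \<in> carrier_vec 3" "y \<in> carrier_vec 3"
  shows "x = y \<longleftrightarrow> x $ 0 = y $ 0 \<and> x $ 1 = y $ 1 \<and> x $ 2 = y $ 2"
  using assms by (auto simp: vec_eq_iff numeral_3_eq_3 numeral_2_eq_2 less_Suc_eq)

text \<open>A trace zero matrix squares to minus its determinant, here \<open>odd_form 1\<close>, so
  one map serves as both \<open>M\<close> and \<open>M'\<close>.\<close>

definition trace_zero_mat :: "'a :: field vec \<Rightarrow> 'a mat" where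
  "trace_zero_mat x = mat2 (x $ 2) (x $ 0) (x $ 1) (- x $ 2)"

lemma odd_form_1: "odd_form 1 x = x $ 0 * x $ 1 + (x $ 2)\<^sup>2"
  by (simp add: odd_form_def)

lemma polar_odd_form_1:
  assumes "u \<in> carrier_vec 3" "w \<in> carrier_vec 3"
  shows "polar_form (odd_form 1) u w = u $ 0 * w $ 1 + w $ 0 * u $ 1 + 2 * u $ 2 * w $ 2"
  using assms unfolding polar_form_def odd_form_1 by (simp add: power2_eq_square algebra_simps)

lemma B_model_1_iso: "B_model TYPE('a :: field) 1 \<cong> PSL TYPE('a) 2"
proof -
  interpret clifford_pair 3 2 "odd_form 1 :: 'a vec \<Rightarrow> 'a" trace_zero_mat trace_zero_mat
  proof
    fix x y :: "'a vec" and c :: 'a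
    assume x: "x \<in> carrier_vec 3"
    show "trace_zero_mat x \<in> carrier_mat 2 2"
      by (simp_all add: trace_zero_mat_def)
    show "trace_zero_mat (c \<cdot>\<^sub>v x) = c \<cdot>\<^sub>m trace_zero_mat x"
      using x by (simp add: trace_zero_mat_def)
    show "trace_zero_mat x * trace_zero_mat x = odd_form 1 x \<cdot>\<^sub>m 1\<^sub>m 2"
      unfolding trace_zero_mat_def odd_form_1 one_mat2 by (simp_all add: power2_eq_square mult.commute)
    assume y: "y \<in> carrier_vec 3"
    show "trace_zero_mat (x + y) = trace_zero_mat x + trace_zero_mat y"
      using x y by (simp_all add: trace_zero_mat_def)
    assume "trace_zero_mat x = trace_zero_mat y"
    then show "x = y" using vec_eq_3[OF x y] by (simp add: trace_zero_mat_def)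
  qed
  have vl: "vec 3 ((!) [p, q, r]) \<in> carrier_vec 3" "vec 3 ((!) [p, q, r]) $ 0 = p"
    "vec 3 ((!) [p, q, r]) $ 1 = q" "vec 3 ((!) [p, q, r]) $ 2 = r" for p q r :: 'a
    by simp_all
  have "projective_model 3 (odd_form 1 :: 'a vec \<Rightarrow> 'a) \<cong> PSL TYPE('a) 2"
    unfolding PSL_def
  proof (rule projective_model_iso_action[where \<alpha> = "\<lambda>A. A" and \<beta> = adj2, OF group_SL _ _ _ _ _ _ elementary_mats_SL SL_subset_generate_elementary])
    fix A :: "'a mat" assume "A \<in> carrier (SL TYPE('a) 2)"
    then show "A \<in> carrier_mat 2 2 \<and> adj2 A \<in> carrier_mat 2 2" by (auto elim!: SL2_cases)
  next
    fix A B :: "'a mat" assume "A \<in> carrier (SL TYPE('a) 2)" "B \<in> carrier (SL TYPE('a) 2)"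
    then show "A \<otimes>\<^bsub>SL TYPE('a) 2\<^esub> B = A * B \<and> adj2 (A \<otimes>\<^bsub>SL TYPE('a) 2\<^esub> B) = adj2 B * adj2 A"
      by (auto elim!: SL2_cases simp: algebra_simps)
  next
    fix A :: "'a mat" and x :: "'a vec" assume A: "A \<in> carrier (SL TYPE('a) 2)"
    obtain a b c d where Ae: "A = mat2 a b c d" using A by (rule SL2_cases)
    obtain r p q t where e: "A * trace_zero_mat x * adj2 A = mat2 r p q t"
      by (rule mat2_cases[of "A * trace_zero_mat x * adj2 A"]) (auto simp: Ae trace_zero_mat_def)
    moreover have "t = - r" using e by (auto simp: Ae trace_zero_mat_def algebra_simps eq_neg_iff_add_eq_0)
    ultimately have e: "A * trace_zero_mat x * adj2 A = mat2 r p q (- r)" by simp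
    show "\<exists>y\<in>carrier_vec 3. trace_zero_mat y = A * trace_zero_mat x * adj2 A"
      unfolding e by (intro bexI[of _ "vec 3 ((!) [p, q, r])"]) (simp_all only: trace_zero_mat_def vl)
  next
    fix u w :: "'a vec"
    assume u: "u \<in> carrier_vec 3" and w: "w \<in> carrier_vec 3" and Q: "odd_form 1 u = 0" "polar_form (odd_form 1) u w = 0"
    note e = Q[unfolded odd_form_1 polar_odd_form_1[OF u w]]
    let ?A = "1\<^sub>m 2 - trace_zero_mat u * trace_zero_mat w"
    \<comment> \<open>This is det (1 - u w) = 1 - B(u, w) + Q(u) Q(w), and both corrections
      vanish.\<close>
    have "det ?A = 1 - (u $ 0 * w $ 1 + w $ 0 * u $ 1 + 2 * u $ 2 * w $ 2)
        + (u $ 0 * u $ 1 + (u $ 2)\<^sup>2) * (w $ 0 * w $ 1 + (w $ 2)\<^sup>2)"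
      unfolding trace_zero_mat_def one_mat2 mat2_mult mat2_minus det_mat2
      by (simp add: power2_eq_square algebra_simps)
    then have "?A \<in> carrier (SL TYPE('a) 2)"
      unfolding e by (simp add: carrier_SL trace_zero_mat_def one_mat2)
    moreover have "adj2 ?A = 1\<^sub>m 2 - trace_zero_mat w * trace_zero_mat u"
      by (simp add: trace_zero_mat_def one_mat2 algebra_simps)
    ultimately show "\<exists>A\<in>carrier (SL TYPE('a) 2). A = 1\<^sub>m 2 - trace_zero_mat u * trace_zero_mat w
        \<and> adj2 A = 1\<^sub>m 2 - trace_zero_mat w * trace_zero_mat u" by blast
  next
    fix A :: "'a mat" assume "A \<in> elementary_mats TYPE('a) 2"
    then show "\<exists>u w. u \<in> carrier_vec 3 \<and> w \<in> carrier_vec 3 \<and> u \<noteq> 0\<^sub>v 3 \<and> odd_form 1 u = 0 \<and> polar_form (odd_form 1) u w = 0 \<and>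
       A = 1\<^sub>m 2 - trace_zero_mat u * trace_zero_mat w \<and> adj2 A = 1\<^sub>m 2 - trace_zero_mat w * trace_zero_mat u"
    proof (cases rule: elementary_mats_2)
      \<comment> \<open>\<open>u\<close> is a nilpotent matrix unit and \<open>w\<close> a multiple
        of diag(1, -1), so the product is a multiple of \<open>u\<close>.\<close>
      case (1 a)
      then show ?thesis
        by (intro exI[of _ "vec 3 ((!) [1, 0, 0])"] exI[of _ "vec 3 ((!) [0, 0, a])"])
           (simp only: vl vec_eq_3 polar_odd_form_1 odd_form_1 trace_zero_mat_def zero_carrier_vec, simp add: one_mat2)
    next
      case (2 a)
      then show ?thesis
        by (intro exI[of _ "vec 3 ((!) [0, 1, 0])"] exI[of _ "vec 3 ((!) [0, 0, - a])"])
           (simp only: vl vec_eq_3 polar_odd_form_1 odd_form_1 trace_zero_mat_def zero_carrier_vec, simp add: one_mat2)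
    qed
  next
    fix A assume "A \<in> carrier (SL TYPE('a) 2)"
    then obtain a b c d where A: "A = mat2 a b c d" and det: "a * d - b * c = 1" by (rule SL2_cases)
    show "A \<in> group_center (SL TYPE('a) 2) \<longleftrightarrow> (\<exists>k. \<forall>x\<in>carrier_vec 3. A * trace_zero_mat x * adj2 A = k \<cdot>\<^sub>m trace_zero_mat x)"
      unfolding A center_SL2[OF det]
    proof
      assume "a = d \<and> b = 0 \<and> c = 0"
      then show "\<exists>k. \<forall>x\<in>carrier_vec 3. mat2 a b c d * trace_zero_mat x * adj2 (mat2 a b c d) = k \<cdot>\<^sub>m trace_zero_mat x"
        by (intro exI[of _ "d * d"]) (simp add: trace_zero_mat_def algebra_simps)
    next
      assume "\<exists>k. \<forall>x\<in>carrier_vec 3. mat2 a b c d * trace_zero_mat x * adj2 (mat2 a b c d) = k \<cdot>\<^sub>m trace_zero_mat x"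
      then obtain k where k: "mat2 a b c d * trace_zero_mat x * adj2 (mat2 a b c d) = k \<cdot>\<^sub>m trace_zero_mat x"
        if "x \<in> carrier_vec 3" for x by blast
      have k': "mat2 a b c d * mat2 r p q (- r) * adj2 (mat2 a b c d) = k \<cdot>\<^sub>m mat2 r p q (- r)" for p q r
        using k[of "vec 3 ((!) [p, q, r])"] by (simp only: trace_zero_mat_def vl)
      \<comment> \<open>The nilpotent matrix units make the matrix diagonal; diag(1, -1) then
        identifies the two diagonal entries.\<close>
      have 0: "b = 0" "c = 0" using k'[of 0 1 0] k'[of 0 0 1] by auto
      have "a * a = k" "a * d = k" using k'[of 0 1 0] k'[of 1 0 0] det 0 by auto
      moreover have "a \<noteq> 0" using det 0 by auto
      ultimately have "a = d" by (metis mult_left_cancel)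
      then show "a = d \<and> b = 0 \<and> c = 0" using 0 by simp
    qed
  qed (auto simp: group_center_subset one_mat2)
  then show ?thesis by (simp add: B_model_def)
qed

section \<open>All matrices of size two and the split model of rank two\<close>

lemma vec_eq_4:
  assumes "x \<in> carrier_vec 4" "y \<in> carrier_vec 4"
  shows "x = y \<longleftrightarrow> x $ 0 = y $ 0 \<and> x $ 1 = y $ 1 \<and> x $ 2 = y $ 2 \<and> x $ 3 = y $ 3"
  using assms by (auto simp: vec_eq_iff numeral_eq_Suc less_Suc_eq)

text \<open>The signs make the determinant equal to \<open>hyperbolic_form 2\<close>;
  \<open>square_mat2'\<close> is the adjugate.\<close>

definition square_mat2 :: "'a :: field vec \<Rightarrow> 'a mat" where
  "square_mat2 x = mat2 (x $ 0) (- x $ 1) (x $ 3) (x $ 2)"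

definition square_mat2' :: "'a :: field vec \<Rightarrow> 'a mat" where
  "square_mat2' x = mat2 (x $ 2) (x $ 1) (- x $ 3) (x $ 0)"

lemma hyperbolic_form_2: "hyperbolic_form 2 x = x $ 0 * x $ 2 + x $ 1 * x $ 3"
  by (simp add: hyperbolic_form_def numeral_eq_Suc)

lemma polar_hyperbolic_form_2:
  assumes "u \<in> carrier_vec 4" "w \<in> carrier_vec 4"
  shows "polar_form (hyperbolic_form 2) u w = u $ 0 * w $ 2 + w $ 0 * u $ 2 + u $ 1 * w $ 3 + w $ 1 * u $ 3"
  using assms unfolding polar_form_def hyperbolic_form_2 by (simp add: algebra_simps)

lemma (in group) DirProd_generate:
  assumes H: "group H" and S: "S \<subseteq> carrier G" "carrier G \<subseteq> generate G S"
    and T: "T \<subseteq> carrier H" "carrier H \<subseteq> generate H T"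
  shows "carrier (G \<times>\<times> H) \<subseteq> generate (G \<times>\<times> H) ((\<lambda>s. (s, \<one>\<^bsub>H\<^esub>)) ` S \<union> (\<lambda>t. (\<one>, t)) ` T)"
proof
  let ?X = "(\<lambda>s. (s, \<one>\<^bsub>H\<^esub>)) ` S \<union> (\<lambda>t. (\<one>, t)) ` T"
  interpret H: group H by fact
  interpret P: group "G \<times>\<times> H" by (rule DirProd_group[OF is_group H])
  interpret l: group_hom G "G \<times>\<times> H" "\<lambda>g. (g, \<one>\<^bsub>H\<^esub>)"
    by unfold_locales (auto simp: hom_def)
  interpret r: group_hom H "G \<times>\<times> H" "\<lambda>h. (\<one>, h)"
    by unfold_locales (auto simp: hom_def)
  fix p assume "p \<in> carrier (G \<times>\<times> H)"
  then obtain g h where p: "p = (g, h)" "g \<in> carrier G" "h \<in> carrier H" by auto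
  have "(g, \<one>\<^bsub>H\<^esub>) \<in> generate (G \<times>\<times> H) ((\<lambda>s. (s, \<one>\<^bsub>H\<^esub>)) ` S)"
    unfolding l.generate_img[OF S(1)] using p S(2) by blast
  moreover have "(\<one>, h) \<in> generate (G \<times>\<times> H) ((\<lambda>t. (\<one>, t)) ` T)"
    unfolding r.generate_img[OF T(1)] using p T(2) by blast
  ultimately have "(g, \<one>\<^bsub>H\<^esub>) \<otimes>\<^bsub>G \<times>\<times> H\<^esub> (\<one>, h) \<in> generate (G \<times>\<times> H) ?X"
    using P.mono_generate[of _ ?X] by (intro generate.eng) blast+
  then show "p \<in> generate (G \<times>\<times> H) ?X" using p by simp
qed

lemma group_center_normal:
  fixes G (structure)
  assumes "group G"
  shows "group_center G \<lhd> G"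
proof -
  interpret group G by fact
  have "subgroup (group_center G) G"
  proof
    fix x y assume x: "x \<in> group_center G" and y: "y \<in> group_center G"
    have c: "x \<in> carrier G" "y \<in> carrier G" using x y by (auto simp: group_center_def)
    have "x \<otimes> y \<otimes> g = g \<otimes> (x \<otimes> y)" if g: "g \<in> carrier G" for g
    proof -
      have "x \<otimes> y \<otimes> g = x \<otimes> (g \<otimes> y)" using c g y by (simp add: m_assoc group_center_def)
      also have "\<dots> = g \<otimes> x \<otimes> y" using c g x by (simp add: m_assoc[symmetric] group_center_def)
      finally show ?thesis using c g by (simp add: m_assoc)
    qed
    then show "x \<otimes> y \<in> group_center G" using c by (simp add: group_center_def)
  next
    fix x assume x: "x \<in> group_center G"
    have c: "x \<in> carrier G" using x by (auto simp: group_center_def)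
    have "inv x \<otimes> g = g \<otimes> inv x" if g: "g \<in> carrier G" for g
    proof -
      have "x \<otimes> g = g \<otimes> x" using x g by (simp add: group_center_def)
      then have "inv x \<otimes> (x \<otimes> g) \<otimes> inv x = inv x \<otimes> (g \<otimes> x) \<otimes> inv x" by simp
      then have "(inv x \<otimes> x) \<otimes> (g \<otimes> inv x) = (inv x \<otimes> g) \<otimes> (x \<otimes> inv x)"
        using c g by (simp only: m_assoc inv_closed m_closed)
      then show ?thesis using c g by simp
    qed
    then show "inv x \<in> group_center G" using c by (simp add: group_center_def)
  qed (auto simp: group_center_def)
  moreover have "x \<otimes> h \<otimes> inv x \<in> group_center G" if x: "x \<in> carrier G" and h: "h \<in> group_center G" for x h
  proof -
    have "h \<in> carrier G" "x \<otimes> h = h \<otimes> x" using h x by (auto simp: group_center_def)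
    then have "x \<otimes> h \<otimes> inv x = h" using x by (simp add: m_assoc)
    then show ?thesis using h by simp
  qed
  ultimately show ?thesis unfolding normal_inv_iff by blast
qed

text \<open>A pair (A, B) acts by X \<mapsto> A X adj(B), which preserves the determinant. It acts
  as a scalar exactly if both components are central, so the quotient splits into two
  factors.\<close>

lemma D_model_2_iso: "D_model TYPE('a :: field) 2 \<cong> PSL TYPE('a) 2 \<times>\<times> PSL TYPE('a) 2"
proof -
  let ?G = "SL TYPE('a) 2"
  let ?S = "(\<lambda>A. (A, \<one>\<^bsub>?G\<^esub>)) ` elementary_mats TYPE('a) 2 \<union> (\<lambda>A. (\<one>\<^bsub>?G\<^esub>, A)) ` elementary_mats TYPE('a) 2"
  interpret clifford_pair 4 2 "hyperbolic_form 2 :: 'a vec \<Rightarrow> 'a" square_mat2 square_mat2'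
  proof
    fix x y :: "'a vec" and c :: 'a
    assume x: "x \<in> carrier_vec 4"
    show "square_mat2 x \<in> carrier_mat 2 2" "square_mat2' x \<in> carrier_mat 2 2"
      by (simp_all add: square_mat2_def square_mat2'_def)
    show "square_mat2 (c \<cdot>\<^sub>v x) = c \<cdot>\<^sub>m square_mat2 x"
      using x by (simp add: square_mat2_def)
    show "square_mat2 x * square_mat2' x = hyperbolic_form 2 x \<cdot>\<^sub>m 1\<^sub>m 2"
      "square_mat2' x * square_mat2 x = hyperbolic_form 2 x \<cdot>\<^sub>m 1\<^sub>m 2"
      unfolding square_mat2_def square_mat2'_def hyperbolic_form_2 one_mat2 by (simp_all add: mult.commute)
    assume y: "y \<in> carrier_vec 4"
    show "square_mat2 (x + y) = square_mat2 x + square_mat2 y" "square_mat2' (x + y) = square_mat2' x + square_mat2' y"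
      using x y by (simp_all add: square_mat2_def square_mat2'_def)
    assume "square_mat2 x = square_mat2 y"
    then show "x = y" using vec_eq_4[OF x y] by (simp add: square_mat2_def)
  qed
  have vl: "vec 4 ((!) [p, q, r, s]) \<in> carrier_vec 4" "vec 4 ((!) [p, q, r, s]) $ 0 = p"
    "vec 4 ((!) [p, q, r, s]) $ 1 = q" "vec 4 ((!) [p, q, r, s]) $ 2 = r" "vec 4 ((!) [p, q, r, s]) $ 3 = s" for p q r s :: 'a
    by simp_all
  have "projective_model 4 (hyperbolic_form 2 :: 'a vec \<Rightarrow> 'a) \<cong> (?G \<times>\<times> ?G) Mod (group_center ?G \<times> group_center ?G)"
  proof (rule projective_model_iso_action[where \<alpha> = fst and \<beta> = "\<lambda>p. adj2 (snd p)" and S = ?S])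
    show "group (?G \<times>\<times> ?G)" by (rule DirProd_group[OF group_SL group_SL])
    show "carrier (?G \<times>\<times> ?G) \<subseteq> generate (?G \<times>\<times> ?G) ?S"
      by (rule group.DirProd_generate[OF group_SL group_SL elementary_mats_SL SL_subset_generate_elementary
            elementary_mats_SL SL_subset_generate_elementary])
    show "?S \<subseteq> carrier (?G \<times>\<times> ?G)"
      using elementary_mats_SL group.is_monoid[OF group_SL, THEN monoid.one_closed] by fastforce
    show "group_center ?G \<times> group_center ?G \<subseteq> carrier (?G \<times>\<times> ?G)"
      using group_center_subset[of ?G] by auto
  next
    fix p assume "p \<in> carrier (?G \<times>\<times> ?G)"
    then show "fst p \<in> carrier_mat 2 2 \<and> adj2 (snd p) \<in> carrier_mat 2 2" by (auto elim!: SL2_cases)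
  next
    fix p q assume "p \<in> carrier (?G \<times>\<times> ?G)" "q \<in> carrier (?G \<times>\<times> ?G)"
    then show "fst (p \<otimes>\<^bsub>?G \<times>\<times> ?G\<^esub> q) = fst p * fst q \<and> adj2 (snd (p \<otimes>\<^bsub>?G \<times>\<times> ?G\<^esub> q)) = adj2 (snd q) * adj2 (snd p)"
      by (auto elim!: SL2_cases simp: algebra_simps)
  next
    fix p and x :: "'a vec" assume p: "p \<in> carrier (?G \<times>\<times> ?G)"
    obtain a b c d where e: "fst p * square_mat2 x * adj2 (snd p) = mat2 a b c d"
      by (rule mat2_cases[of "fst p * square_mat2 x * adj2 (snd p)"])
         (use p in \<open>auto elim!: SL2_cases simp: square_mat2_def\<close>)
    show "\<exists>y\<in>carrier_vec 4. square_mat2 y = fst p * square_mat2 x * adj2 (snd p)"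
      unfolding e by (intro bexI[of _ "vec 4 ((!) [a, - b, d, c])"]) (simp_all only: square_mat2_def vl minus_minus)
  next
    fix u w :: "'a vec"
    assume u: "u \<in> carrier_vec 4" and w: "w \<in> carrier_vec 4"
      and Q: "hyperbolic_form 2 u = 0" "polar_form (hyperbolic_form 2) u w = 0"
    note e = Q[unfolded hyperbolic_form_2 polar_hyperbolic_form_2[OF u w]]
    let ?A = "1\<^sub>m 2 - square_mat2 u * square_mat2' w" and ?B = "1\<^sub>m 2 - square_mat2' w * square_mat2 u"
    have "det ?A = 1 - (u $ 0 * w $ 2 + w $ 0 * u $ 2 + u $ 1 * w $ 3 + w $ 1 * u $ 3)
        + (u $ 0 * u $ 2 + u $ 1 * u $ 3) * (w $ 0 * w $ 2 + w $ 1 * w $ 3)"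
      unfolding square_mat2_def square_mat2'_def one_mat2 mat2_mult mat2_minus det_mat2
      by (simp add: algebra_simps)
    then have "?A \<in> carrier ?G"
      unfolding e by (simp add: carrier_SL square_mat2_def square_mat2'_def one_mat2)
    moreover have "det (adj2 ?B) = 1 - (u $ 0 * w $ 2 + w $ 0 * u $ 2 + u $ 1 * w $ 3 + w $ 1 * u $ 3)
        + (u $ 0 * u $ 2 + u $ 1 * u $ 3) * (w $ 0 * w $ 2 + w $ 1 * w $ 3)"
      unfolding square_mat2_def square_mat2'_def one_mat2 mat2_mult mat2_minus adj2_mat2 det_mat2
      by (simp add: algebra_simps)
    then have "adj2 ?B \<in> carrier ?G"
      unfolding e by (simp add: carrier_SL square_mat2_def square_mat2'_def one_mat2)
    moreover have "adj2 (adj2 ?B) = ?B"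
      by (simp add: square_mat2_def square_mat2'_def one_mat2)
    ultimately show "\<exists>p\<in>carrier (?G \<times>\<times> ?G). fst p = ?A \<and> adj2 (snd p) = ?B"
      by (intro bexI[of _ "(?A, adj2 ?B)"]) simp_all
  next
    fix p assume "p \<in> ?S"
    then consider A where "p = (A, 1\<^sub>m 2)" "A \<in> elementary_mats TYPE('a) 2"
      | A where "p = (1\<^sub>m 2, A)" "A \<in> elementary_mats TYPE('a) 2" by auto
    then show "\<exists>u w. u \<in> carrier_vec 4 \<and> w \<in> carrier_vec 4 \<and> u \<noteq> 0\<^sub>v 4 \<and> hyperbolic_form 2 u = 0 \<and> polar_form (hyperbolic_form 2) u w = 0 \<and>
       fst p = 1\<^sub>m 2 - square_mat2 u * square_mat2' w \<and> adj2 (snd p) = 1\<^sub>m 2 - square_mat2' w * square_mat2 u"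
    proof cases
      \<comment> \<open>In all four cases \<open>u\<close> and \<open>w\<close> lie in a common
        totally singular plane, chosen such that one of the products M u M' w and M' w M u vanishes;
        the corresponding component is then trivial.\<close>
      case (1 A)
      from 1(2) show ?thesis
      proof (cases rule: elementary_mats_2)
        case (1 a)
        then show ?thesis unfolding \<open>p = _\<close>
          by (intro exI[of _ "vec 4 ((!) [1, 0, 0, 0])"] exI[of _ "vec 4 ((!) [0, - a, 0, 0])"])
             (simp only: vl vec_eq_4 polar_hyperbolic_form_2 hyperbolic_form_2 square_mat2_def square_mat2'_def zero_carrier_vec, simp add: one_mat2)
      next
        case (2 a)
        then show ?thesis unfolding \<open>p = _\<close>
          by (intro exI[of _ "vec 4 ((!) [0, 0, 1, 0])"] exI[of _ "vec 4 ((!) [0, 0, 0, a])"])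
             (simp only: vl vec_eq_4 polar_hyperbolic_form_2 hyperbolic_form_2 square_mat2_def square_mat2'_def zero_carrier_vec, simp add: one_mat2)
      qed
    next
      case (2 A)
      from 2(2) show ?thesis
      proof (cases rule: elementary_mats_2)
        case (1 a)
        then show ?thesis unfolding \<open>p = _\<close>
          by (intro exI[of _ "vec 4 ((!) [0, 0, 1, 0])"] exI[of _ "vec 4 ((!) [0, a, 0, 0])"])
             (simp only: vl vec_eq_4 polar_hyperbolic_form_2 hyperbolic_form_2 square_mat2_def square_mat2'_def zero_carrier_vec, simp add: one_mat2)
      next
        case (2 a)
        then show ?thesis unfolding \<open>p = _\<close>
          by (intro exI[of _ "vec 4 ((!) [1, 0, 0, 0])"] exI[of _ "vec 4 ((!) [0, 0, 0, - a])"])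
             (simp only: vl vec_eq_4 polar_hyperbolic_form_2 hyperbolic_form_2 square_mat2_def square_mat2'_def zero_carrier_vec, simp add: one_mat2)
      qed
    qed
  next
    fix p assume "p \<in> carrier (?G \<times>\<times> ?G)"
    then obtain a b c d a' b' c' d' where p: "p = (mat2 a b c d, mat2 a' b' c' d')"
      and det: "a * d - b * c = 1" "a' * d' - b' * c' = 1" by (auto elim!: SL2_cases)
    show "p \<in> group_center ?G \<times> group_center ?G
        \<longleftrightarrow> (\<exists>k. \<forall>x\<in>carrier_vec 4. fst p * square_mat2 x * adj2 (snd p) = k \<cdot>\<^sub>m square_mat2 x)"
      unfolding p mem_Times_iff fst_conv snd_conv center_SL2[OF det(1)] center_SL2[OF det(2)]
    proof
      assume "(a = d \<and> b = 0 \<and> c = 0) \<and> (a' = d' \<and> b' = 0 \<and> c' = 0)"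
      then show "\<exists>k. \<forall>x\<in>carrier_vec 4. mat2 a b c d * square_mat2 x * adj2 (mat2 a' b' c' d') = k \<cdot>\<^sub>m square_mat2 x"
        by (intro exI[of _ "d * d'"]) (simp add: square_mat2_def algebra_simps)
    next
      assume "\<exists>k. \<forall>x\<in>carrier_vec 4. mat2 a b c d * square_mat2 x * adj2 (mat2 a' b' c' d') = k \<cdot>\<^sub>m square_mat2 x"
      then obtain k where k: "mat2 a b c d * square_mat2 x * adj2 (mat2 a' b' c' d') = k \<cdot>\<^sub>m square_mat2 x"
        if "x \<in> carrier_vec 4" for x by blast
      have k': "mat2 a b c d * mat2 p (- q) s r * adj2 (mat2 a' b' c' d') = k \<cdot>\<^sub>m mat2 p (- q) s r" for p q r s
        using k[of "vec 4 ((!) [p, q, r, s])"] by (simp only: square_mat2_def vl)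
      have 00: "a * d' = k" "c * d' = 0" "a * b' = 0" "c * b' = 0" using k'[of 1 0 0 0] by auto
      have 11: "d * a' = k" "b * a' = 0" "d * c' = 0" "b * c' = 0" using k'[of 0 0 0 1] by auto
      have 10: "b * d' = 0" "b * b' = 0" "d * d' = k" "d * b' = 0" using k'[of 0 0 1 0] by auto
      have 01: "a * a' = k" "c * a' = 0" "a * c' = 0" using k'[of 0 "-1" 0 0] by auto
      \<comment> \<open>An element that annihilates a row of a matrix of determinant one is
        0.\<close>
      have zero: "x = 0" if "x * p = 0" "x * q = 0" "p * s - q * t = 1" for x p q s t :: 'a
      proof -
        have "x = x * (p * s - q * t)" using that(3) by simp
        also have "\<dots> = (x * p) * s - (x * q) * t" by (simp add: algebra_simps)
        finally show ?thesis using that by simp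
      qed
      have b: "b = 0" by (rule zero[OF _ _ det(2)]) (use 11 10 in auto)
      have c: "c = 0" by (rule zero[OF _ _ det(2)]) (use 00 01 in auto)
      have b': "b' = 0" by (rule zero[OF _ _ det(1)]) (use 00 10 in auto)
      have c': "c' = 0" by (rule zero[OF _ _ det(1)]) (use 11 01 in auto)
      have "d \<noteq> 0" "a' \<noteq> 0" using det b b' by auto
      then have "a = d" "a' = d'" using 00(1) 11(1) 10(3) 01(1) by (metis mult_left_cancel mult_right_cancel)+
      then show "(a = d \<and> b = 0 \<and> c = 0) \<and> (a' = d' \<and> b' = 0 \<and> c' = 0)" using b c b' c' by simp
    qed
  qed (simp_all add: one_mat2)
  moreover have "(?G \<times>\<times> ?G) Mod (group_center ?G \<times> group_center ?G) \<cong> PSL TYPE('a) 2 \<times>\<times> PSL TYPE('a) 2"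
    unfolding PSL_def
    by (rule group.FactGroup_DirProd_multiplication_iso_2[OF group_SL group_SL
          group_center_normal[OF group_SL] group_center_normal[OF group_SL]])
  ultimately show ?thesis
    unfolding D_model_def using iso_trans by fastforce
qed

text \<open>On the plane the alternating form is the determinant of two vectors, hence a matrix
  multiplies it by its own determinant and the two groups coincide.\<close>

lemma C_model_1_iso: "C_model TYPE('a :: field) 1 \<cong> PSL TYPE('a) 2"
proof -
  have form: "alternating_form 1 (A *\<^sub>v x) (A *\<^sub>v y) = det A * alternating_form 1 x y"
    if "A \<in> carrier_mat 2 2" "x \<in> carrier_vec 2" "y \<in> carrier_vec 2" for A and x y :: "'a vec"
  proof -
    from that(1) obtain a b c d where A: "A = mat2 a b c d" by (rule mat2_cases)
    have entries: "(A *\<^sub>v z) $ 0 = a * z $ 0 + b * z $ 1" "(A *\<^sub>v z) $ 1 = c * z $ 0 + d * z $ 1"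
      if "z \<in> carrier_vec 2" for z
      using that by (simp_all add: A mat2_def scalar_prod_def numeral_2_eq_2)
    have "alternating_form 1 v w = v $ 0 * w $ 1 - v $ 1 * w $ 0" for v w :: "'a vec"
      by (simp add: alternating_form_def)
    moreover have "det A = a * d - b * c" by (simp add: A)
    ultimately show ?thesis
      using that(2,3) by (simp only: entries) (simp add: algebra_simps)
  qed
  have "carrier (Sp TYPE('a) 1) = carrier (SL TYPE('a) 2)"
  proof (intro Set.set_eqI iffI)
    fix A assume A: "A \<in> carrier (Sp TYPE('a) 1)"
    then have Ac: "A \<in> carrier_mat 2 2" using Sp_carrier_mat[OF A] by simp
    have "alternating_form 1 (A *\<^sub>v unit_vec 2 0) (A *\<^sub>v unit_vec 2 1) = alternating_form 1 (unit_vec 2 0) (unit_vec 2 1 :: 'a vec)"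
      using Sp_alternating_form[OF A] by simp
    then have "det A = 1" using form[OF Ac, of "unit_vec 2 0" "unit_vec 2 1"] by (simp add: alternating_form_def)
    then show "A \<in> carrier (SL TYPE('a) 2)" using Ac by (simp add: carrier_SL)
  next
    fix A assume A: "A \<in> carrier (SL TYPE('a) 2)"
    then have "A \<in> carrier (GL TYPE('a) 2)" by (simp add: SL_def)
    then show "A \<in> carrier (Sp TYPE('a) 1)" using A form by (auto simp: carrier_SL carrier_Sp carrier_GL)
  qed
  then have "Sp TYPE('a) 1 = SL TYPE('a) 2" by (simp add: Sp_def SL_def GL_def)
  then have "C_model TYPE('a) 1 = PSL TYPE('a) 2" unfolding C_model_def PSL_def by simp
  then show ?thesis by simp
qed

section \<open>Odd-dimensional forms in characteristic two\<close>

text \<open>Invertibility comes from nondegeneracy: a vector in the kernel would be orthogonal to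
  every vector.\<close>

lemma SpI:
  fixes A :: "'a :: field mat"
  assumes A: "A \<in> carrier_mat (2 * r) (2 * r)"
    and form: "\<And>x y. x \<in> carrier_vec (2 * r) \<Longrightarrow> y \<in> carrier_vec (2 * r)
      \<Longrightarrow> alternating_form r (A *\<^sub>v x) (A *\<^sub>v y) = alternating_form r x y"
  shows "A \<in> carrier (Sp TYPE('a) r)"
proof -
  have "det A \<noteq> 0"
  proof
    assume "det A = 0"
    then obtain x where x: "x \<in> carrier_vec (2 * r)" "x \<noteq> 0\<^sub>v (2 * r)" "A *\<^sub>v x = 0\<^sub>v (2 * r)"
      using det_0_iff_vec_prod_zero_field[OF A] by blast
    have "orth_pairs r 0 x" using x by (simp add: orth_pairs_def)
    then obtain y where y: "orth_pairs r 0 y" "alternating_form r x y \<noteq> 0"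
      using orth_pairs_dual[of 0 r x] x by auto
    have "alternating_form r (0\<^sub>v (2 * r)) (A *\<^sub>v y) = alternating_form r x y"
      using form[of x y] x y by (simp add: orth_pairs_def)
    then show False using y by (simp add: alternating_form_def)
  qed
  then have "A \<in> carrier (GL TYPE('a) (2 * r))"
    using det_non_zero_imp_unit[OF A, of "()"] by (simp add: GL_def units_of_def)
  then show ?thesis using form by (simp add: Sp_def)
qed

definition trunc_vec :: "nat \<Rightarrow> 'a vec \<Rightarrow> 'a vec" where
  "trunc_vec n x = vec n (\<lambda>i. x $ i)"

lemma trunc_vec_carrier [simp]: "trunc_vec n x \<in> carrier_vec n"
  by (simp add: trunc_vec_def)

lemma index_trunc_vec [simp]: "i < n \<Longrightarrow> trunc_vec n x $ i = x $ i"
  by (simp add: trunc_vec_def)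

lemma dim_trunc_vec [simp]: "dim_vec (trunc_vec n x) = n"
  by (simp add: trunc_vec_def)

lemma odd_form_hyperbolic: "odd_form r x = hyperbolic_form r (trunc_vec (2 * r) x) + (x $ (2 * r))\<^sup>2"
  by (auto simp: odd_form_def hyperbolic_form_def intro!: sum.cong)

lemma odd_form_smult:
  assumes "x \<in> carrier_vec (Suc (2 * r))"
  shows "odd_form r (c \<cdot>\<^sub>v x) = c\<^sup>2 * odd_form r x"
proof -
  have "(\<Sum>i<r. (c \<cdot>\<^sub>v x) $ i * (c \<cdot>\<^sub>v x) $ (r + i)) = c\<^sup>2 * (\<Sum>i<r. x $ i * x $ (r + i))"
    using assms by (auto simp: sum_distrib_left power2_eq_square intro!: sum.cong)
  moreover have "((c \<cdot>\<^sub>v x) $ (2 * r))\<^sup>2 = c\<^sup>2 * (x $ (2 * r))\<^sup>2"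
    using assms by (simp add: power_mult_distrib)
  ultimately show ?thesis by (simp add: odd_form_def algebra_simps)
qed

lemma siegel_map_carrier:
  "x \<in> carrier_vec n \<Longrightarrow> u \<in> carrier_vec n \<Longrightarrow> w \<in> carrier_vec n \<Longrightarrow> siegel_map n Q u w x \<in> carrier_vec n"
  by (simp add: siegel_map_def)

locale char2_finite_field =
  fixes ty :: "'a :: field itself" and r :: nat
  assumes finite_field: "finite (UNIV :: 'a set)" and char2: "CHAR('a) = 2"
begin

lemma add_self [simp]: "(a :: 'a) + a = 0"
  using of_nat_CHAR[where 'a = 'a] by (simp add: char2 mult_2[symmetric])

lemma add_self_left [simp]: "(a :: 'a) + (a + b) = b"
  by (simp add: add.assoc[symmetric])

lemma uminus_eq [simp]: "- (a :: 'a) = a"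
  by (simp add: uminus_CHAR_2 char2)

lemma minus_eq_plus [simp]: "(a :: 'a) - b = a + b"
  by (simp add: minus_CHAR_2 char2)

lemma two_eq_0 [simp]: "(2 :: 'a) = 0"
  using add_self[of 1] by (metis one_add_one)

definition sq_root :: "'a \<Rightarrow> 'a" where
  "sq_root = inv_into UNIV (\<lambda>a. a\<^sup>2)"

text \<open>Equal squares agree up to sign, and signs are invisible in characteristic two.\<close>

lemma square_eqD: "(a :: 'a)\<^sup>2 = b\<^sup>2 \<Longrightarrow> a = b"
  by (simp add: power2_eq_iff)

lemma sq_root_square [simp]: "(sq_root a)\<^sup>2 = a"
proof -
  have "inj (\<lambda>a :: 'a. a\<^sup>2)" by (rule injI) (rule square_eqD)
  then have "surj (\<lambda>a :: 'a. a\<^sup>2)" using finite_field finite_UNIV_inj_surj by blast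
  from surj_f_inv_f[OF this] show ?thesis by (simp add: sq_root_def)
qed

abbreviation "V \<equiv> carrier_vec (Suc (2 * r)) :: 'a vec set"
abbreviation "tr \<equiv> trunc_vec (2 * r) :: 'a vec \<Rightarrow> 'a vec"
abbreviation "B \<equiv> polar_form (odd_form r :: 'a vec \<Rightarrow> 'a)"
abbreviation "\<omega> \<equiv> alternating_form r :: 'a vec \<Rightarrow> 'a vec \<Rightarrow> 'a"

lemma tr_linear:
  assumes "x \<in> V" "y \<in> V"
  shows "tr (x + y) = tr x + tr y" "tr (x - y) = tr x - tr y" "tr (c \<cdot>\<^sub>v x) = c \<cdot>\<^sub>v tr x"
  using assms by (auto intro!: eq_vecI)

text \<open>The radical of \<open>B\<close> is the last coordinate axis, and a vector is determined by its image modulo the radical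
  and its value under the form, since squaring is injective.\<close>

lemma polar_odd_form:
  assumes "x \<in> V" "y \<in> V"
  shows "B x y = \<omega> (tr x) (tr y)"
proof -
  have "odd_form r (x + y) = odd_form r x + odd_form r y + (\<Sum>i<r. x $ i * y $ (r + i) + x $ (r + i) * y $ i)"
    using assms by (simp add: odd_form_def algebra_simps sum.distrib power2_sum)
  also have "(\<Sum>i<r. x $ i * y $ (r + i) + x $ (r + i) * y $ i) = \<omega> (tr x) (tr y)"
    by (auto simp: alternating_form_def intro!: sum.cong)
  finally show ?thesis by (simp add: polar_form_def algebra_simps)
qed

lemma odd_form_determines:
  assumes "x \<in> V" "y \<in> V" "tr x = tr y" "odd_form r x = odd_form r y"
  shows "x = y"
proof (rule eq_vecI)
  have last: "x $ (2 * r) = y $ (2 * r)"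
    using assms(3,4) by (intro square_eqD[of "_ $ _"]) (simp add: odd_form_hyperbolic)
  fix i assume "i < dim_vec y"
  then consider "i < 2 * r" | "i = 2 * r" using assms by force
  then show "x $ i = y $ i"
    using arg_cong[OF assms(3), of "\<lambda>v. v $ i"] last by cases auto
qed (use assms in auto)

text \<open>The isometry over \<open>g\<close>: the last coordinate enters the form as a square, so
  it is shifted by the square root of the change of \<open>hyperbolic_form\<close> under
  \<open>g\<close>.\<close>

definition lift :: "'a mat \<Rightarrow> 'a vec \<Rightarrow> 'a vec" where
  "lift g x = vec (Suc (2 * r)) (\<lambda>i. if i < 2 * r then (g *\<^sub>v tr x) $ i
     else x $ (2 * r) + sq_root (hyperbolic_form r (tr x) + hyperbolic_form r (g *\<^sub>v tr x)))"

lemma lift_carrier [simp]: "lift g x \<in> V"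
  by (simp add: lift_def)

lemma tr_lift: "g \<in> carrier_mat (2 * r) (2 * r) \<Longrightarrow> tr (lift g x) = g *\<^sub>v tr x"
  by (auto simp: lift_def intro!: eq_vecI)

lemma square_add: "((a :: 'a) + b)\<^sup>2 = a\<^sup>2 + b\<^sup>2"
  by (simp add: power2_sum mult_2[symmetric] mult.assoc)

lemma odd_form_lift:
  assumes "g \<in> carrier_mat (2 * r) (2 * r)"
  shows "odd_form r (lift g x) = odd_form r x"
proof -
  have "(lift g x $ (2 * r))\<^sup>2 = (x $ (2 * r))\<^sup>2 + (hyperbolic_form r (tr x) + hyperbolic_form r (g *\<^sub>v tr x))"
    by (simp add: lift_def square_add)
  then show ?thesis
    unfolding odd_form_hyperbolic tr_lift[OF assms] by (simp add: algebra_simps)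
qed

text \<open>Uniqueness of lifts. It reduces multiplicativity, homogeneity and the comparison with
  Siegel maps to an identity modulo the radical and an equality of form values.\<close>

lemma lift_eqI:
  assumes "g \<in> carrier_mat (2 * r) (2 * r)" "y \<in> V" "tr y = g *\<^sub>v tr x" "odd_form r y = odd_form r x"
  shows "lift g x = y"
  by (rule odd_form_determines) (use assms in \<open>simp_all add: lift_carrier tr_lift odd_form_lift\<close>)

lemma siegel_map_eq:
  assumes "x \<in> V" "u \<in> V" "w \<in> V"
  shows "siegel_map (Suc (2 * r)) (odd_form r) u w x
    = x + (B x u \<cdot>\<^sub>v w + (B x w + odd_form r w * B x u) \<cdot>\<^sub>v u)"
  using assms by (intro eq_vecI) (simp_all add: siegel_map_def algebra_simps)

text \<open>With b = B(x, u) and e = B(x, w) + Q(w) b, adding b w + e u changes the form by b^2 Q(w)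
  + b B(x, w) + e b, and these terms cancel in pairs.\<close>

lemma odd_form_siegel_map:
  assumes x: "x \<in> V" and u: "u \<in> V" and w: "w \<in> V" and Q: "odd_form r u = 0" "B u w = 0"
  shows "odd_form r (siegel_map (Suc (2 * r)) (odd_form r) u w x) = odd_form r x"
proof -
  let ?b = "B x u" let ?e = "B x w + odd_form r w * B x u"
  have add: "odd_form r (y + z) = odd_form r y + odd_form r z + B y z" for y z :: "'a vec"
    by (simp add: polar_form_def algebra_simps)
  have "B x (?b \<cdot>\<^sub>v w + ?e \<cdot>\<^sub>v u) = ?b * B x w + ?e * B x u"
    using x u w by (simp add: polar_odd_form tr_linear alternating_form_add alternating_form_smult)
  moreover have "B (?b \<cdot>\<^sub>v w) (?e \<cdot>\<^sub>v u) = 0"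
    using x u w Q(2) by (simp add: polar_odd_form tr_linear alternating_form_smult alternating_form_skew[of r "tr w"])
  ultimately show ?thesis
    unfolding siegel_map_eq[OF x u w] add using u w Q(1)
    by (simp add: odd_form_smult algebra_simps power2_eq_square)
qed

lemma tr_siegel_map:
  assumes x: "x \<in> V" and u: "u \<in> V" and w: "w \<in> V"
  shows "tr (siegel_map (Suc (2 * r)) (odd_form r) u w x)
    = tr x + (\<omega> (tr x) (tr u) \<cdot>\<^sub>v tr w + (\<omega> (tr x) (tr w) + odd_form r w * \<omega> (tr x) (tr u)) \<cdot>\<^sub>v tr u)"
  using x u w unfolding siegel_map_eq[OF x u w] by (simp add: tr_linear polar_odd_form)

text \<open>The map that \<open>siegel_map\<close> induces on the quotient by the last axis, written
  column by column from \<open>tr_siegel_map\<close>.\<close>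

definition siegel_mat :: "'a vec \<Rightarrow> 'a vec \<Rightarrow> 'a mat" where
  "siegel_mat u w = mat (2 * r) (2 * r) (\<lambda>(i, j). (if i = j then 1 else 0)
     + (\<omega> (unit_vec (2 * r) j) (tr u) * w $ i
        + (\<omega> (unit_vec (2 * r) j) (tr w) + odd_form r w * \<omega> (unit_vec (2 * r) j) (tr u)) * u $ i))"

lemma siegel_mat_carrier: "siegel_mat u w \<in> carrier_mat (2 * r) (2 * r)"
  by (simp add: siegel_mat_def)

lemma siegel_mat_mult_vec:
  assumes x: "x \<in> V" and u: "u \<in> V" and w: "w \<in> V"
  shows "siegel_mat u w *\<^sub>v tr x = tr (siegel_map (Suc (2 * r)) (odd_form r) u w x)"
proof (rule eq_vecI)
  fix i assume "i < dim_vec (tr (siegel_map (Suc (2 * r)) (odd_form r) u w x))"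
  then have i: "i < 2 * r" by simp
  let ?\<omega> = "\<lambda>j. \<omega> (unit_vec (2 * r) j)"
  have "(siegel_mat u w *\<^sub>v tr x) $ i
      = (\<Sum>j<2 * r. (if j = i then tr x $ i else 0) + w $ i * (tr x $ j * ?\<omega> j (tr u))
          + u $ i * (tr x $ j * ?\<omega> j (tr w)) + (odd_form r w * u $ i) * (tr x $ j * ?\<omega> j (tr u)))"
    using i by (auto simp: siegel_mat_def scalar_prod_def lessThan_atLeast0 algebra_simps intro!: sum.cong)
  also have "\<dots> = tr x $ i + w $ i * \<omega> (tr x) (tr u) + u $ i * \<omega> (tr x) (tr w) + odd_form r w * u $ i * \<omega> (tr x) (tr u)"
    using i unfolding sum.distrib sum_distrib_left[symmetric] alternating_form_expand[OF trunc_vec_carrier, symmetric] by simp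
  finally show "(siegel_mat u w *\<^sub>v tr x) $ i = tr (siegel_map (Suc (2 * r)) (odd_form r) u w x) $ i"
    unfolding tr_siegel_map[OF x u w] using i by (simp add: algebra_simps)
qed (simp add: siegel_mat_def)

text \<open>A Siegel map is additive and preserves the form, hence also its polarization, which is
  the alternating form of the truncations. \<open>X\<close> and \<open>Y\<close> extend
  \<open>x\<close> and \<open>y\<close> by a zero coordinate.\<close>

lemma siegel_mat_in_Sp:
  assumes u: "u \<in> V" and w: "w \<in> V" and Q: "odd_form r u = 0" "B u w = 0"
  shows "siegel_mat u w \<in> carrier (Sp TYPE('a) r)"
proof (rule SpI[OF siegel_mat_carrier])
  let ?S = "siegel_map (Suc (2 * r)) (odd_form r) u w"
  let ?g = "siegel_mat u w"
  fix x y :: "'a vec" assume x: "x \<in> carrier_vec (2 * r)" and y: "y \<in> carrier_vec (2 * r)"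
  define X Y where "X = vec (Suc (2 * r)) (\<lambda>i. if i < 2 * r then x $ i else 0)"
    and "Y = vec (Suc (2 * r)) (\<lambda>i. if i < 2 * r then y $ i else 0)"
  have XY: "X \<in> V" "Y \<in> V" "tr X = x" "tr Y = y"
    using x y by (auto simp: X_def Y_def intro!: eq_vecI)
  have SV: "?S z \<in> V" if "z \<in> V" for z using that u w by (rule siegel_map_carrier)
  have "?S (X + Y) = ?S X + ?S Y"
  proof -
    have B_add: "B (X + Y) z = B X z + B Y z" if "z \<in> V" for z
      using that XY x y by (simp add: polar_odd_form tr_linear alternating_form_add)
    show ?thesis
      unfolding siegel_map_eq[OF add_carrier_vec[OF XY(1,2)] u w] siegel_map_eq[OF XY(1) u w]
        siegel_map_eq[OF XY(2) u w] B_add[OF u] B_add[OF w]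
      using XY(1,2) u w by (intro eq_vecI) (simp_all add: algebra_simps)
  qed
  then have "B (?S X) (?S Y) = B X Y"
    using XY u w Q by (simp add: polar_form_def[of _ "?S X"] polar_form_def[of _ X] odd_form_siegel_map flip: \<open>?S (X + Y) = _\<close>)
  then show "\<omega> (?g *\<^sub>v x) (?g *\<^sub>v y) = \<omega> x y"
    using XY u w SV siegel_mat_mult_vec[OF XY(1) u w] siegel_mat_mult_vec[OF XY(2) u w] by (simp add: polar_odd_form)
qed

theorem B_model_iso_C_model:
  assumes r: "r \<ge> 1"
  shows "B_model TYPE('a) r \<cong> C_model TYPE('a) r"
proof -
  let ?G = "Sp TYPE('a) r"
  define \<phi> where "\<phi> = (\<lambda>g. \<lambda>x\<in>V. lift g x)"
  have ext: "\<phi> g = f \<longleftrightarrow> (\<forall>x\<in>V. lift g x = f x)" if "f \<in> extensional V" for g f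
    using that by (auto simp: \<phi>_def fun_eq_iff extensional_def)
  have ext_siegel: "siegel_map (Suc (2 * r)) (odd_form r) u w \<in> extensional V" for u w
    by (simp add: siegel_map_def)
  have siegel_V: "siegel_map (Suc (2 * r)) (odd_form r) u w x \<in> V" if "x \<in> V" "u \<in> V" "w \<in> V" for u w x
    using that by (rule siegel_map_carrier)
  have "projective_model (Suc (2 * r)) (odd_form r :: 'a vec \<Rightarrow> 'a) \<cong> ?G Mod group_center ?G"
  proof (rule projective_model_iso[OF group_Sp _ symplectic_transvections_subset Sp_subset_generate_transvections, of \<phi>])
    show "\<phi> \<in> hom ?G (BijGroup V)"
      unfolding \<phi>_def
    proof (rule action_hom_BijGroup[OF group_Sp])
      show "lift g x \<in> V" for g x by simp
    next
      fix g h and x :: "'a vec" assume "g \<in> carrier ?G" "h \<in> carrier ?G" "x \<in> V"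
      then have c: "g \<in> carrier_mat (2 * r) (2 * r)" "h \<in> carrier_mat (2 * r) (2 * r)" by (auto dest: Sp_carrier_mat)
      have "lift (g * h) x = lift g (lift h x)"
        using c by (intro lift_eqI) (simp_all add: lift_carrier tr_lift odd_form_lift assoc_mult_mat_vec[of _ "2 * r" "2 * r" _ "2 * r"])
      then show "lift (g \<otimes>\<^bsub>?G\<^esub> h) x = lift g (lift h x)" by simp
    next
      fix x :: "'a vec" assume "x \<in> V"
      then have "lift (1\<^sub>m (2 * r)) x = x" by (intro lift_eqI) simp_all
      then show "lift \<one>\<^bsub>?G\<^esub> x = x" by simp
    qed
    show "\<phi> ` symplectic_transvections TYPE('a) r \<subseteq> siegel_transformations (Suc (2 * r)) (odd_form r)"
    proof clarify
      fix s assume "s \<in> symplectic_transvections TYPE('a) r"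
      then obtain v a where s: "s = symplectic_transvection r v a" and v: "v \<in> carrier_vec (2 * r)" "v \<noteq> 0\<^sub>v (2 * r)"
        by (auto simp: symplectic_transvections_def)
      \<comment> \<open>\<open>u\<close> is the singular vector above \<open>v\<close>, and
        \<open>w\<close> lies in the radical with form value \<open>a\<close>. Modulo the radical
        only the term Q(w) B(x, u) u of the Siegel map survives, and that is the
        transvection.\<close>
      define u w where "u = vec (Suc (2 * r)) (\<lambda>i. if i < 2 * r then v $ i else sq_root (hyperbolic_form r v))"
        and "w = vec (Suc (2 * r)) (\<lambda>i. if i < 2 * r then 0 else sq_root a)"
      have u: "u \<in> V" "tr u = v" and w: "w \<in> V" "tr w = 0\<^sub>v (2 * r)"
        using v by (auto simp: u_def w_def intro!: eq_vecI)
      have zero: "\<omega> x (0\<^sub>v (2 * r)) = 0" for x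
        by (simp add: alternating_form_def)
      have Qu: "odd_form r u = 0" unfolding odd_form_hyperbolic u(2) by (simp add: u_def)
      have Qw: "odd_form r w = a" unfolding odd_form_hyperbolic w(2) by (simp add: w_def hyperbolic_form_def)
      have uw: "B u w = 0" using u w by (simp add: polar_odd_form zero)
      have "u \<noteq> 0\<^sub>v (Suc (2 * r))"
      proof
        assume "u = 0\<^sub>v (Suc (2 * r))"
        then have "tr u = 0\<^sub>v (2 * r)" by (intro eq_vecI) simp_all
        then show False using u(2) v(2) by simp
      qed
      moreover have "\<phi> s = siegel_map (Suc (2 * r)) (odd_form r) u w"
        unfolding ext[OF ext_siegel]
      proof
        fix x :: "'a vec" assume x: "x \<in> V"
        have "tr (siegel_map (Suc (2 * r)) (odd_form r) u w x) = s *\<^sub>v tr x"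
          unfolding tr_siegel_map[OF x u(1) w(1)] s using v
          by (auto simp: u w zero Qw symplectic_transvection_mult_vec intro!: eq_vecI)
        then show "lift s x = siegel_map (Suc (2 * r)) (odd_form r) u w x"
          using x u(1) w(1) siegel_V odd_form_siegel_map[OF x u(1) w(1) Qu uw]
          by (intro lift_eqI) (simp_all add: s)
      qed
      ultimately show "\<phi> s \<in> siegel_transformations (Suc (2 * r)) (odd_form r)"
        using u(1) w(1) Qu uw unfolding siegel_transformations_def by blast
    qed
    show "siegel_transformations (Suc (2 * r)) (odd_form r) \<subseteq> \<phi> ` carrier ?G"
    proof
      fix f :: "'a vec \<Rightarrow> 'a vec" assume "f \<in> siegel_transformations (Suc (2 * r)) (odd_form r)"
      then obtain u w where uw: "u \<in> V" "w \<in> V" "odd_form r u = 0" "B u w = 0"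
        and f: "f = siegel_map (Suc (2 * r)) (odd_form r) u w"
        unfolding siegel_transformations_def by blast
      have "\<phi> (siegel_mat u w) = f"
        unfolding f ext[OF ext_siegel]
      proof
        fix x :: "'a vec" assume x: "x \<in> V"
        show "lift (siegel_mat u w) x = siegel_map (Suc (2 * r)) (odd_form r) u w x"
          using x uw siegel_V
          by (intro lift_eqI siegel_mat_carrier) (simp_all add: siegel_mat_mult_vec odd_form_siegel_map)
      qed
      then show "f \<in> \<phi> ` carrier ?G" using siegel_mat_in_Sp[OF uw] by blast
    qed
    show "\<phi> g (c \<cdot>\<^sub>v x) = c \<cdot>\<^sub>v \<phi> g x" if "g \<in> carrier ?G" "x \<in> V" for g c x
    proof -
      have g: "g \<in> carrier_mat (2 * r) (2 * r)" using that(1) by (rule Sp_carrier_mat)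
      have "g *\<^sub>v (c \<cdot>\<^sub>v tr x) = c \<cdot>\<^sub>v (g *\<^sub>v tr x)"
        using g by (rule mult_mat_vec) simp
      then have "lift g (c \<cdot>\<^sub>v x) = c \<cdot>\<^sub>v lift g x"
        using that(2) g
        by (intro lift_eqI) (simp_all add: lift_carrier tr_linear(3)[OF _ lift_carrier] tr_linear(3)[of x x]
            tr_linear(3)[OF lift_carrier lift_carrier] tr_lift odd_form_smult odd_form_lift)
      then show ?thesis using that(2) by (simp add: \<phi>_def)
    qed
    show "group_center ?G \<subseteq> carrier ?G" by (auto simp: group_center_def)
    fix g assume g: "g \<in> carrier ?G"
    have gc: "g \<in> carrier_mat (2 * r) (2 * r)" using g by (rule Sp_carrier_mat)
    have "g \<in> group_center ?G \<longleftrightarrow> g = 1\<^sub>m (2 * r)"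
    proof
      assume "g \<in> group_center ?G"
      then obtain c where c: "g = c \<cdot>\<^sub>m 1\<^sub>m (2 * r)" using center_Sp[OF g] by blast
      let ?e = "unit_vec (2 * r) :: nat \<Rightarrow> 'a vec"
      have ce: "g *\<^sub>v ?e i = c \<cdot>\<^sub>v ?e i" if "i < 2 * r" for i
        using that gc by (auto simp: c intro!: eq_vecI)
      have "\<omega> (g *\<^sub>v ?e 0) (g *\<^sub>v ?e (r + 0)) = \<omega> (?e 0) (?e (r + 0))"
        by (rule Sp_alternating_form[OF g]) auto
      moreover have "\<omega> (?e 0) (?e (r + 0)) = 1"
        using r alternating_form_unit(2)[of 0 r "?e 0"] by simp
      \<comment> \<open>A hyperbolic pair shows that a scalar symplectic matrix has c^2 = 1, which
        in characteristic two leaves only the identity.\<close>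
      ultimately have "c * c = 1" using r ce by (simp add: alternating_form_smult)
      then have "c\<^sup>2 = 1\<^sup>2" by (simp add: power2_eq_square)
      then have "c = 1" by (rule square_eqD)
      then show "g = 1\<^sub>m (2 * r)" using c by auto
    next
      assume "g = 1\<^sub>m (2 * r)"
      then show "g \<in> group_center ?G" using center_Sp[OF g] by (auto intro!: exI[of _ 1])
    qed
    also have "\<dots> \<longleftrightarrow> (\<exists>c. \<forall>x\<in>V. lift g x = c \<cdot>\<^sub>v x)"
    proof
      assume "g = 1\<^sub>m (2 * r)"
      then have "\<forall>x\<in>V. lift g x = 1 \<cdot>\<^sub>v x" by (auto intro!: lift_eqI)
      then show "\<exists>c. \<forall>x\<in>V. lift g x = c \<cdot>\<^sub>v x" by blast
    next
      assume "\<exists>c. \<forall>x\<in>V. lift g x = c \<cdot>\<^sub>v x"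
      then obtain c where c: "lift g x = c \<cdot>\<^sub>v x" if "x \<in> V" for x by blast
      let ?z = "unit_vec (Suc (2 * r)) (2 * r) :: 'a vec"
      \<comment> \<open>A lift preserves the form, and the last unit vector has value 1; this forces
        c^2 = 1.\<close>
      have "odd_form r (c \<cdot>\<^sub>v ?z) = odd_form r ?z" using c[of ?z] odd_form_lift[OF gc, of ?z] by simp
      moreover have "odd_form r ?z = 1" by (simp add: odd_form_def)
      ultimately have "c\<^sup>2 = 1\<^sup>2" by (simp add: odd_form_smult)
      then have "c = 1" by (rule square_eqD)
      show "g = 1\<^sub>m (2 * r)"
      proof (rule mat_eqI_vec[OF gc])
        fix x :: "'a vec" assume x: "x \<in> carrier_vec (2 * r)"
        define X where "X = vec (Suc (2 * r)) (\<lambda>i. if i < 2 * r then x $ i else 0)"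
        have X: "X \<in> V" "tr X = x" using x by (auto simp: X_def intro!: eq_vecI)
        show "g *\<^sub>v x = 1\<^sub>m (2 * r) *\<^sub>v x"
          using tr_lift[OF gc, of X] c[OF X(1)] X x \<open>c = 1\<close> by simp
      qed simp
    qed
    also have "\<dots> \<longleftrightarrow> \<phi> g \<in> scalar_maps (Suc (2 * r))"
      unfolding scalar_maps_def by (auto simp: ext)
    finally show "g \<in> group_center ?G \<longleftrightarrow> \<phi> g \<in> scalar_maps (Suc (2 * r))" .
  qed
  then show ?thesis by (simp add: B_model_def C_model_def)
qed

end

section \<open>The Klein quadric\<close>

lemma less_4_cases: "(i :: nat) < 4 \<longleftrightarrow> i = 0 \<or> i = 1 \<or> i = 2 \<or> i = 3"
  by auto

lemma sum_4: "(\<Sum>i\<in>{0..<4}. f i) = f 0 + f 1 + f 2 + f (3 :: nat)"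
  by (simp add: numeral_eq_Suc add.assoc)

lemma vec_eq_6:
  assumes "x \<in> carrier_vec 6" "y \<in> carrier_vec 6"
  shows "x = y \<longleftrightarrow> x $ 0 = y $ 0 \<and> x $ 1 = y $ 1 \<and> x $ 2 = y $ 2 \<and> x $ 3 = y $ 3 \<and> x $ 4 = y $ 4 \<and> x $ 5 = y $ 5"
proof -
  have "i < 6 \<longleftrightarrow> i = 0 \<or> i = 1 \<or> i = 2 \<or> i = 3 \<or> i = 4 \<or> i = 5" for i :: nat by auto
  moreover have "x = y \<longleftrightarrow> (\<forall>i<6. x $ i = y $ i)" using assms by (auto simp: vec_eq_iff)
  ultimately show ?thesis by metis
qed

lemma index_mult_4:
  assumes "A \<in> carrier_mat 4 4" "B \<in> carrier_mat 4 4" "i < 4" "j < 4"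
  shows "(A * B) $$ (i, j) = A $$ (i, 0) * B $$ (0, j) + A $$ (i, 1) * B $$ (1, j) + A $$ (i, 2) * B $$ (2, j) + A $$ (i, 3) * B $$ (3, j)"
  using assms by (simp add: scalar_prod_def sum_4)

text \<open>The Pluecker coordinates \<open>p\<^sub>0\<^sub>1, p\<^sub>0\<^sub>3, p\<^sub>0\<^sub>2, p\<^sub>2\<^sub>3, p\<^sub>1\<^sub>2, - p\<^sub>1\<^sub>3\<close> of an alternating matrix, in which the Pfaffian is
  the hyperbolic form; \<open>skew6'\<close> is the negative of the Hodge dual.\<close>

definition skew6 :: "'a :: field vec \<Rightarrow> 'a mat" where
  "skew6 x = mat 4 4 (\<lambda>(i, j).
     [[0, x $ 0, x $ 2, x $ 1], [- x $ 0, 0, x $ 4, - x $ 5], [- x $ 2, - x $ 4, 0, x $ 3], [- x $ 1, x $ 5, - x $ 3, 0]] ! i ! j)"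

definition skew6' :: "'a :: field vec \<Rightarrow> 'a mat" where
  "skew6' x = mat 4 4 (\<lambda>(i, j).
     [[0, - x $ 3, - x $ 5, - x $ 4], [x $ 3, 0, - x $ 1, x $ 2], [x $ 5, x $ 1, 0, - x $ 0], [x $ 4, - x $ 2, x $ 0, 0]] ! i ! j)"

lemma skew6_carrier [simp]: "skew6 x \<in> carrier_mat 4 4" "skew6' x \<in> carrier_mat 4 4"
  by (simp_all add: skew6_def skew6'_def)

lemma dim_skew6 [simp]: "dim_row (skew6 x) = 4" "dim_col (skew6 x) = 4" "dim_row (skew6' x) = 4" "dim_col (skew6' x) = 4"
  by (simp_all add: skew6_def skew6'_def)

lemma index_skew6 [simp]:
  "i < 4 \<Longrightarrow> j < 4 \<Longrightarrow> skew6 x $$ (i, j) =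
     [[0, x $ 0, x $ 2, x $ 1], [- x $ 0, 0, x $ 4, - x $ 5], [- x $ 2, - x $ 4, 0, x $ 3], [- x $ 1, x $ 5, - x $ 3, 0]] ! i ! j"
  "i < 4 \<Longrightarrow> j < 4 \<Longrightarrow> skew6' x $$ (i, j) =
     [[0, - x $ 3, - x $ 5, - x $ 4], [x $ 3, 0, - x $ 1, x $ 2], [x $ 5, x $ 1, 0, - x $ 0], [x $ 4, - x $ 2, x $ 0, 0]] ! i ! j"
  by (simp_all add: skew6_def skew6'_def)

lemma transpose_skew6: "(skew6 x)\<^sup>T = - skew6 x" "(skew6' x)\<^sup>T = - skew6' x"
  by (intro eq_matI; auto simp: less_4_cases)+

lemma hyperbolic_form_3: "hyperbolic_form 3 x = x $ 0 * x $ 3 + x $ 1 * x $ 4 + x $ 2 * x $ 5"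
  by (simp add: hyperbolic_form_def numeral_eq_Suc)

lemma polar_hyperbolic_form_3:
  assumes "u \<in> carrier_vec 6" "w \<in> carrier_vec 6"
  shows "polar_form (hyperbolic_form 3) u w = u $ 0 * w $ 3 + w $ 0 * u $ 3 + u $ 1 * w $ 4 + w $ 1 * u $ 4 + u $ 2 * w $ 5 + w $ 2 * u $ 5"
  using assms unfolding polar_form_def hyperbolic_form_3 by (simp add: algebra_simps)

text \<open>The classical identity that an alternating matrix of size four times its dual is minus
  the Pfaffian times the identity; \<open>skew6'\<close> absorbs the sign.\<close>

lemma skew6_mult:
  "skew6 x * skew6' x = hyperbolic_form 3 x \<cdot>\<^sub>m 1\<^sub>m 4" "skew6' x * skew6 x = hyperbolic_form 3 x \<cdot>\<^sub>m 1\<^sub>m 4"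
  unfolding hyperbolic_form_3
  by (intro eq_matI; auto simp: less_4_cases index_mult_4 simp del: index_mult_mat(1); simp add: algebra_simps)+

lemma clifford_pair_skew6: "clifford_pair 6 4 (hyperbolic_form 3) (skew6 :: 'a :: field vec \<Rightarrow> 'a mat) skew6'"
proof
  fix x y :: "'a vec" and c :: 'a
  assume x: "x \<in> carrier_vec 6"
  show "skew6 x \<in> carrier_mat 4 4" "skew6' x \<in> carrier_mat 4 4" by simp_all
  show "skew6 (c \<cdot>\<^sub>v x) = c \<cdot>\<^sub>m skew6 x"
    using x by (intro eq_matI) (auto simp: less_4_cases)
  show "skew6 x * skew6' x = hyperbolic_form 3 x \<cdot>\<^sub>m 1\<^sub>m 4" "skew6' x * skew6 x = hyperbolic_form 3 x \<cdot>\<^sub>m 1\<^sub>m 4"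
    by (rule skew6_mult)+
  assume y: "y \<in> carrier_vec 6"
  show "skew6 (x + y) = skew6 x + skew6 y" "skew6' (x + y) = skew6' x + skew6' y"
    using x y by (intro eq_matI; auto simp: less_4_cases)+
  assume e: "skew6 x = skew6 y"
  show "x = y"
    using arg_cong[OF e, of "\<lambda>A. A $$ (0, 1)"] arg_cong[OF e, of "\<lambda>A. A $$ (0, 2)"] arg_cong[OF e, of "\<lambda>A. A $$ (0, 3)"]
      arg_cong[OF e, of "\<lambda>A. A $$ (1, 2)"] arg_cong[OF e, of "\<lambda>A. A $$ (1, 3)"] arg_cong[OF e, of "\<lambda>A. A $$ (2, 3)"]
    unfolding vec_eq_6[OF x y] by simp
qed

section \<open>Congruence on alternating matrices\<close>

lemma index_mult_skew6:
  assumes A: "A \<in> carrier_mat 4 4" and i: "i < 4"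
  shows "(A * skew6 x) $$ (i, 0) = - (A $$ (i, 1) * x $ 0) - A $$ (i, 2) * x $ 2 - A $$ (i, 3) * x $ 1"
    "(A * skew6 x) $$ (i, 1) = A $$ (i, 0) * x $ 0 - A $$ (i, 2) * x $ 4 + A $$ (i, 3) * x $ 5"
    "(A * skew6 x) $$ (i, 2) = A $$ (i, 0) * x $ 2 + A $$ (i, 1) * x $ 4 - A $$ (i, 3) * x $ 3"
    "(A * skew6 x) $$ (i, 3) = A $$ (i, 0) * x $ 1 - A $$ (i, 1) * x $ 5 + A $$ (i, 2) * x $ 3"
  using A i by (simp_all add: index_mult_4[of A "skew6 x"] del: index_mult_mat(1))

definition minor2 :: "'a :: field mat \<Rightarrow> nat \<Rightarrow> nat \<Rightarrow> nat \<Rightarrow> nat \<Rightarrow> 'a" where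
  "minor2 A i j k l = A $$ (i, k) * A $$ (j, l) - A $$ (i, l) * A $$ (j, k)"

text \<open>Congruence by \<open>A\<close> acts on the Pluecker coordinates through the minors of
  size two, that is, through the exterior square of \<open>A\<close>.\<close>

lemma index_skew6_congruence:
  assumes A: "A \<in> carrier_mat 4 4" and ij: "i < 4" "j < 4"
  shows "(A * skew6 x * A\<^sup>T) $$ (i, j) = x $ 0 * minor2 A i j 0 1 + x $ 1 * minor2 A i j 0 3 + x $ 2 * minor2 A i j 0 2
    + x $ 3 * minor2 A i j 2 3 + x $ 4 * minor2 A i j 1 2 - x $ 5 * minor2 A i j 1 3"
proof -
  have col: "A\<^sup>T $$ (0, j) = A $$ (j, 0)" "A\<^sup>T $$ (1, j) = A $$ (j, 1)" "A\<^sup>T $$ (2, j) = A $$ (j, 2)" "A\<^sup>T $$ (3, j) = A $$ (j, 3)"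
    using A ij by simp_all
  have "A\<^sup>T \<in> carrier_mat 4 4"
    using A by simp
  then show ?thesis
    unfolding index_mult_4[OF mult_carrier_mat[OF A skew6_carrier(1)] \<open>A\<^sup>T \<in> _\<close> ij] index_mult_skew6[OF A ij(1)] col minor2_def by (simp add: algebra_simps)
qed

text \<open>The diagonal vanishes because a minor with two equal rows does. In characteristic two
  this does not follow from skew symmetry, so it is read off from the minors.\<close>

lemma skew6_congruence:
  fixes A :: "'a :: field mat" and x :: "'a vec"
  assumes A: "A \<in> carrier_mat 4 4"
  defines "P \<equiv> A * skew6 x * A\<^sup>T"
  shows "skew6 (vec 6 ((!) [P $$ (0, 1), P $$ (0, 3), P $$ (0, 2), P $$ (2, 3), P $$ (1, 2), - P $$ (1, 3)])) = P"
proof (rule eq_matI)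
  have skew: "P $$ (i, i) = 0" "P $$ (j, i) = - P $$ (i, j)" if "i < 4" "j < 4" for i j
    using that A unfolding P_def by (simp_all add: index_skew6_congruence minor2_def algebra_simps del: index_mult_mat(1))
  fix i j assume "i < dim_row P" "j < dim_col P"
  then have ij: "i < 4" "j < 4" using A by (simp_all add: P_def)
  then show "skew6 (vec 6 ((!) [P $$ (0, 1), P $$ (0, 3), P $$ (0, 2), P $$ (2, 3), P $$ (1, 2), - P $$ (1, 3)])) $$ (i, j) = P $$ (i, j)"
    using skew(1)[of 0 0] skew(1)[of 1 0] skew(1)[of 2 0] skew(1)[of 3 0] skew(2)[of 0 1] skew(2)[of 0 2] skew(2)[of 0 3]
      skew(2)[of 1 2] skew(2)[of 1 3] skew(2)[of 2 3]
    unfolding less_4_cases by (elim disjE) simp_all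
qed (use A in \<open>simp_all add: P_def\<close>)

text \<open>In the Clifford algebra u y u = - y u u = 0. It is used to show that u w squares to
  zero.\<close>

lemma (in clifford_pair) M_M'_M:
  assumes u: "u \<in> carrier_vec N" "Q u = 0" and y: "y \<in> carrier_vec N" "polar_form Q u y = 0"
  shows "M u * (M' y * M u) = 0\<^sub>m n n"
proof -
  have c: "M u \<in> carrier_mat n n" "M' u \<in> carrier_mat n n" "M y \<in> carrier_mat n n" "M' y \<in> carrier_mat n n"
    using u y M_carrier M'_carrier by auto
  have UY: "M u * M' y = - (M y * M' u)"
    using polar_swap(1)[OF u(1) y(1)] c by (auto simp: y(2) intro!: eq_matI)
  have UU: "M' u * M u = 0\<^sub>m n n"
    using M'_M[OF u(1)] by (auto simp: u(2) intro!: eq_matI)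
  have "M u * (M' y * M u) = M u * M' y * M u"
    by (rule assoc_mult_mat[OF c(1,4,1), symmetric])
  also have "\<dots> = - (M y * (M' u * M u))"
    unfolding UY assoc_mult_mat[OF c(3,2,1), symmetric] using c by simp
  also have "\<dots> = 0\<^sub>m n n" unfolding UU using c by auto
  finally show ?thesis .
qed

text \<open>Over the polynomial ring 1 - t N has the inverse 1 + t N, so its determinant is a unit
  and hence constant in t. Evaluation at t = 0 gives 1 and evaluation at t = 1 gives the
  claim.\<close>

lemma det_one_minus_nilpotent:
  fixes N :: "'a :: field mat"
  assumes N: "N \<in> carrier_mat n n" "N * N = 0\<^sub>m n n"
  shows "det (1\<^sub>m n - N) = 1"
proof -
  define C where "C = map_mat (\<lambda>a. [:a:]) N"
  define T where "T = [:0, 1 :: 'a:] \<cdot>\<^sub>m C"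
  have C: "C \<in> carrier_mat n n" using N by (simp add: C_def)
  have "C * C = 0\<^sub>m n n"
  proof (rule eq_matI)
    fix i j assume "i < dim_row (0\<^sub>m n n)" "j < dim_col (0\<^sub>m n n)"
    then have ij: "i < n" "j < n" by simp_all
    have "(\<Sum>k\<in>{0..<n}. N $$ (i, k) * N $$ (k, j)) = 0"
      using arg_cong[OF N(2), of "\<lambda>A. A $$ (i, j)"] N(1) ij by (simp add: scalar_prod_def)
    moreover have "(C * C) $$ (i, j) = [:\<Sum>k\<in>{0..<n}. N $$ (i, k) * N $$ (k, j):]"
      using N(1) ij by (intro poly_eqI) (simp add: C_def scalar_prod_def coeff_sum coeff_pCons mult.commute split: nat.split)
    ultimately show "(C * C) $$ (i, j) = 0\<^sub>m n n $$ (i, j)" using ij by simp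
  qed (use C in auto)
  then have T: "T \<in> carrier_mat n n" "T * T = 0\<^sub>m n n"
    using C by (simp_all add: T_def mult_smult_distrib[of _ n n _ n] mult_smult_assoc_mat[of _ n n _ n])
  have T1: "1\<^sub>m n - T \<in> carrier_mat n n" "1\<^sub>m n + T \<in> carrier_mat n n"
    using T(1) by (simp_all add: minus_carrier_mat)
  have "(1\<^sub>m n - T) * (1\<^sub>m n + T) = (1\<^sub>m n + T) - T * (1\<^sub>m n + T)"
    using T(1) T1 by (subst minus_mult_distrib_mat[of _ n n _ _ n]) simp_all
  also have "T * (1\<^sub>m n + T) = T"
    using T by (subst mult_add_distrib_mat[of _ n n _ n]) simp_all
  also have "1\<^sub>m n + T - T = 1\<^sub>m n"
    using T(1) by (intro eq_matI) simp_all
  finally have "det (1\<^sub>m n - T) * det (1\<^sub>m n + T) = 1"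
    using det_mult[OF T1] by simp
  then have "is_unit (det (1\<^sub>m n - T))" by (metis dvd_triv_left)
  then obtain d where d: "det (1\<^sub>m n - T) = [:d:]" by (auto simp: is_unit_poly_iff)
  have eval: "det (1\<^sub>m n - t \<cdot>\<^sub>m N) = d" for t
  proof -
    interpret comm_ring_hom "\<lambda>p. poly p t" by unfold_locales auto
    have "det (map_mat (\<lambda>p. poly p t) (1\<^sub>m n - T)) = d" unfolding hom_det d by simp
    moreover have "map_mat (\<lambda>p. poly p t) (1\<^sub>m n - T) = 1\<^sub>m n - t \<cdot>\<^sub>m N"
      using N(1) by (intro eq_matI) (auto simp: T_def C_def)
    ultimately show ?thesis by simp
  qed
  have "1\<^sub>m n - 0 \<cdot>\<^sub>m N = 1\<^sub>m n" "1\<^sub>m n - 1 \<cdot>\<^sub>m N = 1\<^sub>m n - N" using N(1) by (auto intro!: eq_matI)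
  then show ?thesis using eval[of 0] eval[of 1] by simp
qed

text \<open>Both factors are skew symmetric, so the two signs cancel. Hence transposition can play
  the part of \<open>\<beta>\<close>.\<close>

lemma transpose_one_minus_skew6:
  "(1\<^sub>m 4 - skew6 u * skew6' w)\<^sup>T = 1\<^sub>m 4 - skew6' w * skew6 (u :: 'a :: field vec)"
proof -
  have "skew6 u * skew6' w \<in> carrier_mat 4 4"
    by (rule mult_carrier_mat[OF skew6_carrier])
  then have "(1\<^sub>m 4 - skew6 u * skew6' w)\<^sup>T = 1\<^sub>m 4 - (skew6 u * skew6' w)\<^sup>T"
    by (simp add: transpose_minus[of _ 4 4])
  also have "(skew6 u * skew6' w)\<^sup>T = skew6' w * skew6 u"
    unfolding transpose_mult[OF skew6_carrier] transpose_skew6 by simp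
  finally show ?thesis .
qed

lemma index_skew6_mult:
  assumes K: "K \<in> carrier_mat 4 4" and j: "j < 4"
  shows "(skew6 x * K) $$ (0, j) = x $ 0 * K $$ (1, j) + x $ 2 * K $$ (2, j) + x $ 1 * K $$ (3, j)"
    "(skew6 x * K) $$ (1, j) = - (x $ 0 * K $$ (0, j)) + x $ 4 * K $$ (2, j) - x $ 5 * K $$ (3, j)"
    "(skew6 x * K) $$ (2, j) = - (x $ 2 * K $$ (0, j)) - x $ 4 * K $$ (1, j) + x $ 3 * K $$ (3, j)"
    "(skew6 x * K) $$ (3, j) = - (x $ 1 * K $$ (0, j)) + x $ 5 * K $$ (1, j) - x $ 3 * K $$ (2, j)"
  using K j by (simp_all add: index_mult_4[of "skew6 x" K] del: index_mult_mat(1))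

text \<open>Multiplying by the inverse of \<open>A\<^sup>T\<close> makes the hypothesis linear in the entries of \<open>A\<close>.\<close>

lemma scalar_mat_of_skew6_congruence:
  assumes A: "A \<in> carrier_mat 4 4" "det A \<noteq> 0"
    and eq: "\<And>x. x \<in> carrier_vec 6 \<Longrightarrow> x $ 2 = x $ 5 \<Longrightarrow> A * skew6 x * A\<^sup>T = c \<cdot>\<^sub>m skew6 x"
  shows "\<exists>d. A = d \<cdot>\<^sub>m 1\<^sub>m 4"
proof -
  have "A\<^sup>T \<in> carrier_mat 4 4" "det A\<^sup>T \<noteq> 0" using A by (simp_all add: det_transpose)
  then obtain K where K: "K \<in> carrier_mat 4 4" "A\<^sup>T * K = 1\<^sub>m 4"
    using det_non_zero_imp_unit[of "A\<^sup>T" 4 "()"] by (auto simp: Units_def ring_mat_simps)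
  have e: "(A * skew6 x) $$ (i, j) = c * (skew6 x * K) $$ (i, j)"
    if "x \<in> carrier_vec 6" "x $ 2 = x $ 5" "i < 4" "j < 4" for x i j
  proof -
    have AX: "A * skew6 x \<in> carrier_mat 4 4" by (rule mult_carrier_mat[OF A(1) skew6_carrier(1)])
    have "A * skew6 x * (A\<^sup>T * K) = A * skew6 x * A\<^sup>T * K"
      using AX A(1) K(1) by (intro assoc_mult_mat[symmetric]) auto
    also have "\<dots> = c \<cdot>\<^sub>m (skew6 x * K)"
      unfolding eq[OF that(1,2)] by (rule mult_smult_assoc_mat[OF skew6_carrier(1) K(1)])
    finally have "A * skew6 x = c \<cdot>\<^sub>m (skew6 x * K)" using K AX by simp
    then show ?thesis using that K(1) by (simp del: index_mult_mat(1))
  qed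
  \<comment> \<open>The test vectors stay in the hyperplane \<open>x $ 2 = x $ 5\<close>, the image
    of \<open>embed5\<close> below, so that the lemma serves the forms in six and in five
    variables.\<close>
  define X where "X p q r s t = (vec 6 ((!) [p, q, r, s, t, r]) :: 'a vec)" for p q r s t
  have X: "X p q r s t \<in> carrier_vec 6" "X p q r s t $ 2 = X p q r s t $ 5" "X p q r s t $ 0 = p" "X p q r s t $ 1 = q"
    "X p q r s t $ 2 = r" "X p q r s t $ 3 = s" "X p q r s t $ 4 = t" "X p q r s t $ 5 = r" for p q r s t
    by (simp_all add: X_def)
  have E: "(A * skew6 (X p q r s t)) $$ (i, j) = c * (skew6 (X p q r s t) * K) $$ (i, j)" if "i < 4" "j < 4" for p q r s t i j
    using e[OF X(1,2)] that by blast
  note row = index_mult_skew6[OF A(1)] and col = index_skew6_mult[OF K(1)]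
  have 0: "A $$ (2, 1) = 0" "A $$ (2, 0) = 0" "A $$ (3, 1) = 0" "A $$ (3, 0) = 0"
    and 1: "A $$ (1, 1) = c * K $$ (0, 0)"
    using E[of 2 0 1 0 0 0 0] E[of 2 1 1 0 0 0 0] E[of 3 0 1 0 0 0 0] E[of 3 1 1 0 0 0 0] E[of 1 0 1 0 0 0 0]
    by (simp_all add: row col X del: index_mult_mat(1) One_nat_def)
  have 2: "A $$ (0, 3) = 0" "A $$ (0, 2) = 0" "A $$ (1, 3) = 0" "A $$ (1, 2) = 0" "A $$ (2, 2) = c * K $$ (3, 3)"
    using E[of 0 2 0 0 0 1 0] E[of 0 3 0 0 0 1 0] E[of 1 2 0 0 0 1 0] E[of 1 3 0 0 0 1 0] E[of 2 3 0 0 0 1 0]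
    by (simp_all add: row col X del: index_mult_mat(1) One_nat_def)
  have 3: "A $$ (1, 0) = 0" "A $$ (2, 3) = 0" "A $$ (0, 0) = c * K $$ (3, 3)" "A $$ (3, 3) = c * K $$ (0, 0)"
    using E[of 1 3 0 1 0 0 0] E[of 2 0 0 1 0 0 0] E[of 0 3 0 1 0 0 0] E[of 3 0 0 1 0 0 0]
    by (simp_all add: row col X del: index_mult_mat(1) One_nat_def)
  have 4: "A $$ (0, 1) = 0" "A $$ (3, 2) = 0"
    using E[of 0 2 0 0 0 0 1] E[of 3 1 0 0 0 0 1]
    by (simp_all add: row col X del: index_mult_mat(1) One_nat_def)
  \<comment> \<open>So far the diagonal entries agree within {0, 2} and within {1, 3}; this vector
    joins the two classes.\<close>
  have 5: "A $$ (1, 1) = c * K $$ (3, 3)"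
    using E[of 1 3 0 0 1 0 0] 3(1) 2(4) by (simp add: row col X 3(1) 2(4) del: index_mult_mat(1) One_nat_def)
  have diag: "A $$ (3, 3) = c * K $$ (3, 3)" using 1 3(4) 5 by simp
  have "A = (c * K $$ (3, 3)) \<cdot>\<^sub>m 1\<^sub>m 4"
  proof (rule eq_matI)
    fix i j assume "i < dim_row ((c * K $$ (3, 3)) \<cdot>\<^sub>m 1\<^sub>m 4)" "j < dim_col ((c * K $$ (3, 3)) \<cdot>\<^sub>m 1\<^sub>m 4)"
    then have ij: "i < 4" "j < 4" by simp_all
    then show "A $$ (i, j) = ((c * K $$ (3, 3)) \<cdot>\<^sub>m 1\<^sub>m 4) $$ (i, j)"
      using 0 2 3(1-3) 4 5 diag unfolding less_4_cases by (elim disjE) (simp_all del: One_nat_def)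
  qed (use A in auto)
  then show ?thesis by blast
qed

lemma scalar_mat_skew6_congruence:
  "(d \<cdot>\<^sub>m 1\<^sub>m 4) * skew6 x * (d \<cdot>\<^sub>m 1\<^sub>m 4)\<^sup>T = (d * d) \<cdot>\<^sub>m skew6 x"
proof -
  have "(d \<cdot>\<^sub>m 1\<^sub>m 4)\<^sup>T = d \<cdot>\<^sub>m 1\<^sub>m 4" by (intro eq_matI) auto
  moreover have "(d \<cdot>\<^sub>m 1\<^sub>m 4) * skew6 x = d \<cdot>\<^sub>m skew6 x"
    using mult_smult_assoc_mat[OF one_carrier_mat skew6_carrier(1), of d x] left_mult_one_mat[OF skew6_carrier(1)] by simp
  moreover have "(d \<cdot>\<^sub>m skew6 x) * (d \<cdot>\<^sub>m 1\<^sub>m 4) = (d * d) \<cdot>\<^sub>m skew6 x"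
    by (subst mult_smult_assoc_mat[of _ 4 4 _ 4], simp, simp, subst mult_smult_distrib[of _ 4 4 _ 4])
       (auto intro!: eq_matI simp: less_4_cases)
  ultimately show ?thesis by simp
qed

text \<open>With \<open>{k, l, p, q} = {0, 1, 2, 3}\<close>, the elementary matrix \<open>1 + a E\<^sub>k\<^sub>l\<close> comes from \<open>e\<^sub>k \<and> e\<^sub>p\<close> and a multiple of \<open>e\<^sub>k \<and> e\<^sub>q\<close>.\<close>

lemma elementary_mats_4:
  assumes "A \<in> elementary_mats TYPE('a :: field) 4"
  obtains u w where "u \<in> carrier_vec 6" "w \<in> carrier_vec 6" "u \<noteq> 0\<^sub>v 6" "hyperbolic_form 3 u = 0"
    "polar_form (hyperbolic_form 3) u w = 0" "A = 1\<^sub>m 4 - skew6 u * skew6' w"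
proof -
  obtain a k l where A: "A = addrow_mat 4 a k l" and kl: "k < 4" "l < 4" "k \<noteq> l"
    using assms by (auto simp: elementary_mats_def)
  from kl consider "k = 0" "l = 1"
    | "k = 0" "l = 2"
    | "k = 0" "l = 3"
    | "k = 1" "l = 0"
    | "k = 1" "l = 2"
    | "k = 1" "l = 3"
    | "k = 2" "l = 0"
    | "k = 2" "l = 1"
    | "k = 2" "l = 3"
    | "k = 3" "l = 0"
    | "k = 3" "l = 1"
    | "k = 3" "l = 2"
    unfolding less_4_cases by (elim disjE) simp_all
  then show thesis
  proof cases
    case 1
    have "A = 1\<^sub>m 4 - skew6 (vec 6 ((!) [0, 1, 0, 0, 0, 0])) * skew6' (vec 6 ((!) [0, 0, a, 0, 0, 0]))"
      unfolding A 1 by (intro eq_matI) (auto simp: less_4_cases index_mult_4 simp del: index_mult_mat(1))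
    then show thesis
      by (intro that[of "vec 6 ((!) [0, 1, 0, 0, 0, 0])" "vec 6 ((!) [0, 0, a, 0, 0, 0])"]) (simp_all add: vec_eq_6 hyperbolic_form_3 polar_hyperbolic_form_3)
  next
    case 2
    have "A = 1\<^sub>m 4 - skew6 (vec 6 ((!) [1, 0, 0, 0, 0, 0])) * skew6' (vec 6 ((!) [0, a, 0, 0, 0, 0]))"
      unfolding A 2 by (intro eq_matI) (auto simp: less_4_cases index_mult_4 simp del: index_mult_mat(1))
    then show thesis
      by (intro that[of "vec 6 ((!) [1, 0, 0, 0, 0, 0])" "vec 6 ((!) [0, a, 0, 0, 0, 0])"]) (simp_all add: vec_eq_6 hyperbolic_form_3 polar_hyperbolic_form_3)
  next
    case 3
    have "A = 1\<^sub>m 4 - skew6 (vec 6 ((!) [1, 0, 0, 0, 0, 0])) * skew6' (vec 6 ((!) [0, 0, - a, 0, 0, 0]))"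
      unfolding A 3 by (intro eq_matI) (auto simp: less_4_cases index_mult_4 simp del: index_mult_mat(1))
    then show thesis
      by (intro that[of "vec 6 ((!) [1, 0, 0, 0, 0, 0])" "vec 6 ((!) [0, 0, - a, 0, 0, 0])"]) (simp_all add: vec_eq_6 hyperbolic_form_3 polar_hyperbolic_form_3)
  next
    case 4
    have "A = 1\<^sub>m 4 - skew6 (vec 6 ((!) [0, 0, 0, 0, 1, 0])) * skew6' (vec 6 ((!) [0, 0, 0, 0, 0, - a]))"
      unfolding A 4 by (intro eq_matI) (auto simp: less_4_cases index_mult_4 simp del: index_mult_mat(1))
    then show thesis
      by (intro that[of "vec 6 ((!) [0, 0, 0, 0, 1, 0])" "vec 6 ((!) [0, 0, 0, 0, 0, - a])"]) (simp_all add: vec_eq_6 hyperbolic_form_3 polar_hyperbolic_form_3)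
  next
    case 5
    have "A = 1\<^sub>m 4 - skew6 (vec 6 ((!) [1, 0, 0, 0, 0, 0])) * skew6' (vec 6 ((!) [0, 0, 0, 0, 0, - a]))"
      unfolding A 5 by (intro eq_matI) (auto simp: less_4_cases index_mult_4 simp del: index_mult_mat(1))
    then show thesis
      by (intro that[of "vec 6 ((!) [1, 0, 0, 0, 0, 0])" "vec 6 ((!) [0, 0, 0, 0, 0, - a])"]) (simp_all add: vec_eq_6 hyperbolic_form_3 polar_hyperbolic_form_3)
  next
    case 6
    have "A = 1\<^sub>m 4 - skew6 (vec 6 ((!) [1, 0, 0, 0, 0, 0])) * skew6' (vec 6 ((!) [0, 0, 0, 0, - a, 0]))"
      unfolding A 6 by (intro eq_matI) (auto simp: less_4_cases index_mult_4 simp del: index_mult_mat(1))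
    then show thesis
      by (intro that[of "vec 6 ((!) [1, 0, 0, 0, 0, 0])" "vec 6 ((!) [0, 0, 0, 0, - a, 0])"]) (simp_all add: vec_eq_6 hyperbolic_form_3 polar_hyperbolic_form_3)
  next
    case 7
    have "A = 1\<^sub>m 4 - skew6 (vec 6 ((!) [0, 0, 0, 1, 0, 0])) * skew6' (vec 6 ((!) [0, 0, 0, 0, - a, 0]))"
      unfolding A 7 by (intro eq_matI) (auto simp: less_4_cases index_mult_4 simp del: index_mult_mat(1))
    then show thesis
      by (intro that[of "vec 6 ((!) [0, 0, 0, 1, 0, 0])" "vec 6 ((!) [0, 0, 0, 0, - a, 0])"]) (simp_all add: vec_eq_6 hyperbolic_form_3 polar_hyperbolic_form_3)
  next
    case 8
    have "A = 1\<^sub>m 4 - skew6 (vec 6 ((!) [0, 0, 1, 0, 0, 0])) * skew6' (vec 6 ((!) [0, 0, 0, - a, 0, 0]))"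
      unfolding A 8 by (intro eq_matI) (auto simp: less_4_cases index_mult_4 simp del: index_mult_mat(1))
    then show thesis
      by (intro that[of "vec 6 ((!) [0, 0, 1, 0, 0, 0])" "vec 6 ((!) [0, 0, 0, - a, 0, 0])"]) (simp_all add: vec_eq_6 hyperbolic_form_3 polar_hyperbolic_form_3)
  next
    case 9
    have "A = 1\<^sub>m 4 - skew6 (vec 6 ((!) [0, 0, 1, 0, 0, 0])) * skew6' (vec 6 ((!) [0, 0, 0, 0, - a, 0]))"
      unfolding A 9 by (intro eq_matI) (auto simp: less_4_cases index_mult_4 simp del: index_mult_mat(1))
    then show thesis
      by (intro that[of "vec 6 ((!) [0, 0, 1, 0, 0, 0])" "vec 6 ((!) [0, 0, 0, 0, - a, 0])"]) (simp_all add: vec_eq_6 hyperbolic_form_3 polar_hyperbolic_form_3)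
  next
    case 10
    have "A = 1\<^sub>m 4 - skew6 (vec 6 ((!) [0, 0, 0, 1, 0, 0])) * skew6' (vec 6 ((!) [0, 0, 0, 0, 0, a]))"
      unfolding A 10 by (intro eq_matI) (auto simp: less_4_cases index_mult_4 simp del: index_mult_mat(1))
    then show thesis
      by (intro that[of "vec 6 ((!) [0, 0, 0, 1, 0, 0])" "vec 6 ((!) [0, 0, 0, 0, 0, a])"]) (simp_all add: vec_eq_6 hyperbolic_form_3 polar_hyperbolic_form_3)
  next
    case 11
    have "A = 1\<^sub>m 4 - skew6 (vec 6 ((!) [0, 1, 0, 0, 0, 0])) * skew6' (vec 6 ((!) [0, 0, 0, - a, 0, 0]))"
      unfolding A 11 by (intro eq_matI) (auto simp: less_4_cases index_mult_4 simp del: index_mult_mat(1))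
    then show thesis
      by (intro that[of "vec 6 ((!) [0, 1, 0, 0, 0, 0])" "vec 6 ((!) [0, 0, 0, - a, 0, 0])"]) (simp_all add: vec_eq_6 hyperbolic_form_3 polar_hyperbolic_form_3)
  next
    case 12
    have "A = 1\<^sub>m 4 - skew6 (vec 6 ((!) [0, 1, 0, 0, 0, 0])) * skew6' (vec 6 ((!) [0, 0, 0, 0, 0, - a]))"
      unfolding A 12 by (intro eq_matI) (auto simp: less_4_cases index_mult_4 simp del: index_mult_mat(1))
    then show thesis
      by (intro that[of "vec 6 ((!) [0, 1, 0, 0, 0, 0])" "vec 6 ((!) [0, 0, 0, 0, 0, - a])"]) (simp_all add: vec_eq_6 hyperbolic_form_3 polar_hyperbolic_form_3)
  qed
qed

text \<open>Determinant one matrices act by congruence. For a Siegel pair u w is square-zero, which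
  puts 1 - u w into the special linear group.\<close>

lemma D_model_3_iso: "D_model TYPE('a :: field) 3 \<cong> PSL TYPE('a) 4"
proof -
  interpret clifford_pair 6 4 "hyperbolic_form 3 :: 'a vec \<Rightarrow> 'a" skew6 skew6'
    by (rule clifford_pair_skew6)
  let ?G = "SL TYPE('a) 4"
  have "projective_model 6 (hyperbolic_form 3 :: 'a vec \<Rightarrow> 'a) \<cong> ?G Mod group_center ?G"
  proof (rule projective_model_iso_action[where \<alpha> = "\<lambda>A. A" and \<beta> = transpose_mat, OF group_SL _ _ _ _ _ _
        elementary_mats_SL SL_subset_generate_elementary])
    fix A assume "A \<in> carrier ?G"
    then show "A \<in> carrier_mat 4 4 \<and> A\<^sup>T \<in> carrier_mat 4 4" by (simp add: carrier_SL)
  next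
    fix A B assume "A \<in> carrier ?G" "B \<in> carrier ?G"
    then show "A \<otimes>\<^bsub>?G\<^esub> B = A * B \<and> (A \<otimes>\<^bsub>?G\<^esub> B)\<^sup>T = B\<^sup>T * A\<^sup>T"
      by (auto simp: carrier_SL intro!: transpose_mult)
  next
    fix A and x :: "'a vec" assume "A \<in> carrier ?G"
    then have "A \<in> carrier_mat 4 4" by (simp add: carrier_SL)
    from skew6_congruence[OF this, of x] show "\<exists>y\<in>carrier_vec 6. skew6 y = A * skew6 x * A\<^sup>T"
      by (meson vec_carrier)
  next
    fix u w :: "'a vec"
    assume u: "u \<in> carrier_vec 6" "hyperbolic_form 3 u = 0" and w: "w \<in> carrier_vec 6" "polar_form (hyperbolic_form 3) u w = 0"
    let ?N = "skew6 u * skew6' w"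
    have N: "?N \<in> carrier_mat 4 4" by (rule mult_carrier_mat[OF skew6_carrier])
    have "?N * ?N = skew6 u * (skew6' w * skew6 u) * skew6' w"
      by (simp add: assoc_mult_mat[of _ 4 4 _ 4 _ 4] mult_carrier_mat[of _ 4 4 _ 4])
    also have "\<dots> = 0\<^sub>m 4 4" unfolding M_M'_M[OF u w] by simp
    finally have "det (1\<^sub>m 4 - ?N) = 1" using N by (intro det_one_minus_nilpotent)
    then have "1\<^sub>m 4 - ?N \<in> carrier ?G" using N by (simp add: carrier_SL minus_carrier_mat)
    then show "\<exists>A\<in>carrier ?G. A = 1\<^sub>m 4 - skew6 u * skew6' w \<and> A\<^sup>T = 1\<^sub>m 4 - skew6' w * skew6 u"
      using transpose_one_minus_skew6 by blast
  next
    fix A assume "A \<in> elementary_mats TYPE('a) 4"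
    then show "\<exists>u w. u \<in> carrier_vec 6 \<and> w \<in> carrier_vec 6 \<and> u \<noteq> 0\<^sub>v 6 \<and> hyperbolic_form 3 u = 0 \<and>
      polar_form (hyperbolic_form 3) u w = 0 \<and> A = 1\<^sub>m 4 - skew6 u * skew6' w \<and> A\<^sup>T = 1\<^sub>m 4 - skew6' w * skew6 u"
      by (rule elementary_mats_4) (metis transpose_one_minus_skew6)
  next
    fix A assume A: "A \<in> carrier ?G"
    then have Ac: "A \<in> carrier_mat 4 4" "det A \<noteq> 0" by (simp_all add: carrier_SL)
    show "A \<in> group_center ?G \<longleftrightarrow> (\<exists>c. \<forall>x\<in>carrier_vec 6. A * skew6 x * A\<^sup>T = c \<cdot>\<^sub>m skew6 x)"
      unfolding center_SL[OF _ A, simplified]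
      using scalar_mat_of_skew6_congruence[OF Ac] scalar_mat_skew6_congruence by metis
  qed (auto simp: group_center_subset)
  then show ?thesis by (simp add: D_model_def PSL_def)
qed

section \<open>The hyperplane of the Klein quadric fixed by the symplectic group of rank two\<close>

lemma vec_eq_5:
  assumes "x \<in> carrier_vec 5" "y \<in> carrier_vec 5"
  shows "x = y \<longleftrightarrow> x $ 0 = y $ 0 \<and> x $ 1 = y $ 1 \<and> x $ 2 = y $ 2 \<and> x $ 3 = y $ 3 \<and> x $ 4 = y $ 4"
proof -
  have "i < 5 \<longleftrightarrow> i = 0 \<or> i = 1 \<or> i = 2 \<or> i = 3 \<or> i = 4" for i :: nat by auto
  moreover have "x = y \<longleftrightarrow> (\<forall>i<5. x $ i = y $ i)" using assms by (auto simp: vec_eq_iff)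
  ultimately show ?thesis by metis
qed

text \<open>The alternating matrices orthogonal to the matrix of the symplectic form are those with \<open>p\<^sub>0\<^sub>2 + p\<^sub>1\<^sub>3 = 0\<close>.\<close>

definition embed5 :: "'a :: field vec \<Rightarrow> 'a vec" where
  "embed5 x = vec 6 ((!) [x $ 0, x $ 1, x $ 4, x $ 2, x $ 3, x $ 4])"

lemma embed5_carrier [simp]: "embed5 x \<in> carrier_vec 6"
  by (simp add: embed5_def)

lemma embed5_linear:
  assumes "x \<in> carrier_vec 5" "y \<in> carrier_vec 5"
  shows "embed5 (x + y) = embed5 x + embed5 y" "embed5 (c \<cdot>\<^sub>v x) = c \<cdot>\<^sub>v embed5 x"
  using assms by (subst vec_eq_6; simp add: embed5_def)+

lemma odd_form_2: "odd_form 2 x = x $ 0 * x $ 2 + x $ 1 * x $ 3 + (x $ 4)\<^sup>2"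
  by (simp add: odd_form_def numeral_eq_Suc)

lemma polar_odd_form_2:
  assumes "u \<in> carrier_vec 5" "w \<in> carrier_vec 5"
  shows "polar_form (odd_form 2) u w = u $ 0 * w $ 2 + w $ 0 * u $ 2 + u $ 1 * w $ 3 + w $ 1 * u $ 3 + 2 * u $ 4 * w $ 4"
  using assms unfolding polar_form_def odd_form_2 by (simp add: power2_eq_square algebra_simps)

text \<open>The hyperbolic partners in positions 2 and 5 both carry the last coordinate, which
  produces its square.\<close>

lemma hyperbolic_form_embed5: "hyperbolic_form 3 (embed5 x) = odd_form 2 x"
  unfolding hyperbolic_form_3 odd_form_2 by (simp add: embed5_def power2_eq_square)

lemma polar_form_embed5:
  assumes "u \<in> carrier_vec 5" "w \<in> carrier_vec 5"
  shows "polar_form (hyperbolic_form 3) (embed5 u) (embed5 w) = polar_form (odd_form 2) u w"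
  using assms unfolding polar_form_def by (simp add: embed5_linear(1)[symmetric] hyperbolic_form_embed5)

lemma clifford_pair_embed5:
  "clifford_pair 5 4 (odd_form 2) (\<lambda>x. skew6 (embed5 x) :: 'a :: field mat) (\<lambda>x. skew6' (embed5 x))"
proof -
  interpret six: clifford_pair 6 4 "hyperbolic_form 3 :: 'a vec \<Rightarrow> 'a" skew6 skew6'
    by (rule clifford_pair_skew6)
  show ?thesis
  proof
    fix x y :: "'a vec" and c :: 'a
    assume x: "x \<in> carrier_vec 5"
    show "skew6 (embed5 x) \<in> carrier_mat 4 4" "skew6' (embed5 x) \<in> carrier_mat 4 4" by simp_all
    show "skew6 (embed5 (c \<cdot>\<^sub>v x)) = c \<cdot>\<^sub>m skew6 (embed5 x)"
      using x by (simp add: embed5_linear(2)[of x x] six.M_smult)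
    show "skew6 (embed5 x) * skew6' (embed5 x) = odd_form 2 x \<cdot>\<^sub>m 1\<^sub>m 4"
      "skew6' (embed5 x) * skew6 (embed5 x) = odd_form 2 x \<cdot>\<^sub>m 1\<^sub>m 4"
      by (simp_all add: skew6_mult hyperbolic_form_embed5)
    assume y: "y \<in> carrier_vec 5"
    show "skew6 (embed5 (x + y)) = skew6 (embed5 x) + skew6 (embed5 y)"
      "skew6' (embed5 (x + y)) = skew6' (embed5 x) + skew6' (embed5 y)"
      using x y by (simp_all add: embed5_linear six.M_add six.M'_add)
    assume "skew6 (embed5 x) = skew6 (embed5 y)"
    then have "embed5 x = embed5 y" by (intro six.M_inj) simp_all
    then show "x = y"
      unfolding vec_eq_5[OF x y] vec_eq_6[OF embed5_carrier embed5_carrier] by (simp add: embed5_def)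
  qed
qed

text \<open>Applied to a vector \<open>j\<close> for which \<open>M j\<close> is the matrix of the symplectic form, this says that \<open>1 - u w\<close> is symplectic.\<close>

lemma (in clifford_pair) dual_action_fixes:
  assumes u: "u \<in> carrier_vec N" "Q u = 0" and w: "w \<in> carrier_vec N" "polar_form Q u w = 0"
    and j: "j \<in> carrier_vec N" "polar_form Q u j = 0" "polar_form Q w j = 0" "M' j = M j"
  shows "(1\<^sub>m n - M' w * M u) * (M j * (1\<^sub>m n - M u * M' w)) = M j"
proof -
  note car = M_carrier[OF u(1)] M'_carrier[OF u(1)] M_carrier[OF w(1)] M'_carrier[OF w(1)] M_carrier[OF j(1)]
  define U U' W W' J where d: "U = M u" "U' = M' u" "W = M w" "W' = M' w" "J = M j"
  note c = car[folded d]
  have UJ: "U * J = - (J * U')" and W'J: "W' * J = - (J * W)" and WU': "W * U' = - (U * W')"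
    using polar_swap(1)[OF u(1) j(1)] polar_swap(2)[OF w(1) j(1)] polar_swap(1)[OF u(1) w(1)] c
    by (auto simp: j(2-4) w(2) d intro!: eq_matI simp del: index_mult_mat(1))
  have N: "U * W' \<in> carrier_mat n n" "W' * U \<in> carrier_mat n n" "W * U' \<in> carrier_mat n n" "J * U' \<in> carrier_mat n n"
    using c by (auto intro: mult_carrier_mat)
  \<comment> \<open>\<open>J\<close> passes to the left with two sign changes, which cancel;
    exchanging \<open>W\<close> and \<open>U\<close> supplies one more.\<close>
  have "W' * U * J = W' * (U * J)" using c by (intro assoc_mult_mat) auto
  also have "\<dots> = - (W' * J * U')" unfolding UJ using c N by (simp add: assoc_mult_mat[of _ n n _ n _ n])
  also have "\<dots> = J * W * U'" unfolding W'J using c by simp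
  also have "\<dots> = J * (W * U')" using c by (intro assoc_mult_mat) auto
  also have "\<dots> = - (J * (U * W'))" unfolding WU' using c N by simp
  finally have "(1\<^sub>m n - W' * U) * J = J + J * (U * W')"
    using c N by (subst minus_mult_distrib_mat[of _ n n _ _ n]) (auto intro!: eq_matI simp del: index_mult_mat(1))
  also have "\<dots> = J * (1\<^sub>m n + U * W')"
    using c N by (subst mult_add_distrib_mat[of _ n n _ n]) auto
  finally have e: "(1\<^sub>m n - W' * U) * J = J * (1\<^sub>m n + U * W')" .
  \<comment> \<open>Because of this the factors 1 + u w and 1 - u w are inverse to each
    other.\<close>
  have UW: "U * W' * (U * W') = 0\<^sub>m n n"
  proof -
    have "U * W' * (U * W') = U * (W' * U) * W'"
      using c N by (simp add: assoc_mult_mat[of _ n n _ n _ n])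
    also have "U * (W' * U) = 0\<^sub>m n n" unfolding d by (rule M_M'_M[OF u w])
    finally show ?thesis using c by simp
  qed
  have N1: "1\<^sub>m n + U * W' \<in> carrier_mat n n" "1\<^sub>m n - U * W' \<in> carrier_mat n n" "1\<^sub>m n - W' * U \<in> carrier_mat n n"
    using N by (auto intro: minus_carrier_mat)
  have "(1\<^sub>m n + U * W') * (1\<^sub>m n - U * W') = (1\<^sub>m n + U * W') - (1\<^sub>m n + U * W') * (U * W')"
    using N N1 right_mult_one_mat[OF N1(1)] by (subst mult_minus_distrib_mat[of _ n n _ n]) simp_all
  also have "(1\<^sub>m n + U * W') * (U * W') = U * W'"
    using N UW left_mult_one_mat[OF N(1)] right_add_zero_mat[OF N(1)] by (subst add_mult_distrib_mat[of _ n n _ _ n]) simp_all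
  also have "1\<^sub>m n + U * W' - U * W' = 1\<^sub>m n"
    using N c by (intro eq_matI) (simp_all del: index_mult_mat(1))
  finally have one: "(1\<^sub>m n + U * W') * (1\<^sub>m n - U * W') = 1\<^sub>m n" .
  have "(1\<^sub>m n - W' * U) * (J * (1\<^sub>m n - U * W')) = (1\<^sub>m n - W' * U) * J * (1\<^sub>m n - U * W')"
    using c(5) N1 by (intro assoc_mult_mat[symmetric])
  also have "\<dots> = J * ((1\<^sub>m n + U * W') * (1\<^sub>m n - U * W'))"
    unfolding e using c(5) N1 by (intro assoc_mult_mat)
  finally show ?thesis unfolding one using c(5) by (simp add: d)
qed

lemma alternating_form_2:
  "alternating_form 2 x y = x $ 0 * y $ 2 - x $ 2 * y $ 0 + (x $ 1 * y $ 3 - x $ 3 * y $ 1)"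
  by (simp add: alternating_form_def numeral_eq_Suc)

text \<open>The vector whose matrix is the Gram matrix of \<open>alternating_form 2\<close>. It is
  orthogonal to the image of \<open>embed5\<close>, and \<open>skew6\<close> and
  \<open>skew6'\<close> agree on it, as \<open>dual_action_fixes\<close> requires.\<close>

definition symp4 :: "'a :: field vec" where
  "symp4 = vec 6 ((!) [0, 0, 1, 0, 0, - 1])"

lemma alternating_form_2_skew6:
  assumes "x \<in> carrier_vec 4" "y \<in> carrier_vec 4"
  shows "alternating_form 2 x y = x \<bullet> (skew6 symp4 *\<^sub>v y)"
proof -
  have "(skew6 symp4 *\<^sub>v y) $ 0 = y $ 2" "(skew6 symp4 *\<^sub>v y) $ 1 = y $ 3"
    "(skew6 symp4 *\<^sub>v y) $ 2 = - y $ 0" "(skew6 symp4 *\<^sub>v y) $ 3 = - y $ 1"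
    using assms by (simp_all add: scalar_prod_def sum_4 symp4_def)
  then show ?thesis
    unfolding alternating_form_2 using assms by (simp add: scalar_prod_def sum_4 del: index_mult_mat_vec One_nat_def)
qed

lemma skew6'_symp4: "skew6' symp4 = skew6 symp4"
  by (intro eq_matI) (auto simp: less_4_cases symp4_def)

lemma polar_form_symp4: "polar_form (hyperbolic_form 3) (embed5 x) symp4 = 0"
  by (subst polar_hyperbolic_form_3) (simp_all add: symp4_def embed5_def)

lemma Sp4_I:
  fixes A :: "'a :: field mat"
  assumes A: "A \<in> carrier_mat 4 4" and J: "A\<^sup>T * (skew6 symp4 * A) = skew6 symp4"
  shows "A \<in> carrier (Sp TYPE('a) 2)"
proof (rule SpI)
  show "A \<in> carrier_mat (2 * 2) (2 * 2)" using A by simp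
  fix x y :: "'a vec" assume "x \<in> carrier_vec (2 * 2)" "y \<in> carrier_vec (2 * 2)"
  then have x: "x \<in> carrier_vec 4" and y: "y \<in> carrier_vec 4" by simp_all
  have JA: "skew6 symp4 * A \<in> carrier_mat 4 4" by (rule mult_carrier_mat[OF skew6_carrier(1) A])
  have Ay: "A *\<^sub>v y \<in> carrier_vec 4" using A y by simp
  have "alternating_form 2 (A *\<^sub>v x) (A *\<^sub>v y) = (A *\<^sub>v x) \<bullet> (skew6 symp4 *\<^sub>v (A *\<^sub>v y))"
    using A x Ay by (intro alternating_form_2_skew6) simp_all
  also have "\<dots> = (skew6 symp4 *\<^sub>v (A *\<^sub>v y)) \<bullet> (A *\<^sub>v x)"
    using A x y Ay by (intro comm_scalar_prod[of _ 4] mult_mat_vec_carrier[of _ 4 4]) simp_all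
  also have "\<dots> = (A\<^sup>T *\<^sub>v (skew6 symp4 *\<^sub>v (A *\<^sub>v y))) \<bullet> x"
    using A x y Ay by (intro transpose_vec_mult_scalar[symmetric, of _ 4 4] mult_mat_vec_carrier[of _ 4 4]) simp_all
  also have "A\<^sup>T *\<^sub>v (skew6 symp4 *\<^sub>v (A *\<^sub>v y)) = skew6 symp4 *\<^sub>v y"
    using A y JA J assoc_mult_mat_vec[OF skew6_carrier(1) A y] assoc_mult_mat_vec[of "A\<^sup>T" 4 4 "skew6 symp4 * A" 4 y]
    by simp
  also have "(skew6 symp4 *\<^sub>v y) \<bullet> x = x \<bullet> (skew6 symp4 *\<^sub>v y)"
    using x y by (intro comm_scalar_prod[of _ 4] mult_mat_vec_carrier[of _ 4 4]) simp_all
  also have "\<dots> = alternating_form 2 x y" using x y by (simp add: alternating_form_2_skew6)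
  finally show "alternating_form 2 (A *\<^sub>v x) (A *\<^sub>v y) = alternating_form 2 x y" .
qed

text \<open>Written out by entries, so that each witness of a transvection is checked by sixteen
  polynomial identities.\<close>

lemma symplectic_transvection_4_eqI:
  fixes A :: "'a :: field mat"
  assumes A: "A \<in> carrier_mat 4 4"
    and entries: "A $$ (0, 0) = 1 + a * v $ 2 * v $ 0" "A $$ (0, 1) = a * v $ 3 * v $ 0"
      "A $$ (0, 2) = - a * v $ 0 * v $ 0" "A $$ (0, 3) = - a * v $ 1 * v $ 0"
      "A $$ (1, 0) = a * v $ 2 * v $ 1" "A $$ (1, 1) = 1 + a * v $ 3 * v $ 1"
      "A $$ (1, 2) = - a * v $ 0 * v $ 1" "A $$ (1, 3) = - a * v $ 1 * v $ 1"
      "A $$ (2, 0) = a * v $ 2 * v $ 2" "A $$ (2, 1) = a * v $ 3 * v $ 2"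
      "A $$ (2, 2) = 1 - a * v $ 0 * v $ 2" "A $$ (2, 3) = - a * v $ 1 * v $ 2"
      "A $$ (3, 0) = a * v $ 2 * v $ 3" "A $$ (3, 1) = a * v $ 3 * v $ 3"
      "A $$ (3, 2) = - a * v $ 0 * v $ 3" "A $$ (3, 3) = 1 - a * v $ 1 * v $ 3"
  shows "symplectic_transvection 2 v a = A"
proof (rule eq_matI)
  fix i j assume "i < dim_row A" "j < dim_col A"
  then have "i < 4" "j < 4" using A by simp_all
  then show "symplectic_transvection 2 v a $$ (i, j) = A $$ (i, j)"
    unfolding less_4_cases symplectic_transvection_def
    by (elim disjE; simp only: ; simp add: alternating_form_2 entries[simplified])
qed (use A in \<open>simp_all add: symplectic_transvection_def\<close>)

text \<open>A transvection along \<open>v\<close> comes from multiples of \<open>v \<and> x\<close> and \<open>v \<and> y\<close>, where \<open>v, x, y\<close> span the orthogonal space of \<open>v\<close>;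
  the choice of \<open>x, y\<close> depends on a nonzero coordinate of \<open>v\<close>.\<close>

lemma symplectic_transvections_4:
  assumes "s \<in> symplectic_transvections TYPE('a :: field) 2"
  obtains u w where "u \<in> carrier_vec 5" "w \<in> carrier_vec 5" "u \<noteq> 0\<^sub>v 5" "odd_form 2 u = 0"
    "polar_form (odd_form 2) u w = 0" "s = 1\<^sub>m 4 - skew6 (embed5 u) * skew6' (embed5 w)"
proof -
  obtain v a where s: "s = symplectic_transvection 2 v a" and v: "v \<in> carrier_vec 4" "v \<noteq> 0\<^sub>v 4"
    using assms by (auto simp: symplectic_transvections_def)
  have car: "1\<^sub>m 4 - skew6 x * skew6' y \<in> carrier_mat 4 4" for x y :: "'a vec"
    by (rule minus_carrier_mat, rule mult_carrier_mat[OF skew6_carrier])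
  from v consider "v $ 0 \<noteq> 0" | "v $ 1 \<noteq> 0" | "v $ 2 \<noteq> 0" | "v $ 3 \<noteq> 0"
    unfolding vec_eq_4[OF v(1) zero_carrier_vec] by auto
  then show thesis
  proof cases
    case 1
    \<comment> \<open>Here x = (0, v0, v3, 0) and y = (0, 0, -v1, v0) are orthogonal to v = (v0, v1,
      v2, v3); \<open>u\<close> is v wedge x and \<open>w\<close> is -b times v wedge y. The product
      carries the factor v0^2, hence the division. The other cases follow the same pattern with
      their own nonzero coordinate.\<close>
    define b where "b = a / (v $ 0)\<^sup>2"
    have a: "a = b * (v $ 0)\<^sup>2" using 1 by (simp add: b_def)
    have "s = 1\<^sub>m 4 - skew6 (embed5 (vec 5 ((!) [v $ 0 * v $ 0, 0, - (v $ 3 * v $ 3), v $ 1 * v $ 3 - v $ 0 * v $ 2, v $ 0 * v $ 3]))) * skew6' (embed5 (vec 5 ((!) [0, - b * (v $ 0 * v $ 0), - b * (v $ 0 * v $ 2 + v $ 1 * v $ 3), - b * (- (v $ 1 * v $ 1)), - b * (- (v $ 0 * v $ 1))])))"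
      unfolding s a by (rule symplectic_transvection_4_eqI[OF car]) (simp_all add: index_mult_4 embed5_def power2_eq_square algebra_simps del: index_mult_mat(1))
    then show thesis
      using 1 by (intro that[of "vec 5 ((!) [v $ 0 * v $ 0, 0, - (v $ 3 * v $ 3), v $ 1 * v $ 3 - v $ 0 * v $ 2, v $ 0 * v $ 3])" "vec 5 ((!) [0, - b * (v $ 0 * v $ 0), - b * (v $ 0 * v $ 2 + v $ 1 * v $ 3), - b * (- (v $ 1 * v $ 1)), - b * (- (v $ 0 * v $ 1))])"]) (simp_all add: vec_eq_5 odd_form_2 polar_odd_form_2 power2_eq_square algebra_simps)
  next
    case 2
    define b where "b = a / (v $ 1)\<^sup>2"
    have a: "a = b * (v $ 1)\<^sup>2" using 2 by (simp add: b_def)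
    have "s = 1\<^sub>m 4 - skew6 (embed5 (vec 5 ((!) [- (v $ 1 * v $ 1), v $ 0 * v $ 2 - v $ 1 * v $ 3, v $ 2 * v $ 2, 0, - (v $ 1 * v $ 2)]))) * skew6' (embed5 (vec 5 ((!) [0, - b * (- (v $ 0 * v $ 0)), - b * (- (v $ 0 * v $ 2) - v $ 1 * v $ 3), - b * (v $ 1 * v $ 1), - b * (v $ 0 * v $ 1)])))"
      unfolding s a by (rule symplectic_transvection_4_eqI[OF car]) (simp_all add: index_mult_4 embed5_def power2_eq_square algebra_simps del: index_mult_mat(1))
    then show thesis
      using 2 by (intro that[of "vec 5 ((!) [- (v $ 1 * v $ 1), v $ 0 * v $ 2 - v $ 1 * v $ 3, v $ 2 * v $ 2, 0, - (v $ 1 * v $ 2)])" "vec 5 ((!) [0, - b * (- (v $ 0 * v $ 0)), - b * (- (v $ 0 * v $ 2) - v $ 1 * v $ 3), - b * (v $ 1 * v $ 1), - b * (v $ 0 * v $ 1)])"]) (simp_all add: vec_eq_5 odd_form_2 polar_odd_form_2 power2_eq_square algebra_simps)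
  next
    case 3
    define b where "b = a / (v $ 2)\<^sup>2"
    have a: "a = b * (v $ 2)\<^sup>2" using 3 by (simp add: b_def)
    have "s = 1\<^sub>m 4 - skew6 (embed5 (vec 5 ((!) [v $ 0 * v $ 2 + v $ 1 * v $ 3, v $ 3 * v $ 3, 0, - (v $ 2 * v $ 2), v $ 2 * v $ 3]))) * skew6' (embed5 (vec 5 ((!) [- b * (- (v $ 1 * v $ 1)), - b * (v $ 0 * v $ 2 - v $ 1 * v $ 3), - b * (v $ 2 * v $ 2), 0, - b * (- (v $ 1 * v $ 2))])))"
      unfolding s a by (rule symplectic_transvection_4_eqI[OF car]) (simp_all add: index_mult_4 embed5_def power2_eq_square algebra_simps del: index_mult_mat(1))
    then show thesis
      using 3 by (intro that[of "vec 5 ((!) [v $ 0 * v $ 2 + v $ 1 * v $ 3, v $ 3 * v $ 3, 0, - (v $ 2 * v $ 2), v $ 2 * v $ 3])" "vec 5 ((!) [- b * (- (v $ 1 * v $ 1)), - b * (v $ 0 * v $ 2 - v $ 1 * v $ 3), - b * (v $ 2 * v $ 2), 0, - b * (- (v $ 1 * v $ 2))])"]) (simp_all add: vec_eq_5 odd_form_2 polar_odd_form_2 power2_eq_square algebra_simps)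
  next
    case 4
    define b where "b = a / (v $ 3)\<^sup>2"
    have a: "a = b * (v $ 3)\<^sup>2" using 4 by (simp add: b_def)
    have "s = 1\<^sub>m 4 - skew6 (embed5 (vec 5 ((!) [- (v $ 0 * v $ 2) - v $ 1 * v $ 3, - (v $ 3 * v $ 3), 0, v $ 2 * v $ 2, - (v $ 2 * v $ 3)]))) * skew6' (embed5 (vec 5 ((!) [- b * (v $ 0 * v $ 0), 0, - b * (- (v $ 3 * v $ 3)), - b * (v $ 1 * v $ 3 - v $ 0 * v $ 2), - b * (v $ 0 * v $ 3)])))"
      unfolding s a by (rule symplectic_transvection_4_eqI[OF car]) (simp_all add: index_mult_4 embed5_def power2_eq_square algebra_simps del: index_mult_mat(1))
    then show thesis
      using 4 by (intro that[of "vec 5 ((!) [- (v $ 0 * v $ 2) - v $ 1 * v $ 3, - (v $ 3 * v $ 3), 0, v $ 2 * v $ 2, - (v $ 2 * v $ 3)])" "vec 5 ((!) [- b * (v $ 0 * v $ 0), 0, - b * (- (v $ 3 * v $ 3)), - b * (v $ 1 * v $ 3 - v $ 0 * v $ 2), - b * (v $ 0 * v $ 3)])"]) (simp_all add: vec_eq_5 odd_form_2 polar_odd_form_2 power2_eq_square algebra_simps)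
  qed
qed

text \<open>The congruence action of \<open>D_model_3_iso\<close>, restricted to the hyperplane
  orthogonal to \<open>symp4\<close>, which symplectic matrices preserve.\<close>

lemma B_model_2_iso: "B_model TYPE('a :: field) 2 \<cong> C_model TYPE('a) 2"
proof -
  interpret six: clifford_pair 6 4 "hyperbolic_form 3 :: 'a vec \<Rightarrow> 'a" skew6 skew6'
    by (rule clifford_pair_skew6)
  interpret clifford_pair 5 4 "odd_form 2 :: 'a vec \<Rightarrow> 'a" "\<lambda>x. skew6 (embed5 x)" "\<lambda>x. skew6' (embed5 x)"
    by (rule clifford_pair_embed5)
  let ?G = "Sp TYPE('a) 2"
  have Ac: "A \<in> carrier_mat 4 4" if "A \<in> carrier ?G" for A using Sp_carrier_mat[OF that] by simp
  have "projective_model 5 (odd_form 2 :: 'a vec \<Rightarrow> 'a) \<cong> ?G Mod group_center ?G"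
  proof (rule projective_model_iso_action[where \<alpha> = "\<lambda>A. A" and \<beta> = transpose_mat, OF group_Sp _ _ _ _ _ _
        symplectic_transvections_subset Sp_subset_generate_transvections])
    fix A assume "A \<in> carrier ?G"
    then show "A \<in> carrier_mat 4 4 \<and> A\<^sup>T \<in> carrier_mat 4 4" using Ac by simp
  next
    fix A B assume "A \<in> carrier ?G" "B \<in> carrier ?G"
    then show "A \<otimes>\<^bsub>?G\<^esub> B = A * B \<and> (A \<otimes>\<^bsub>?G\<^esub> B)\<^sup>T = B\<^sup>T * A\<^sup>T"
      using transpose_mult[OF Ac Ac] by simp
  next
    fix A and x :: "'a vec" assume A: "A \<in> carrier ?G"
    define P where "P = A * skew6 (embed5 x) * A\<^sup>T"
    \<comment> \<open>The left side is the alternating form of columns \<open>k\<close> and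
      \<open>l\<close> of \<open>A\<close>, collected by the row pairs (0, 2) and (1, 3).\<close>
    have minors: "minor2 A 0 2 k l + minor2 A 1 3 k l = alternating_form 2 (unit_vec 4 k) (unit_vec 4 l)" if "k < 4" "l < 4" for k l
    proof -
      have "alternating_form 2 (A *\<^sub>v unit_vec 4 k) (A *\<^sub>v unit_vec 4 l) = alternating_form 2 (unit_vec 4 k) (unit_vec 4 l)"
        using Sp_alternating_form[OF A, of "unit_vec 4 k" "unit_vec 4 l"] by simp
      then show ?thesis
        using that Ac[OF A] by (simp add: mult_mat_unit_vec[of _ 4 4] alternating_form_2[of "col A k"] minor2_def algebra_simps)
    qed
    have "P $$ (0, 2) + P $$ (1, 3) = x $ 0 * (minor2 A 0 2 0 1 + minor2 A 1 3 0 1) + x $ 1 * (minor2 A 0 2 0 3 + minor2 A 1 3 0 3)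
        + x $ 4 * (minor2 A 0 2 0 2 + minor2 A 1 3 0 2) + x $ 2 * (minor2 A 0 2 2 3 + minor2 A 1 3 2 3)
        + x $ 3 * (minor2 A 0 2 1 2 + minor2 A 1 3 1 2) - x $ 4 * (minor2 A 0 2 1 3 + minor2 A 1 3 1 3)"
      using Ac[OF A] unfolding P_def
      by (simp add: index_skew6_congruence embed5_def algebra_simps del: index_mult_mat(1))
    \<comment> \<open>Only the column pairs (0, 2) and (1, 3) contribute, both with coefficient 1;
      their terms are x4 and -x4.\<close>
    also have "\<dots> = 0" by (simp add: minors[unfolded One_nat_def] alternating_form_2)
    finally have "P $$ (0, 2) = - P $$ (1, 3)" by (simp add: eq_neg_iff_add_eq_0)
    then have "embed5 (vec 5 ((!) [P $$ (0, 1), P $$ (0, 3), P $$ (2, 3), P $$ (1, 2), P $$ (0, 2)]))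
      = vec 6 ((!) [P $$ (0, 1), P $$ (0, 3), P $$ (0, 2), P $$ (2, 3), P $$ (1, 2), - P $$ (1, 3)])"
      by (subst vec_eq_6) (simp_all add: embed5_def)
    then have "skew6 (embed5 (vec 5 ((!) [P $$ (0, 1), P $$ (0, 3), P $$ (2, 3), P $$ (1, 2), P $$ (0, 2)]))) = P"
      using skew6_congruence[OF Ac[OF A], of "embed5 x"] by (simp add: P_def)
    then show "\<exists>y\<in>carrier_vec 5. skew6 (embed5 y) = A * skew6 (embed5 x) * A\<^sup>T"
      unfolding P_def by (meson vec_carrier)
  next
    fix u w :: "'a vec"
    assume u: "u \<in> carrier_vec 5" "odd_form 2 u = 0" and w: "w \<in> carrier_vec 5" "polar_form (odd_form 2) u w = 0"
    let ?A = "1\<^sub>m 4 - skew6 (embed5 u) * skew6' (embed5 w)"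
    have A: "?A \<in> carrier_mat 4 4"
      by (rule minus_carrier_mat, rule mult_carrier_mat[OF skew6_carrier])
    have "symp4 \<in> carrier_vec 6" by (simp add: symp4_def)
    then have "?A\<^sup>T * (skew6 symp4 * ?A) = skew6 symp4"
      unfolding transpose_one_minus_skew6 using u w
      by (intro six.dual_action_fixes) (simp_all add: hyperbolic_form_embed5 polar_form_embed5 polar_form_symp4 skew6'_symp4)
    then have "?A \<in> carrier ?G" by (rule Sp4_I[OF A])
    then show "\<exists>A\<in>carrier ?G. A = ?A \<and> A\<^sup>T = 1\<^sub>m 4 - skew6' (embed5 w) * skew6 (embed5 u)"
      using transpose_one_minus_skew6 by blast
  next
    fix A assume "A \<in> symplectic_transvections TYPE('a) 2"
    then show "\<exists>u w. u \<in> carrier_vec 5 \<and> w \<in> carrier_vec 5 \<and> u \<noteq> 0\<^sub>v 5 \<and> odd_form 2 u = 0 \<and>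
      polar_form (odd_form 2) u w = 0 \<and> A = 1\<^sub>m 4 - skew6 (embed5 u) * skew6' (embed5 w) \<and>
      A\<^sup>T = 1\<^sub>m 4 - skew6' (embed5 w) * skew6 (embed5 u)"
      by (rule symplectic_transvections_4) (metis transpose_one_minus_skew6)
  next
    fix A assume A: "A \<in> carrier ?G"
    have "A \<in> Units (ring_mat TYPE('a) 4 ())" using A by (simp add: Sp_def GL_def units_of_def)
    then have det: "det A \<noteq> 0" by (rule unit_imp_det_non_zero)
    have "\<exists>d. A = d \<cdot>\<^sub>m 1\<^sub>m 4" if c: "\<forall>x\<in>carrier_vec 5. A * skew6 (embed5 x) * A\<^sup>T = c \<cdot>\<^sub>m skew6 (embed5 x)" for c
    proof (rule scalar_mat_of_skew6_congruence[OF Ac[OF A] det])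
      fix x :: "'a vec" assume x: "x \<in> carrier_vec 6" "x $ 2 = x $ 5"
      have "x = embed5 (vec 5 ((!) [x $ 0, x $ 1, x $ 3, x $ 4, x $ 2]))"
        using x by (subst vec_eq_6) (simp_all add: embed5_def)
      then show "A * skew6 x * A\<^sup>T = c \<cdot>\<^sub>m skew6 x" using c by (metis vec_carrier)
    qed
    then show "A \<in> group_center ?G \<longleftrightarrow> (\<exists>c. \<forall>x\<in>carrier_vec 5. A * skew6 (embed5 x) * A\<^sup>T = c \<cdot>\<^sub>m skew6 (embed5 x))"
      using center_Sp[OF A] scalar_mat_skew6_congruence by auto
  qed (auto simp: group_center_subset)
  then show ?thesis by (simp add: B_model_def C_model_def)
qed

theorem mainTheorem4:
  shows "(B_model TYPE('a :: field) 1 \<cong> PSL TYPE('a) 2 \<and> C_model TYPE('a) 1 \<cong> PSL TYPE('a) 2)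
    \<and> (finite (UNIV :: 'a set) \<longrightarrow> B_model TYPE('a) 2 \<cong> C_model TYPE('a) 2)
    \<and> D_model TYPE('a) 2 \<cong> PSL TYPE('a) 2 \<times>\<times> PSL TYPE('a) 2
    \<and> (finite (UNIV :: 'a set) \<longrightarrow> D_model TYPE('a) 3 \<cong> PSL TYPE('a) 4)
    \<and> (finite (UNIV :: 'a set) \<and> CHAR('a) = 2 \<longrightarrow>
         (\<forall>r\<ge>1. B_model TYPE('a) r \<cong> C_model TYPE('a) r))"
proof (intro conjI impI allI)
  show "B_model TYPE('a) 1 \<cong> PSL TYPE('a) 2" by (rule B_model_1_iso)
  show "C_model TYPE('a) 1 \<cong> PSL TYPE('a) 2" by (rule C_model_1_iso)
  show "B_model TYPE('a) 2 \<cong> C_model TYPE('a) 2" by (rule B_model_2_iso)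
  show "D_model TYPE('a) 2 \<cong> PSL TYPE('a) 2 \<times>\<times> PSL TYPE('a) 2" by (rule D_model_2_iso)
  show "D_model TYPE('a) 3 \<cong> PSL TYPE('a) 4" by (rule D_model_3_iso)
next
  fix r :: nat
  assume "finite (UNIV :: 'a set) \<and> CHAR('a) = 2" and r: "1 \<le> r"
  then interpret char2_finite_field "TYPE('a)" r by unfold_locales auto
  show "B_model TYPE('a) r \<cong> C_model TYPE('a) r" using r by (rule B_model_iso_C_model)
qed

end
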